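(* Let $G=\mathbb{Z}^2\rtimes SL_2(\mathbb{Z})$ and suppose that $H$ is a maximal Haagerup subgroup of $G$. Then exactly one of the following cases holds. (1) $H=\mathbb{Z}^2\rtimes C'$ for some maximal amenable subgroup $C'<SL_2(\mathbb{Z})$. (2) $H=\{(c(g),g): g\in S\}$, where $S<SL_2(\mathbb{Z})$ is a non-amenable subgroup and $c:S\to\mathbb{Z}^2$ is a cocycle that cannot be extended (as a $\mathbb{Z}^2$-valued cocycle) to a strictly larger subgroup of $SL_2(\mathbb{Z})$. In particular, $H\cong S$, and $H$ is not conjugate to $S$ inside $\mathbb{Z}^2\rtimes SL_2(\mathbb{Z})$ unless $c$ is a coboundary, in which case $S=SL_2(\mathbb{Z})$. Conversely, each of the subgroups in (1) and (2) is a maximal Haagerup subgroup of $\mathbb{Z}^2\rtimes SL_2(\mathbb{Z})$.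
   Context: All groups are discrete and countable. A group has the Haagerup property (is Haagerup) if there is a sequence of positive-definite functions in $c_0$ of the group converging pointwise to $1$. A maximal Haagerup subgroup of $G$ is a subgroup of $G$ that has the Haagerup property and is not properly contained in any other subgroup of $G$ with the Haagerup property; maximal amenable subgroups are defined analogously. $SL_2(\mathbb{Z})$ acts on $\mathbb{Z}^2$ by matrix multiplication; elements of $\mathbb{Z}^2\rtimes SL_2(\mathbb{Z})$ are written $(a,g)$ with $(a,g)(b,h)=(a+gb,gh)$, and a subgroup $S<SL_2(\mathbb{Z})$ is identified with $\{(0,g):g\in S\}$. For $S<SL_2(\mathbb{Z})$, a cocycle is a map $c:S\to\mathbb{Z}^2$ with $c(g_1g_2)=g_1c(g_2)+c(g_1)$ for all $g_1,g_2\in S$; it is a coboundary if there is $\xi\in\mathbb{Z}^2$ with $c(g)=\xi-g\xi$ for all $g\in S$. *)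

theory Defs
  imports "HOL-Analysis.Analysis" "HOL-Algebra.Coset"
begin

type_synonym Z2 = "int ^ 2"
type_synonym Z2x2 = "(int ^ 2) ^ 2"

definition positive_definite_on ::
  "('a, 'm) monoid_scheme \<Rightarrow> ('a \<Rightarrow> complex) \<Rightarrow> bool" where
  "positive_definite_on G \<phi> \<longleftrightarrow>
     (\<forall>F a. finite F \<and> F \<subseteq> carrier G \<longrightarrow>
        (\<Sum>g\<in>F. \<Sum>h\<in>F. cnj (a g) * a h * \<phi> (inv\<^bsub>G\<^esub> g \<otimes>\<^bsub>G\<^esub> h)) \<in> \<real>\<^sub>\<ge>\<^sub>0)"

definition c0_on :: "('a, 'm) monoid_scheme \<Rightarrow> ('a \<Rightarrow> complex) \<Rightarrow> bool" where
  "c0_on G \<phi> \<longleftrightarrow> (\<forall>\<epsilon>>0. finite {g \<in> carrier G. \<epsilon> \<le> norm (\<phi> g)})"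

text \<open>Sequences (rather than nets) are the right notion for countable groups only.\<close>

definition haagerup :: "('a, 'm) monoid_scheme \<Rightarrow> bool" where
  "haagerup G \<longleftrightarrow>
     (\<exists>\<phi> :: nat \<Rightarrow> 'a \<Rightarrow> complex.
        (\<forall>n. positive_definite_on G (\<phi> n) \<and> c0_on G (\<phi> n)) \<and>
        (\<forall>g\<in>carrier G. (\<lambda>n. \<phi> n g) \<longlonglongrightarrow> 1))"

text \<open>Amenability of a discrete group: there is a left-invariant finitely additive
  probability measure defined on all subsets. Values of \<open>\<mu>\<close> outside the
  power set of the carrier are irrelevant.\<close>

definition amenable :: "('a, 'm) monoid_scheme \<Rightarrow> bool" where
  "amenable G \<longleftrightarrow>
     (\<exists>\<mu> :: 'a set \<Rightarrow> real.
        (\<forall>A. A \<subseteq> carrier G \<longrightarrow> 0 \<le> \<mu> A) \<and>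
        \<mu> (carrier G) = 1 \<and>
        (\<forall>A B. A \<subseteq> carrier G \<and> B \<subseteq> carrier G \<and> A \<inter> B = {} \<longrightarrow>
           \<mu> (A \<union> B) = \<mu> A + \<mu> B) \<and>
        (\<forall>g A. g \<in> carrier G \<and> A \<subseteq> carrier G \<longrightarrow> \<mu> (g <#\<^bsub>G\<^esub> A) = \<mu> A))"

definition maximal_haagerup_subgroup :: "'a set \<Rightarrow> ('a, 'm) monoid_scheme \<Rightarrow> bool" where
  "maximal_haagerup_subgroup H G \<longleftrightarrow>
     subgroup H G \<and> haagerup (G\<lparr>carrier := H\<rparr>) \<and>
     \<not> (\<exists>K. subgroup K G \<and> haagerup (G\<lparr>carrier := K\<rparr>) \<and> H \<subset> K)"

definition maximal_amenable_subgroup :: "'a set \<Rightarrow> ('a, 'm) monoid_scheme \<Rightarrow> bool" where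
  "maximal_amenable_subgroup H G \<longleftrightarrow>
     subgroup H G \<and> amenable (G\<lparr>carrier := H\<rparr>) \<and>
     \<not> (\<exists>K. subgroup K G \<and> amenable (G\<lparr>carrier := K\<rparr>) \<and> H \<subset> K)"

definition conjugate_in :: "('a, 'm) monoid_scheme \<Rightarrow> 'a set \<Rightarrow> 'a set \<Rightarrow> bool" where
  "conjugate_in G H K \<longleftrightarrow>
     (\<exists>x\<in>carrier G. H = (\<lambda>k. x \<otimes>\<^bsub>G\<^esub> k \<otimes>\<^bsub>G\<^esub> inv\<^bsub>G\<^esub> x) ` K)"

definition SL2Z :: "Z2x2 monoid" where
  "SL2Z = \<lparr>carrier = {A. det A = 1}, mult = (**), one = mat 1\<rparr>"

definition Z2_SL2Z :: "(Z2 \<times> Z2x2) monoid" where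
  "Z2_SL2Z =
     \<lparr>carrier = UNIV \<times> carrier SL2Z,
      mult = (\<lambda>(a, g) (b, h). (a + g *v b, g ** h)),
      one = (0, mat 1)\<rparr>"

lemma group_SL2Z: "group SL2Z"
proof (rule groupI)
  fix A assume "A \<in> carrier SL2Z"
  then have d: "A$1$1 * A$2$2 - A$1$2 * A$2$1 = 1"
    by (simp add: SL2Z_def det_2)
  define B :: Z2x2 where "B = vector [vector [A$2$2, - A$1$2], vector [- A$2$1, A$1$1]]"
  have "det B = 1" using d by (simp add: B_def det_2 algebra_simps)
  moreover have "B ** A = mat 1"
    using d by (simp add: B_def vec_eq_iff forall_2 matrix_matrix_mult_def sum_2 mat_def algebra_simps)
  ultimately show "\<exists>B\<in>carrier SL2Z. B \<otimes>\<^bsub>SL2Z\<^esub> A = \<one>\<^bsub>SL2Z\<^esub>"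
    by (auto simp: SL2Z_def)
qed (auto simp: SL2Z_def det_mul matrix_mul_assoc)

lemma group_Z2_SL2Z: "group Z2_SL2Z"
proof (rule groupI)
  fix x assume x: "x \<in> carrier Z2_SL2Z"
  obtain a A where [simp]: "x = (a, A)" by (cases x)
  have "A \<in> carrier SL2Z" using x by (simp add: Z2_SL2Z_def)
  then obtain B where B: "B \<in> carrier SL2Z" "B ** A = mat 1"
    using group.l_inv_ex[OF group_SL2Z] by (auto simp: SL2Z_def)
  then show "\<exists>y\<in>carrier Z2_SL2Z. y \<otimes>\<^bsub>Z2_SL2Z\<^esub> x = \<one>\<^bsub>Z2_SL2Z\<^esub>"
    by (intro bexI[of _ "(- (B *v a), B)"]) (auto simp: Z2_SL2Z_def)
qed (auto simp: Z2_SL2Z_def SL2Z_def det_mul matrix_mul_assoc matrix_vector_mul_assoc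
       matrix_vector_right_distrib add.assoc)

text \<open>Only the values of \<open>c\<close> on \<open>S\<close> matter in the following notions.\<close>

definition cocycle :: "Z2x2 set \<Rightarrow> (Z2x2 \<Rightarrow> Z2) \<Rightarrow> bool" where
  "cocycle S c \<longleftrightarrow> (\<forall>g\<in>S. \<forall>h\<in>S. c (g ** h) = g *v c h + c g)"

definition coboundary :: "Z2x2 set \<Rightarrow> (Z2x2 \<Rightarrow> Z2) \<Rightarrow> bool" where
  "coboundary S c \<longleftrightarrow> (\<exists>\<xi>. \<forall>g\<in>S. c g = \<xi> - g *v \<xi>)"

definition cocycle_extends_beyond ::
  "Z2x2 set \<Rightarrow> (Z2x2 \<Rightarrow> Z2) \<Rightarrow> bool" where
  "cocycle_extends_beyond S c \<longleftrightarrow>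
     (\<exists>T d. subgroup T SL2Z \<and> S \<subset> T \<and> cocycle T d \<and> (\<forall>g\<in>S. d g = c g))"

definition cocycle_graph ::
  "Z2x2 set \<Rightarrow> (Z2x2 \<Rightarrow> Z2) \<Rightarrow> (Z2 \<times> Z2x2) set" where
  "cocycle_graph S c = {(c g, g) | g. g \<in> S}"

definition inextendible_cocycle ::
  "Z2x2 set \<Rightarrow> (Z2x2 \<Rightarrow> Z2) \<Rightarrow> bool" where
  "inextendible_cocycle S c \<longleftrightarrow> cocycle S c \<and> \<not> cocycle_extends_beyond S c"

end

theory Submission
  imports Defs
begin

text \<open>
  Everything reduces to one dichotomy for a subgroup \<open>S\<close> of \<open>SL\<^sub>2(\<int>)\<close>: either any two elements of \<open>S\<close>
  with \<open>\<bar>trace\<bar> \<ge> 2\<close> commute, or \<open>S\<close> contains such \<open>g, h\<close> with \<open>g h \<noteq> h g\<close>.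

  In the first case the principal congruence subgroup of level 3 in \<open>S\<close> is abelian of finite index, so
  \<open>S\<close> and \<open>\<int>\<^sup>2 \<rtimes> S\<close> have Folner sets; hence \<open>S\<close> is amenable and \<open>\<int>\<^sup>2 \<rtimes> S\<close> is Haagerup.

  In the second case the forms \<open>p \<mapsto> p \<and> g p\<close> and \<open>p \<mapsto> p \<and> h p\<close> have no common real zero, and
  large powers of \<open>g\<close> (of \<open>h\<close>) move the region where the corresponding form is relatively large off
  itself. An invariant probability on the projective line would give each of these two regions mass at
  most 1/3, although they cover the line. Pulled back to \<open>S\<close>, this shows that \<open>S\<close> is not
  amenable. Applied to the spectral measure on the dual torus of almost invariant positive definite
  functions, concentrated near 0 but without mass at 0, it shows that no Haagerup subgroup of
  \<open>\<int>\<^sup>2 \<rtimes> SL\<^sub>2(\<int>)\<close> with image \<open>S\<close> meets \<open>\<int>\<^sup>2\<close> nontrivially. Only trigonometric polynomials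
  are needed for the latter, not Bochner's theorem.

  Finally \<open>SL\<^sub>2(\<int>)\<close> is Haagerup because \<open>(cosh d) powr (- s)\<close>, with \<open>d\<close> the hyperbolic displacement, is positive
  definite, so a subgroup meeting \<open>\<int>\<^sup>2\<close> trivially, being the graph of a cocycle, is Haagerup.
\<close>

section \<open>Orbits of elements of trace at least two\<close>

text \<open>The condition |trace| \<ge> 2 treats parabolic and hyperbolic elements alike. Along an
  orbit of such a \<open>g\<close> the form \<open>qform g\<close> is constant while the squared
  length is convex, strictly so where the form is nonzero. Hence two points of one orbit at which
  the form is relatively large are boundedly many steps apart, with a bound independent of the
  orbit; one power of \<open>g\<close> then works for the whole region.

  Three disjoint translates are used because two regions of mass 1/2 could still cover a probability
  space. With mass 1/3 each there remains a slack of 1/3, which pays for all errors of the spectral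
  version.

  The obstacle there is that the regions are sets of directions: even a smoothed indicator has no
  limit at the trivial character, whereas trigonometric polynomials approximate continuous functions
  only. Two auxiliary polynomials control this point. An energy has small integral because the
  positive definite function is close to 1 on finitely many elements, so the measure concentrates
  near the point. A squared Dirichlet average has small integral because the function tends to 0 at
  infinity, so the point itself carries no mass.\<close>

definition act :: "Z2x2 \<Rightarrow> real \<times> real \<Rightarrow> real \<times> real" where
  "act g p = (of_int (g$1$1) * fst p + of_int (g$1$2) * snd p,
              of_int (g$2$1) * fst p + of_int (g$2$2) * snd p)"

definition nsq :: "real \<times> real \<Rightarrow> real" where
  "nsq p = (fst p)\<^sup>2 + (snd p)\<^sup>2"

text \<open>The area spanned by \<open>p\<close> and \<open>g p\<close>: it vanishes when these are
  parallel, and a \<open>g\<close> of determinant 1 preserves it.\<close>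

definition qform :: "Z2x2 \<Rightarrow> real \<times> real \<Rightarrow> real" where
  "qform g p = fst p * snd (act g p) - snd p * fst (act g p)"

lemma mat_mult_entries:
  "((A::Z2x2) ** B)$i$j = A$i$1 * B$1$j + A$i$2 * B$2$j"
  by (simp add: matrix_matrix_mult_def sum_2)

lemma mat_vec_entries: "((A::Z2x2) *v v)$i = A$i$1 * v$1 + A$i$2 * v$2"
  by (simp add: matrix_vector_mult_def sum_2)

lemma mat2_eq_iff: "(A::Z2x2) = B \<longleftrightarrow>
   A$1$1 = B$1$1 \<and> A$1$2 = B$1$2 \<and> A$2$1 = B$2$1 \<and> A$2$2 = B$2$2"
  by (simp add: vec_eq_iff forall_2)

lemma SL2Z_simps [simp]:
  "g \<in> carrier SL2Z \<longleftrightarrow> det g = 1" "mult SL2Z = (**)" "one SL2Z = mat 1"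
  by (simp_all add: SL2Z_def)

lemma act_mult: "act (g ** h) p = act g (act h p)"
  by (simp add: act_def mat_mult_entries algebra_simps)

lemma act_one [simp]: "act (mat 1) p = p"
  by (simp add: act_def mat_def)

lemma nsq_nonneg: "0 \<le> nsq p" by (simp add: nsq_def)

lemma nsq_pos: "p \<noteq> 0 \<Longrightarrow> 0 < nsq p"
  by (cases p) (auto simp: nsq_def sum_power2_gt_zero_iff zero_prod_def)

lemma nsq_eq_0_iff: "nsq p = 0 \<longleftrightarrow> p = 0"
  by (cases p) (auto simp: nsq_def sum_power2_eq_zero_iff zero_prod_def)

abbreviation tr :: "Z2x2 \<Rightarrow> int" where "tr g \<equiv> g$1$1 + g$2$2"

lemma det_real:
  "det (g::Z2x2) = 1 \<Longrightarrow> real_of_int (g$1$1) * of_int (g$2$2) - of_int (g$1$2) * of_int (g$2$1) = 1"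
  by (simp add: det_2 flip: of_int_mult of_int_diff)

lemma qform_act:
  assumes "det g = 1" shows "qform g (act g p) = qform g p"
proof -
  note d = det_real[OF assms]
  have "qform g (act g p) = qform g p * (real_of_int (g$1$1) * of_int (g$2$2) - of_int (g$1$2) * of_int (g$2$1))"
    by (simp add: qform_def act_def) algebra
  then show ?thesis using d by simp
qed

lemma qform_act_funpow:
  assumes "det g = 1" shows "qform g ((act g ^^ k) p) = qform g p"
  by (induction k) (simp_all add: qform_act[OF assms])

text \<open>By Cayley-Hamilton \<open>g (g p) + p\<close> is \<open>tr g\<close> times
  \<open>g p\<close>, so the parallelogram law writes twice the second difference as
  \<open>(tr g)\<^sup>2 - 4\<close> times \<open>nsq (act g p)\<close> plus the squared length of
  \<open>g (g p) - p\<close>. The latter is bounded below by Lagrange's identity, since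
  \<open>g p\<close> and \<open>g (g p) - p\<close> span the area
  \<open>2 * qform g p\<close>.\<close>

lemma nsq_second_difference:
  assumes "det g = 1" "4 \<le> (tr g)\<^sup>2"
  shows "2 * (qform g p)\<^sup>2 \<le>
    nsq (act g p) * (nsq (act g (act g p)) + nsq p - 2 * nsq (act g p))"
proof -
  define a b c d where ab: "a = real_of_int (g$1$1)" "b = real_of_int (g$1$2)" "c = real_of_int (g$2$1)" "d = real_of_int (g$2$2)"
  have dt: "a * d - b * c = 1" using det_real[OF assms(1)] ab by simp
  have t4: "4 \<le> (a + d)\<^sup>2" using assms(2) unfolding ab
    by (metis of_int_add of_int_le_iff of_int_numeral of_int_power)
  obtain x y where p: "p = (x, y)" by (cases p)
  define X Y where XY: "X = a * x + b * y" "Y = c * x + d * y"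
  define X2 Y2 where XY2: "X2 = a * X + b * Y" "Y2 = c * X + d * Y"
  have ch1: "X2 + x = (a + d) * X"
    using dt unfolding XY2 XY by algebra
  have ch2: "Y2 + y = (a + d) * Y"
    using dt unfolding XY2 XY by algebra
  define q where "q = x * Y - y * X"
  have q2: "X * Y2 - Y * X2 = q"
    using dt unfolding q_def XY2 XY by algebra
  have cs: "4 * q\<^sup>2 \<le> (X\<^sup>2 + Y\<^sup>2) * ((X2 - x)\<^sup>2 + (Y2 - y)\<^sup>2)"
  proof -
    have "X * (Y2 - y) - Y * (X2 - x) = 2 * q" using q2 unfolding q_def by algebra
    then have "(X\<^sup>2 + Y\<^sup>2) * ((X2 - x)\<^sup>2 + (Y2 - y)\<^sup>2) = (2 * q)\<^sup>2 + (X * (X2 - x) + Y * (Y2 - y))\<^sup>2"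
      by algebra
    then show ?thesis by (simp add: power_mult_distrib)
  qed
  have e: "2 * (X2\<^sup>2 + Y2\<^sup>2 + (x\<^sup>2 + y\<^sup>2) - 2 * (X\<^sup>2 + Y\<^sup>2)) =
     ((a + d)\<^sup>2 - 4) * (X\<^sup>2 + Y\<^sup>2) + ((X2 - x)\<^sup>2 + (Y2 - y)\<^sup>2)"
    using ch1 ch2 by algebra
  have "4 * q\<^sup>2 \<le> (X\<^sup>2 + Y\<^sup>2) * (((a + d)\<^sup>2 - 4) * (X\<^sup>2 + Y\<^sup>2) + ((X2 - x)\<^sup>2 + (Y2 - y)\<^sup>2))"
    using cs t4 by (simp add: distrib_left add_increasing)
  also have "\<dots> = 2 * ((X\<^sup>2 + Y\<^sup>2) * (X2\<^sup>2 + Y2\<^sup>2 + (x\<^sup>2 + y\<^sup>2) - 2 * (X\<^sup>2 + Y\<^sup>2)))"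
    unfolding e[symmetric] by simp
  finally show ?thesis
    by (simp add: nsq_def qform_def act_def p q_def XY2 XY ab)
qed

text \<open>Slopes increase: if the slope at \<open>j\<close> is nonnegative, the values rise from
  there to \<open>k\<close>; otherwise they have been falling ever since 0.\<close>

lemma discrete_convex_le_max:
  fixes d :: "nat \<Rightarrow> real"
  assumes cvx: "\<And>j. Suc j < k \<Longrightarrow> 2 * d (Suc j) \<le> d j + d (Suc (Suc j))" and "j \<le> k"
  shows "d j \<le> max (d 0) (d k)"
proof -
  have mono: "d (Suc i) - d i \<le> d (Suc i') - d i'" if "i \<le> i'" "i' < k" for i i'
    using that
  proof (induction i' rule: dec_induct)
    case (step n)
    then show ?case using cvx[of n] by simp
  qed simp
  show ?thesis
  proof (cases "j < k \<and> 0 \<le> d (Suc j) - d j")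
    case True
    have "d j \<le> d i" if "j \<le> i" "i \<le> k" for i
      using that
    proof (induction i rule: dec_induct)
      case (step n)
      then show ?case using mono[of j n] True by simp
    qed simp
    then show ?thesis using \<open>j \<le> k\<close> by (simp add: le_max_iff_disj)
  next
    case False
    show ?thesis
    proof (cases "j = k")
      case False
      with \<open>\<not> (j < k \<and> _)\<close> \<open>j \<le> k\<close> have neg: "j < k" "d (Suc j) - d j < 0" by auto
      have "d j \<le> d 0"
      proof -
        have "d i \<le> d 0" if "i \<le> j" for i
          using that
        proof (induction i)
          case (Suc i)
          then show ?case using mono[of i j] neg by simp
        qed simp
        then show ?thesis by simp
      qed
      then show ?thesis by simp
    qed simp
  qed
qed

lemma funpow_act_mult: "act (g [^]\<^bsub>SL2Z\<^esub> (k::nat)) p = (act g ^^ k) p"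
proof (induction k arbitrary: p)
  case (Suc k)
  have "act (g [^]\<^bsub>SL2Z\<^esub> Suc k) p = (act g ^^ k) (act g p)"
    using Suc by (simp add: act_mult)
  then show ?case by (simp add: funpow_swap1)
qed simp

text \<open>If both ends of the stretch lie in the cone, convexity keeps every squared length in
  between below \<open>\<bar>qform g p\<bar> / \<delta>\<close>, and then each second difference is
  at least \<open>2 * \<bar>qform g p\<bar> * \<delta>\<close>. A bounded nonnegative sequence
  cannot keep such a curvature for long.\<close>

lemma orbit_leaves_cone:
  assumes g: "det g = 1" "4 \<le> (tr g)\<^sup>2" and \<delta>: "0 < \<delta>" and p: "p \<noteq> 0"
    and in0: "\<delta> * nsq p \<le> \<bar>qform g p\<bar>"
    and ink: "\<delta> * nsq ((act g ^^ k) p) \<le> \<bar>qform g p\<bar>"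
  shows "real k \<le> 1 / \<delta>\<^sup>2 + 1"
proof (cases "k \<le> 1")
  case False
  define q where "q = \<bar>qform g p\<bar>"
  define b where "b j = nsq ((act g ^^ j) p)" for j
  define M where "M = 1 / \<delta>"
  have M: "M > 0" using \<delta> by (simp add: M_def)
  have q: "0 < q" using in0 nsq_pos[OF p] \<delta> unfolding q_def
    by (smt (verit) mult_pos_pos)
  have b0: "b 0 \<le> M * q" and bk: "b k \<le> M * q"
    using in0 ink \<delta> by (auto simp: b_def q_def M_def field_simps)
  have nn: "0 \<le> b j" for j by (simp add: b_def nsq_nonneg)
  have step: "2 * q\<^sup>2 \<le> b (Suc j) * (b (Suc (Suc j)) + b j - 2 * b (Suc j))" for j
    using nsq_second_difference[OF g, of "(act g ^^ j) p"]
    by (simp add: b_def q_def qform_act_funpow[OF g(1)])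
  have pos: "0 < b (Suc j)" for j
  proof (rule ccontr)
    assume "\<not> ?thesis" with nn[of "Suc j"] have "b (Suc j) = 0" by simp
    with step[of j] q show False by simp
  qed
  have sd: "2 * q\<^sup>2 / b (Suc j) \<le> b (Suc (Suc j)) + b j - 2 * b (Suc j)" for j
    using step[of j] pos[of j] by (simp add: field_simps)
  have bd: "b j \<le> M * q" if "j \<le> k" for j
  proof -
    have "b j \<le> max (b 0) (b k)"
    proof (rule discrete_convex_le_max[OF _ that])
      fix j show "2 * b (Suc j) \<le> b j + b (Suc (Suc j))"
        using sd[of j] divide_nonneg_pos[OF _ pos[of j], of "2 * q\<^sup>2"] mult_nonneg_nonneg[OF _ zero_le_power2, of 2 q]
        by linarith
    qed
    with b0 bk show ?thesis by simp
  qed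
  \<comment> \<open>The parabola \<open>j * (k - j)\<close> has second difference -2, so
    \<open>q / M\<close> times it can be added without losing convexity. It vanishes at both ends
    and is \<open>k - 1\<close> at \<open>j = 1\<close>, which bounds \<open>k\<close>.\<close>
  have "b 1 + q / M * (real 1 * (real k - real 1)) \<le> max (b 0 + q / M * (real 0 * (real k - real 0))) (b k + q / M * (real k * (real k - real k)))"
  proof (rule discrete_convex_le_max)
    show "1 \<le> k" using False by simp
  next
    fix j assume j: "Suc j < k"
    have "2 * q / M = 2 * q\<^sup>2 / (M * q)" using q by (simp add: power2_eq_square)
    also have "\<dots> \<le> 2 * q\<^sup>2 / b (Suc j)"
      using bd[of "Suc j"] j pos[of j] M q by (intro divide_left_mono) auto
    finally have "2 * q / M \<le> b (Suc (Suc j)) + b j - 2 * b (Suc j)" using sd[of j] by simp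
    moreover have "real (Suc j) * (real k - real (Suc j)) * 2 - real j * (real k - real j)
        - real (Suc (Suc j)) * (real k - real (Suc (Suc j))) = 2"
      by (simp add: algebra_simps)
    then have "q / M * (real (Suc j) * (real k - real (Suc j)) * 2 - real j * (real k - real j)
        - real (Suc (Suc j)) * (real k - real (Suc (Suc j)))) = 2 * q / M" by simp
    ultimately show "2 * (b (Suc j) + q / M * (real (Suc j) * (real k - real (Suc j)))) \<le>
      b j + q / M * (real j * (real k - real j)) + (b (Suc (Suc j)) + q / M * (real (Suc (Suc j)) * (real k - real (Suc (Suc j)))))"
      by (simp only: right_diff_distrib distrib_left) argo
  qed
  then have "q / M * (real k - 1) \<le> M * q" using b0 bk nn[of 1] by simp
  then have "q * (real k - 1) \<le> q * M\<^sup>2" using M by (simp add: field_simps power2_eq_square)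
  then have "real k - 1 \<le> M\<^sup>2" using q by (simp only: mult_le_cancel_left_pos)
  then show ?thesis by (simp add: M_def power_divide)
next
  case True
  then have "real k \<le> 1" by simp
  moreover have "0 \<le> 1 / \<delta>\<^sup>2" by simp
  ultimately show ?thesis by linarith
qed

text \<open>The only integer squares at distance 4 are 0 and 4. Applied to the discriminant of the
  characteristic polynomial, this leaves only the traces 2 and -2 for a rational
  eigendirection.\<close>

lemma int_square_minus_four:
  fixes t k :: int assumes "t\<^sup>2 - 4 = k\<^sup>2" shows "k = 0"
proof (rule ccontr)
  assume "k \<noteq> 0"
  then have k: "\<bar>k\<bar> \<ge> 1" by simp
  have e: "\<bar>t\<bar>\<^sup>2 = \<bar>k\<bar>\<^sup>2 + 4" using assms by simp
  have "\<bar>t\<bar> > \<bar>k\<bar>" using e by (smt (verit) power_mono abs_ge_zero)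
  then have "\<bar>t\<bar> \<ge> \<bar>k\<bar> + 2 \<or> \<bar>t\<bar> = \<bar>k\<bar> + 1" by linarith
  then show False
  proof
    assume "\<bar>t\<bar> \<ge> \<bar>k\<bar> + 2"
    then have "\<bar>t\<bar>\<^sup>2 \<ge> (\<bar>k\<bar> + 2)\<^sup>2" by (intro power_mono) auto
    moreover have "(\<bar>k\<bar> + 2)\<^sup>2 = \<bar>k\<bar>\<^sup>2 + 4 * \<bar>k\<bar> + 4" by algebra
    ultimately show False using e k by linarith
  next
    assume "\<bar>t\<bar> = \<bar>k\<bar> + 1"
    then have "\<bar>k\<bar>\<^sup>2 + 2 * \<bar>k\<bar> + 1 = \<bar>k\<bar>\<^sup>2 + 4" using e by (simp add: power2_sum)
    then show False by presburger
  qed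
qed


section \<open>Non-commuting pairs and the cones of their quadratic forms\<close>

definition noncomm_pair :: "Z2x2 \<Rightarrow> Z2x2 \<Rightarrow> bool" where
  "noncomm_pair g h \<longleftrightarrow> det g = 1 \<and> det h = 1 \<and> 4 \<le> (tr g)\<^sup>2 \<and> 4 \<le> (tr h)\<^sup>2 \<and> g ** h \<noteq> h ** g"

text \<open>Scalars commute with everything, and traceless 2x2 matrices commute iff they are
  proportional. The equations are the 2x2 minors of the two traceless parts, equivalently of the
  coefficient vectors of \<open>qform g\<close> and \<open>qform h\<close>.\<close>

lemma commute_iff_proportional:
  "(g::Z2x2) ** h = h ** g \<longleftrightarrow>
     g$1$2 * h$2$1 = h$1$2 * g$2$1 \<and>
     (g$1$1 - g$2$2) * h$1$2 = (h$1$1 - h$2$2) * g$1$2 \<and>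
     (g$1$1 - g$2$2) * h$2$1 = (h$1$1 - h$2$2) * g$2$1"
  by (auto simp: mat2_eq_iff mat_mult_entries algebra_simps)

text \<open>An integral quadratic form with a rational zero has square discriminant.\<close>

lemma rational_zero_trace:
  fixes m n :: int
  assumes "det g = 1" "4 \<le> (tr g)\<^sup>2" "(m, n) \<noteq> (0, 0)"
    and z: "g$2$1 * m\<^sup>2 + (g$2$2 - g$1$1) * m * n - g$1$2 * n\<^sup>2 = 0"
  shows "(tr g)\<^sup>2 = 4"
proof -
  define a b c d where ab: "a = g$1$1" "b = g$1$2" "c = g$2$1" "d = g$2$2"
  have dt: "a * d - b * c = 1" using assms(1) by (simp add: det_2 ab)
  have D: "(a + d)\<^sup>2 - 4 = (d - a)\<^sup>2 + 4 * b * c" using dt by algebra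
  have z': "c * m\<^sup>2 + (d - a) * m * n - b * n\<^sup>2 = 0" using z ab by simp
  have 1: "n\<^sup>2 * ((a + d)\<^sup>2 - 4) = (2 * c * m + (d - a) * n)\<^sup>2"
    using D z' by algebra
  have 2: "m\<^sup>2 * ((a + d)\<^sup>2 - 4) = (2 * b * n - (d - a) * m)\<^sup>2"
    using D z' by algebra
  have sq: "\<exists>k. x = k\<^sup>2" if "u\<^sup>2 * x = v\<^sup>2" "u \<noteq> 0" for u v x :: int
  proof -
    have "u\<^sup>2 dvd v\<^sup>2" using that(1) by (metis dvd_triv_left)
    then have "u dvd v" by simp
    then obtain k where "v = u * k" by blast
    with that have "x = k\<^sup>2" by (simp add: power_mult_distrib)
    then show ?thesis by blast
  qed
  have "\<exists>k. (a + d)\<^sup>2 - 4 = k\<^sup>2"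
    using sq[OF 1] sq[OF 2] assms(3) by auto
  then show ?thesis using int_square_minus_four ab by fastforce
qed

lemma parabolic_discriminant:
  assumes "det (g::Z2x2) = 1" "(tr g)\<^sup>2 = 4"
  shows "(g$2$2 - g$1$1)\<^sup>2 = 4 * g$2$1 * - g$1$2"
  using assms unfolding det_2 by algebra

lemma qform_expand:
  "qform g (x, y) = of_int (g$2$1) * x\<^sup>2 + of_int (g$2$2 - g$1$1) * x * y - of_int (g$1$2) * y\<^sup>2"
  by (simp add: qform_def act_def power2_eq_square algebra_simps)

text \<open>A common zero is a common eigendirection. It turns out to be rational, which forces both
  traces to be 2 or -2; but two such matrices with a common eigendirection commute.\<close>

lemma no_common_zero:
  assumes "noncomm_pair g h" "qform g p = 0" "qform h p = 0"
  shows "p = 0"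
proof (rule ccontr)
  assume "p \<noteq> 0"
  obtain x y where p: "p = (x, y)" by (cases p)
  with \<open>p \<noteq> 0\<close> have xy: "x \<noteq> 0 \<or> y \<noteq> 0" by (auto simp: zero_prod_def)
  define A B C where AB: "A = g$2$1" "B = g$2$2 - g$1$1" "C = - g$1$2"
  define A' B' C' where AB': "A' = h$2$1" "B' = h$2$2 - h$1$1" "C' = - h$1$2"
  have np: "\<not> (A * C' = A' * C \<and> B * C' = B' * C \<and> A * B' = A' * B)"
    using assms(1) unfolding noncomm_pair_def commute_iff_proportional AB AB' 
    by (auto simp: algebra_simps)
  have z: "of_int A * x\<^sup>2 + of_int B * x * y + of_int C * y\<^sup>2 = 0"
    using assms(2) unfolding p qform_expand AB by simp
  have z': "of_int A' * x\<^sup>2 + of_int B' * x * y + of_int C' * y\<^sup>2 = 0"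
    using assms(3) unfolding p qform_expand AB' by simp
  text \<open>Eliminating a coefficient from the two forms shows that a common zero of
    non-proportional forms is rational.\<close>
  have r1: "of_int (A * B' - A' * B) * x = - (of_int (A * C' - A' * C) * y)" if "y \<noteq> 0"
  proof -
    have "y * (of_int (A * B' - A' * B) * x + of_int (A * C' - A' * C) * y) = 0"
      unfolding of_int_diff of_int_mult using z z' by algebra
    with that show ?thesis by (simp add: eq_neg_iff_add_eq_0)
  qed
  have r2: "of_int (A * C' - A' * C) * x = - (of_int (B * C' - B' * C) * y)" if "x \<noteq> 0"
  proof -
    have "x * (of_int (A * C' - A' * C) * x + of_int (B * C' - B' * C) * y) = 0"
      unfolding of_int_diff of_int_mult using z z' by algebra
    with that show ?thesis by (simp add: eq_neg_iff_add_eq_0)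
  qed
  have "\<exists>m n t. (m, n) \<noteq> (0, 0) \<and> x = t * real_of_int m \<and> y = t * real_of_int n"
  proof (cases "x = 0 \<or> y = 0")
    case True
    then show ?thesis
    proof
      assume "x = 0" then show ?thesis by (intro exI[of _ 0] exI[of _ 1] exI[of _ y]) simp
    next
      assume "y = 0" then show ?thesis by (intro exI[of _ 1] exI[of _ 0] exI[of _ x]) simp
    qed
  next
    case False
    have "\<exists>m n. (m, n) \<noteq> (0, 0) \<and> of_int n * x = of_int m * y"
    proof (cases "A * B' - A' * B = 0 \<and> A * C' - A' * C = 0")
      case True
      then have "B * C' - B' * C \<noteq> 0" using np by auto
      then have "real_of_int (B * C' - B' * C) \<noteq> 0" using of_int_eq_0_iff by blast
      with r2 True False show ?thesis by (metis mult_eq_0_iff mult_zero_left neg_equal_0_iff_equal of_int_0)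
    next
      case F: False
      have "of_int (A * B' - A' * B) * x = of_int (- (A * C' - A' * C)) * y"
        using r1 False by (metis of_int_minus mult_minus_left)
      moreover have "(- (A * C' - A' * C), A * B' - A' * B) \<noteq> (0, 0)" using F by auto
      ultimately show ?thesis by blast
    qed
    then obtain m n where mn: "(m, n) \<noteq> (0, 0)" "of_int n * x = of_int m * y" by blast
    then have "n \<noteq> 0" using False by auto
    with mn show ?thesis
      by (intro exI[of _ m] exI[of _ n] exI[of _ "y / of_int n"]) (auto simp: field_simps)
  qed
  then obtain m n t where mn: "(m, n) \<noteq> (0, 0)" and t: "x = t * real_of_int m" "y = t * real_of_int n" by blast
  have t0: "t \<noteq> 0" using xy t by auto
  have int_zero: "U * m\<^sup>2 + V * m * n + W * n\<^sup>2 = 0"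
    if "of_int U * x\<^sup>2 + of_int V * x * y + of_int W * y\<^sup>2 = 0" for U V W :: int
  proof -
    have "t\<^sup>2 * of_int (U * m\<^sup>2 + V * m * n + W * n\<^sup>2) = 0"
      using that unfolding t of_int_mult of_int_add of_int_power by algebra
    then have "real_of_int (U * m\<^sup>2 + V * m * n + W * n\<^sup>2) = 0"
      using t0 by (metis mult_eq_0_iff power_not_zero)
    then show ?thesis by (simp only: of_int_eq_0_iff)
  qed
  have iz: "A * m\<^sup>2 + B * m * n + C * n\<^sup>2 = 0" "A' * m\<^sup>2 + B' * m * n + C' * n\<^sup>2 = 0"
    using int_zero z z' by blast+
  have "(tr g)\<^sup>2 = 4" "(tr h)\<^sup>2 = 4"
    using assms(1) mn iz unfolding noncomm_pair_def AB AB'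
    by (auto intro!: rational_zero_trace[of _ m n])
  then have disc: "B\<^sup>2 = 4 * A * C" "B'\<^sup>2 = 4 * A' * C'"
    using assms(1) parabolic_discriminant unfolding noncomm_pair_def AB AB' by auto
  text \<open>Both forms are multiples of the square of the same linear form.\<close>
  have dbl: "2 * U * m + V * n = 0 \<and> V * m + 2 * W * n = 0"
    if "U * m\<^sup>2 + V * m * n + W * n\<^sup>2 = 0" "V\<^sup>2 = 4 * U * W" for U V W :: int
  proof -
    have "(2 * U * m + V * n)\<^sup>2 = 0" "(V * m + 2 * W * n)\<^sup>2 = 0"
      using that by algebra+
    then show ?thesis by simp
  qed
  have l: "2 * A * m + B * n = 0" "B * m + 2 * C * n = 0" "2 * A' * m + B' * n = 0" "B' * m + 2 * C' * n = 0"
    using dbl[OF iz(1) disc(1)] dbl[OF iz(2) disc(2)] by auto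
  have "m = 0 \<or> (A * B' = A' * B \<and> B * C' = B' * C \<and> A * C' = A' * C)" 
  proof (cases "m = 0")
    case False
    have "m * (A * B' - A' * B) = 0" "m * (B * C' - B' * C) = 0" "m\<^sup>2 * (4 * (A * C' - A' * C)) = 0"
      using l by algebra+
    with False show ?thesis by simp
  qed simp
  moreover have "n = 0 \<or> (A * B' = A' * B \<and> B * C' = B' * C \<and> A * C' = A' * C)" 
  proof (cases "n = 0")
    case False
    have "n * (A * B' - A' * B) = 0" "n * (B * C' - B' * C) = 0" "n\<^sup>2 * (4 * (A * C' - A' * C)) = 0"
      using l by algebra+
    with False show ?thesis by simp
  qed simp
  ultimately show False using np mn by auto
qed

lemma qform_scale: "qform g (r *\<^sub>R p) = r\<^sup>2 * qform g p"
  by (simp add: qform_def act_def power2_eq_square algebra_simps)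

lemma nsq_norm: "nsq p = (norm p)\<^sup>2"
  by (cases p) (simp add: nsq_def norm_prod_def)

lemma continuous_qform [continuous_intros]:
  "continuous_on S f \<Longrightarrow> continuous_on S (\<lambda>x. qform g (f x))"
  unfolding qform_def act_def by (auto intro!: continuous_intros)

lemma continuous_nsq [continuous_intros]:
  "continuous_on S f \<Longrightarrow> continuous_on S (\<lambda>x. nsq (f x))"
  unfolding nsq_def by (auto intro!: continuous_intros)

text \<open>Both sides are homogeneous of degree two, so compactness of the unit circle turns the
  absence of a common zero into a uniform bound.\<close>

lemma noncomm_pair_bound:
  assumes "noncomm_pair g h"
  obtains \<delta> where "0 < \<delta>" "\<And>p. \<delta> * nsq p \<le> \<bar>qform g p\<bar> + \<bar>qform h p\<bar>"
proof -
  define f where "f p = \<bar>qform g p\<bar> + \<bar>qform h p\<bar>" for p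
  have "continuous_on (sphere 0 1) f"
    unfolding f_def by (intro continuous_intros)
  moreover have "sphere (0::real \<times> real) 1 \<noteq> {}" by simp
  ultimately obtain p0 where p0: "p0 \<in> sphere 0 1" "\<And>p. p \<in> sphere 0 1 \<Longrightarrow> f p0 \<le> f p"
    using continuous_attains_inf[OF compact_sphere] by metis
  have "f p0 > 0"
  proof (rule ccontr)
    assume "\<not> ?thesis"
    then have "qform g p0 = 0" "qform h p0 = 0" by (auto simp: f_def)
    then have "p0 = 0" by (rule no_common_zero[OF assms])
    with p0(1) show False by simp
  qed
  moreover have "f p0 * nsq p \<le> \<bar>qform g p\<bar> + \<bar>qform h p\<bar>" for p
  proof (cases "p = 0")
    case False
    define u where "u = inverse (norm p) *\<^sub>R p"
    have p: "p = norm p *\<^sub>R u" using False by (simp add: u_def)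
    have "f p0 \<le> f u" using False by (intro p0(2)) (simp add: u_def)
    then have "(norm p)\<^sup>2 * f p0 \<le> (norm p)\<^sup>2 * f u" by (simp add: mult_left_mono)
    also have "\<dots> = f (norm p *\<^sub>R u)"
      by (simp add: f_def qform_scale abs_mult distrib_left)
    finally show ?thesis using p by (simp add: f_def nsq_norm mult.commute)
  qed (simp add: nsq_eq_0_iff[THEN iffD2])
  ultimately show ?thesis using that by blast
qed

text \<open>A union of punctured lines, that is, a region of the projective line. For a
  non-commuting pair the two regions cover everything once the constant of
  \<open>noncomm_pair_bound\<close> is halved.\<close>

definition qcone :: "Z2x2 \<Rightarrow> real \<Rightarrow> (real \<times> real) set" where
  "qcone g \<delta> = {p. p \<noteq> 0 \<and> \<delta> * nsq p \<le> \<bar>qform g p\<bar>}"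

lemma act_nonzero:
  assumes "det g = 1" "p \<noteq> 0" shows "act g p \<noteq> 0"
proof
  assume "act g p = 0"
  obtain x y where p: "p = (x, y)" by (cases p)
  define a b c d where ab: "a = real_of_int (g$1$1)" "b = real_of_int (g$1$2)" "c = real_of_int (g$2$1)" "d = real_of_int (g$2$2)"
  have dt: "a * d - b * c = 1" using det_real[OF assms(1)] ab by simp
  have "a * x + b * y = 0" "c * x + d * y = 0"
    using \<open>act g p = 0\<close> by (auto simp: act_def p ab zero_prod_def)
  then have "x = 0" "y = 0" using dt by algebra+
  with assms(2) p show False by (simp add: zero_prod_def)
qed

text \<open>The bound of \<open>orbit_leaves_cone\<close> does not depend on \<open>p\<close>, so a
  power of \<open>g\<close> beyond it works for the whole cone, and so does its square. Excluding
  both \<open>f\<close> and \<open>f f\<close> is what makes three successive translates of the cone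
  pairwise disjoint.\<close>

lemma cone_escape:
  assumes g: "det g = 1" "4 \<le> (tr g)\<^sup>2" and \<delta>: "0 < \<delta>"
  obtains f where "f \<in> range (\<lambda>n::nat. g [^]\<^bsub>SL2Z\<^esub> n)" 
    "\<And>p. p \<in> qcone g \<delta> \<Longrightarrow> act f p \<notin> qcone g \<delta> \<and> act f (act f p) \<notin> qcone g \<delta>"
proof -
  obtain J :: nat where J: "real J > 1 / \<delta>\<^sup>2 + 1" using reals_Archimedean2 by blast
  have *: "(act g ^^ k) p \<notin> qcone g \<delta>" if "p \<in> qcone g \<delta>" "k \<ge> J" for k p
  proof
    assume "(act g ^^ k) p \<in> qcone g \<delta>"
    then have "real k \<le> 1 / \<delta>\<^sup>2 + 1"
      using that(1) by (intro orbit_leaves_cone[OF g \<delta>, of p]) (auto simp: qcone_def qform_act_funpow[OF g(1)])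
    with J that(2) show False by simp
  qed
  show ?thesis
  proof (rule that[of "g [^]\<^bsub>SL2Z\<^esub> J"])
    fix p assume "p \<in> qcone g \<delta>"
    then show "act (g [^]\<^bsub>SL2Z\<^esub> J) p \<notin> qcone g \<delta> \<and> act (g [^]\<^bsub>SL2Z\<^esub> J) (act (g [^]\<^bsub>SL2Z\<^esub> J) p) \<notin> qcone g \<delta>"
      using *[of p J] *[of p "J + J"] by (simp add: funpow_act_mult funpow_add)
  qed simp
qed

section \<open>The Haagerup property of SL2Z\<close>

definition psd :: "'a set \<Rightarrow> ('a \<Rightarrow> 'a \<Rightarrow> complex) \<Rightarrow> bool" where
  "psd F K \<longleftrightarrow> (\<forall>a. (\<Sum>g\<in>F. \<Sum>h\<in>F. cnj (a g) * a h * K g h) \<in> \<real>\<^sub>\<ge>\<^sub>0)"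

lemma cnj_mult_self_nonneg: "cnj z * z \<in> \<real>\<^sub>\<ge>\<^sub>0"
  by (simp add: complex_nonneg_Reals_iff)

lemma sum_nonneg_Reals: "(\<And>i. i \<in> I \<Longrightarrow> f i \<in> \<real>\<^sub>\<ge>\<^sub>0) \<Longrightarrow> sum f I \<in> (\<real>\<^sub>\<ge>\<^sub>0 :: complex set)"
  by (induction I rule: infinite_finite_induct) auto

lemma psd_rank_one: "psd F (\<lambda>g h. cnj (u g) * u h)"
  unfolding psd_def
proof
  fix a
  have "(\<Sum>g\<in>F. \<Sum>h\<in>F. cnj (a g) * a h * (cnj (u g) * u h)) = cnj (\<Sum>g\<in>F. a g * u g) * (\<Sum>h\<in>F. a h * u h)"
    unfolding cnj_sum sum_product by (intro sum.cong refl) (simp add: mult_ac)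
  then show "(\<Sum>g\<in>F. \<Sum>h\<in>F. cnj (a g) * a h * (cnj (u g) * u h)) \<in> \<real>\<^sub>\<ge>\<^sub>0"
    by (simp only: cnj_mult_self_nonneg)
qed

lemma psd_sum:
  assumes "\<And>i. i \<in> I \<Longrightarrow> psd F (K i)" shows "psd F (\<lambda>g h. \<Sum>i\<in>I. K i g h)"
  unfolding psd_def
proof
  fix a
  have "(\<Sum>g\<in>F. \<Sum>h\<in>F. cnj (a g) * a h * (\<Sum>i\<in>I. K i g h)) = (\<Sum>g\<in>F. \<Sum>i\<in>I. \<Sum>h\<in>F. cnj (a g) * a h * K i g h)"
    unfolding sum_distrib_left by (intro sum.cong refl sum.swap)
  also have "\<dots> = (\<Sum>i\<in>I. \<Sum>g\<in>F. \<Sum>h\<in>F. cnj (a g) * a h * K i g h)" by (rule sum.swap)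
  finally show "(\<Sum>g\<in>F. \<Sum>h\<in>F. cnj (a g) * a h * (\<Sum>i\<in>I. K i g h)) \<in> \<real>\<^sub>\<ge>\<^sub>0"
    using assms by (simp add: sum_nonneg_Reals psd_def)
qed

lemma psd_scale:
  assumes "psd F K" "c \<in> \<real>\<^sub>\<ge>\<^sub>0" shows "psd F (\<lambda>g h. c * K g h)"
  unfolding psd_def
proof
  fix a
  have "(\<Sum>g\<in>F. \<Sum>h\<in>F. cnj (a g) * a h * (c * K g h)) = c * (\<Sum>g\<in>F. \<Sum>h\<in>F. cnj (a g) * a h * K g h)"
    by (simp add: sum_distrib_left mult_ac)
  then show "(\<Sum>g\<in>F. \<Sum>h\<in>F. cnj (a g) * a h * (c * K g h)) \<in> \<real>\<^sub>\<ge>\<^sub>0"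
    using assms by (simp add: psd_def)
qed

lemma psd_weight:
  assumes "psd F K" shows "psd F (\<lambda>g h. cnj (w g) * w h * K g h)"
  unfolding psd_def
proof
  fix a
  have "(\<Sum>g\<in>F. \<Sum>h\<in>F. cnj (a g * w g) * (a h * w h) * K g h) \<in> \<real>\<^sub>\<ge>\<^sub>0"
    using assms unfolding psd_def by (rule spec)
  then show "(\<Sum>g\<in>F. \<Sum>h\<in>F. cnj (a g) * a h * (cnj (w g) * w h * K g h)) \<in> \<real>\<^sub>\<ge>\<^sub>0"
    by (simp add: mult_ac)
qed

lemma psd_sums:
  assumes "\<And>n. psd F (K n)" "\<And>g h. g \<in> F \<Longrightarrow> h \<in> F \<Longrightarrow> (\<lambda>n. K n g h) sums L g h"
  shows "psd F L"
  unfolding psd_def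
proof
  fix a
  have "(\<lambda>n. \<Sum>g\<in>F. \<Sum>h\<in>F. cnj (a g) * a h * K n g h) sums (\<Sum>g\<in>F. \<Sum>h\<in>F. cnj (a g) * a h * L g h)"
    by (intro sums_sum sums_mult assms(2))
  then have "(\<lambda>N. \<Sum>n<N. \<Sum>g\<in>F. \<Sum>h\<in>F. cnj (a g) * a h * K n g h) \<longlonglongrightarrow> (\<Sum>g\<in>F. \<Sum>h\<in>F. cnj (a g) * a h * L g h)"
    by (simp add: sums_def)
  then show "(\<Sum>g\<in>F. \<Sum>h\<in>F. cnj (a g) * a h * L g h) \<in> \<real>\<^sub>\<ge>\<^sub>0"
    using assms(1)[unfolded psd_def]
    by (intro Lim_in_closed_set[OF closed_nonneg_Reals_complex])
       (simp_all add: sum_nonneg_Reals psd_def)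
qed

lemma psd_cong: "(\<And>g h. g \<in> F \<Longrightarrow> h \<in> F \<Longrightarrow> K g h = L g h) \<Longrightarrow> psd F K = psd F L"
  by (simp add: psd_def)

lemma positive_definite_on_psd:
  "positive_definite_on G \<phi> \<longleftrightarrow>
    (\<forall>F. finite F \<and> F \<subseteq> carrier G \<longrightarrow> psd F (\<lambda>g h. \<phi> (inv\<^bsub>G\<^esub> g \<otimes>\<^bsub>G\<^esub> h)))"
  by (auto simp: positive_definite_on_def psd_def)

text \<open>Weights of points with the same image are added up. This matters for non-injective maps,
  since positive definiteness is stated for sets, which cannot list a group element twice.\<close>

lemma psd_image:
  fixes f :: "'a \<Rightarrow> 'b"
  assumes "psd (f ` F) K" "finite F"
  shows "psd F (\<lambda>g h. K (f g) (f h))"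
  unfolding psd_def
proof
  fix a :: "'a \<Rightarrow> complex"
  define b where "b y = (\<Sum>g | g \<in> F \<and> f g = y. a g)" for y
  have "(\<Sum>g\<in>F. \<Sum>h\<in>F. cnj (a g) * a h * K (f g) (f h)) =
      (\<Sum>y\<in>f ` F. \<Sum>g | g \<in> F \<and> f g = y. \<Sum>z\<in>f ` F. \<Sum>h | h \<in> F \<and> f h = z. cnj (a g) * a h * K y z)"
    by (subst sum.image_gen[OF assms(2), of _ f], intro sum.cong refl, subst sum.image_gen[OF assms(2), of _ f])
       (auto intro!: sum.cong)
  also have "\<dots> = (\<Sum>y\<in>f ` F. \<Sum>z\<in>f ` F. cnj (b y) * b z * K y z)"
  proof (rule sum.cong[OF refl])
    fix y
    have "(\<Sum>g | g \<in> F \<and> f g = y. \<Sum>z\<in>f ` F. \<Sum>h | h \<in> F \<and> f h = z. cnj (a g) * a h * K y z) =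
        (\<Sum>z\<in>f ` F. \<Sum>g | g \<in> F \<and> f g = y. \<Sum>h | h \<in> F \<and> f h = z. cnj (a g) * a h * K y z)"
      by (rule sum.swap)
    also have "\<dots> = (\<Sum>z\<in>f ` F. cnj (b y) * b z * K y z)"
      unfolding b_def cnj_sum sum_product by (simp only: sum_distrib_right)
    finally show "(\<Sum>g | g \<in> F \<and> f g = y. \<Sum>z\<in>f ` F. \<Sum>h | h \<in> F \<and> f h = z. cnj (a g) * a h * K y z) =
        (\<Sum>z\<in>f ` F. cnj (b y) * b z * K y z)" .
  qed
  also have "\<dots> \<in> \<real>\<^sub>\<ge>\<^sub>0" using assms(1) by (simp add: psd_def)
  finally show "(\<Sum>g\<in>F. \<Sum>h\<in>F. cnj (a g) * a h * K (f g) (f h)) \<in> \<real>\<^sub>\<ge>\<^sub>0" .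
qed

text \<open>Positive definiteness pulls back along any homomorphism; injectivity serves c0, because
  preimages of finite sets have to be finite.\<close>

lemma haagerup_pullback:
  assumes G: "group G" and H: "group H" and f: "f \<in> hom G H" "inj_on f (carrier G)" and h: "haagerup H"
  shows "haagerup G"
proof -
  interpret group_hom G H f using G H f(1) by (simp add: group_hom_def group_hom_axioms_def)
  obtain \<phi> where \<phi>: "\<And>n::nat. positive_definite_on H (\<phi> n)" "\<And>n. c0_on H (\<phi> n)"
      "\<And>g. g \<in> carrier H \<Longrightarrow> (\<lambda>n. \<phi> n g) \<longlonglongrightarrow> 1"
    using h unfolding haagerup_def by blast
  show ?thesis unfolding haagerup_def
  proof (intro exI[of _ "\<lambda>n g. \<phi> n (f g)"] conjI allI ballI)
    fix n
    show "positive_definite_on G (\<lambda>g. \<phi> n (f g))"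
      unfolding positive_definite_on_psd
    proof (intro allI impI)
      fix F assume F: "finite F \<and> F \<subseteq> carrier G"
      then have "psd (f ` F) (\<lambda>g h. \<phi> n (inv\<^bsub>H\<^esub> g \<otimes>\<^bsub>H\<^esub> h))"
        by (intro \<phi>(1)[unfolded positive_definite_on_psd, rule_format] conjI) auto
      then have "psd F (\<lambda>g h. \<phi> n (inv\<^bsub>H\<^esub> (f g) \<otimes>\<^bsub>H\<^esub> f h))"
        by (rule psd_image) (use F in simp)
      then show "psd F (\<lambda>g h. \<phi> n (f (inv\<^bsub>G\<^esub> g \<otimes>\<^bsub>G\<^esub> h)))"
        by (rule psd_cong[THEN iffD1, rotated]) (use F in \<open>auto simp: subset_iff\<close>)
    qed
  next
    fix n
    show "c0_on G (\<lambda>g. \<phi> n (f g))"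
      unfolding c0_on_def
    proof (intro allI impI)
      fix \<epsilon> :: real assume "\<epsilon> > 0"
      then have "finite {g \<in> carrier H. \<epsilon> \<le> norm (\<phi> n g)}" using \<phi>(2) by (simp add: c0_on_def)
      then have "finite (f -` {g \<in> carrier H. \<epsilon> \<le> norm (\<phi> n g)} \<inter> carrier G)"
        by (rule finite_vimage_IntI) (rule f(2))
      then show "finite {g \<in> carrier G. \<epsilon> \<le> norm (\<phi> n (f g))}"
        by (rule finite_subset[rotated]) auto
    qed
  qed (use \<phi>(3) in auto)
qed

text \<open>For determinant 1 this is the cosh of the hyperbolic distance between \<open>i\<close>
  and \<open>g i\<close> in the upper half-plane.\<close>

definition half_frobenius :: "Z2x2 \<Rightarrow> real" where
  "half_frobenius g = ((of_int (g$1$1))\<^sup>2 + (of_int (g$1$2))\<^sup>2 + (of_int (g$2$1))\<^sup>2 + (of_int (g$2$2))\<^sup>2) / 2"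

text \<open>The entries of \<open>g g\<^sup>T\<close> give the point \<open>(half_frobenius g, lor1 g, lor2 g)\<close> of the hyperboloid
  \<open>X\<^sub>0\<^sup>2 = 1 + X\<^sub>1\<^sup>2 + X\<^sub>2\<^sup>2\<close>; dividing by \<open>half_frobenius g\<close> gives coordinates in the Klein disc.\<close>

definition lor1 :: "Z2x2 \<Rightarrow> real" where
  "lor1 g = ((of_int (g$1$1))\<^sup>2 + (of_int (g$1$2))\<^sup>2 - (of_int (g$2$1))\<^sup>2 - (of_int (g$2$2))\<^sup>2) / 2"
definition lor2 :: "Z2x2 \<Rightarrow> real" where
  "lor2 g = of_int (g$1$1) * of_int (g$2$1) + of_int (g$1$2) * of_int (g$2$2)"

lemma hyperboloid:
  assumes "det g = 1" shows "(half_frobenius g)\<^sup>2 = 1 + (lor1 g)\<^sup>2 + (lor2 g)\<^sup>2"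
proof -
  define a b c d where ab: "a = real_of_int (g$1$1)" "b = real_of_int (g$1$2)" "c = real_of_int (g$2$1)" "d = real_of_int (g$2$2)"
  have dt: "a * d - b * c = 1" using det_real[OF assms(1)] ab by simp
  have "(2 * half_frobenius g)\<^sup>2 = 4 + (2 * lor1 g)\<^sup>2 + 4 * (lor2 g)\<^sup>2"
    using dt unfolding half_frobenius_def lor1_def lor2_def ab[symmetric] by simp algebra
  then show ?thesis by (simp add: power_mult_distrib)
qed

lemma half_frobenius_ge_1: assumes "det g = 1" shows "1 \<le> half_frobenius g"
proof -
  have "1\<^sup>2 \<le> (half_frobenius g)\<^sup>2" using hyperboloid[OF assms] by simp
  moreover have "0 \<le> half_frobenius g" by (simp add: half_frobenius_def)
  ultimately show ?thesis by (rule power2_le_imp_le)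
qed

text \<open>The Lorentz form of two points of the hyperboloid is the cosh of their distance, and
  distances are invariant under the group. Here \<open>k\<close> is the quotient of \<open>g\<close>
  and \<open>h\<close>, given by its defining equation.\<close>

lemma half_frobenius_quotient:
  assumes "det g = 1" "g ** k = h"
  shows "half_frobenius k = half_frobenius g * half_frobenius h - lor1 g * lor1 h - lor2 g * lor2 h"
proof -
  define a b c d where ab: "a = real_of_int (g$1$1)" "b = real_of_int (g$1$2)" "c = real_of_int (g$2$1)" "d = real_of_int (g$2$2)"
  define a' b' c' d' where ab': "a' = real_of_int (k$1$1)" "b' = real_of_int (k$1$2)" "c' = real_of_int (k$2$1)" "d' = real_of_int (k$2$2)"
  have dt: "a * d - b * c = 1" using det_real[OF assms(1)] ab by simp
  have h: "real_of_int (h$1$1) = a * a' + b * c'" "real_of_int (h$1$2) = a * b' + b * d'"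
     "real_of_int (h$2$1) = c * a' + d * c'" "real_of_int (h$2$2) = c * b' + d * d'"
    unfolding ab ab' assms(2)[symmetric] mat_mult_entries by simp_all
  have "4 * half_frobenius k = (2 * half_frobenius g) * (2 * half_frobenius h) - (2 * lor1 g) * (2 * lor1 h) - 4 * (lor2 g * lor2 h)"
    using dt unfolding half_frobenius_def lor1_def lor2_def h ab[symmetric] ab'[symmetric] by simp algebra
  then show ?thesis by simp
qed

text \<open>These are the Taylor coefficients of \<open>(1 - z) powr (- s)\<close>: rising
  factorials divided by factorials.\<close>

lemma gbinomial_neg_alternating_nonneg:
  fixes s :: real assumes "0 \<le> s" shows "0 \<le> ((- s) gchoose n) * (- 1) ^ n"
proof -
  have "((- s) gchoose n) * (- 1) ^ n = pochhammer s n / fact n"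
    by (simp add: gbinomial_pochhammer mult.commute flip: power_mult_distrib)
  also have "\<dots> \<ge> 0" using assms by (auto simp: pochhammer_prod intro!: divide_nonneg_pos prod_nonneg)
  finally show ?thesis .
qed

text \<open>Dividing by \<open>half_frobenius g * half_frobenius h\<close> leaves
  \<open>1 - z\<close>, with \<open>z\<close> the inner product of two points of the Klein disc. The
  binomial series of \<open>(1 - z) powr (- s)\<close> has nonnegative coefficients, and powers of
  an inner product are positive semidefinite kernels.\<close>

lemma psd_half_frobenius_powr:
  assumes s: "0 < s" and F: "\<And>g. g \<in> F \<Longrightarrow> det g = 1"
  shows "psd F (\<lambda>g h. complex_of_real ((half_frobenius g * half_frobenius h - lor1 g * lor1 h - lor2 g * lor2 h) powr (- s)))"
proof -
  define y1 y2 where y: "y1 g = lor1 g / half_frobenius g" "y2 g = lor2 g / half_frobenius g" for g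
  define z where "z g h = y1 g * y1 h + y2 g * y2 h" for g h
  define c where "c n = ((- s) gchoose n) * (- 1) ^ n" for n :: nat
  have c: "0 \<le> c n" for n unfolding c_def using s by (intro gbinomial_neg_alternating_nonneg) simp
  have pos: "0 < half_frobenius g" if "g \<in> F" for g using half_frobenius_ge_1[OF F[OF that]] by simp
  have disc: "(y1 g)\<^sup>2 + (y2 g)\<^sup>2 < 1" if "g \<in> F" for g
  proof -
    have "(y1 g)\<^sup>2 + (y2 g)\<^sup>2 = ((lor1 g)\<^sup>2 + (lor2 g)\<^sup>2) / (half_frobenius g)\<^sup>2"
      by (simp add: y power_divide add_divide_distrib)
    also have "\<dots> < 1"
      using hyperboloid[OF F[OF that]] pos[OF that] zero_less_power[OF pos[OF that], of 2]
      by (subst divide_less_eq_1_pos) (simp_all del: zero_less_power2)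
    finally show ?thesis .
  qed
  have z: "\<bar>z g h\<bar> < 1" if "g \<in> F" "h \<in> F" for g h
  proof -
    have "2 * \<bar>z g h\<bar> \<le> (y1 g)\<^sup>2 + (y2 g)\<^sup>2 + ((y1 h)\<^sup>2 + (y2 h)\<^sup>2)"
      using sum_squares_bound[of "y1 g" "y1 h"] sum_squares_bound[of "y2 g" "y2 h"]
        sum_squares_bound[of "- y1 g" "y1 h"] sum_squares_bound[of "- y2 g" "y2 h"]
      by (simp add: z_def abs_if)
    with disc[OF that(1)] disc[OF that(2)] show ?thesis by linarith
  qed
  have "psd F (\<lambda>g h. complex_of_real (z g h ^ n))" for n
  proof -
    \<comment> \<open>The binomial theorem exhibits the power as a nonnegative combination of
      rank-one kernels.\<close>
    have "complex_of_real (z g h ^ n) = (\<Sum>k\<le>n. of_nat (n choose k) *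
       (cnj (of_real (y1 g ^ k * y2 g ^ (n - k))) * of_real (y1 h ^ k * y2 h ^ (n - k))))" for g h
      unfolding z_def by (subst binomial_ring) (simp add: power_mult_distrib mult_ac)
    then show ?thesis
      by (simp only:) (intro psd_sum psd_scale psd_rank_one; simp)
  qed
  then have "psd F (\<lambda>g h. of_real (c n) * complex_of_real (z g h ^ n))" for n
    using c by (intro psd_scale) auto
  then have "psd F (\<lambda>g h. complex_of_real ((1 - z g h) powr (- s)))"
  proof (rule psd_sums)
    fix g h assume "g \<in> F" "h \<in> F"
    then have "(\<lambda>n. ((- s) gchoose n) * (- z g h) ^ n) sums (1 + - z g h) powr (- s)"
      using z by (intro gen_binomial_real) simp
    then have "(\<lambda>n. c n * z g h ^ n) sums (1 - z g h) powr (- s)"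
      by (simp add: c_def mult.assoc flip: power_mult_distrib)
    then show "(\<lambda>n. complex_of_real (c n) * complex_of_real (z g h ^ n)) sums complex_of_real ((1 - z g h) powr - s)"
      by (subst of_real_mult[symmetric]) (rule sums_of_real)
  qed
  then have "psd F (\<lambda>g h. cnj (of_real (half_frobenius g powr (- s))) * of_real (half_frobenius h powr (- s)) * complex_of_real ((1 - z g h) powr (- s)))"
    by (rule psd_weight)
  then show ?thesis
  proof (rule psd_cong[THEN iffD1, rotated])
    fix g h assume gh: "g \<in> F" "h \<in> F"
    have "half_frobenius g * half_frobenius h - lor1 g * lor1 h - lor2 g * lor2 h = half_frobenius g * half_frobenius h * (1 - z g h)"
      using pos[OF gh(1)] pos[OF gh(2)] by (simp add: z_def y field_simps)
    then show "cnj (of_real (half_frobenius g powr (- s))) * of_real (half_frobenius h powr (- s)) * complex_of_real ((1 - z g h) powr (- s))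
      = complex_of_real ((half_frobenius g * half_frobenius h - lor1 g * lor1 h - lor2 g * lor2 h) powr (- s))"
      using pos[OF gh(1)] pos[OF gh(2)] z[OF gh] by (simp add: powr_mult)
  qed
qed

lemma finite_half_frobenius_le: "finite {g. half_frobenius g \<le> R}"
proof -
  define N where "N = \<lceil>2 * R\<rceil>"
  have entry: "\<bar>x\<bar> \<le> N" if "(real_of_int x)\<^sup>2 \<le> 2 * R" for x
  proof -
    have "\<bar>x\<bar> \<le> \<bar>x\<bar>\<^sup>2" by (cases "x = 0") (auto simp: power2_eq_square mult_le_cancel_left1 simp del: abs_mult_self_eq power2_abs)
    then have "real_of_int \<bar>x\<bar> \<le> (real_of_int x)\<^sup>2" by (metis of_int_le_iff of_int_power power2_abs)
    with that have "real_of_int \<bar>x\<bar> \<le> 2 * R" by linarith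
    then show ?thesis unfolding N_def by linarith
  qed
  have "{g. half_frobenius g \<le> R} \<subseteq> (\<lambda>(a, b, c, d). vector [vector [a, b], vector [c, d]]) ` ({-N..N} \<times> {-N..N} \<times> {-N..N} \<times> {-N..N})"
  proof
    fix g :: Z2x2 assume "g \<in> {g. half_frobenius g \<le> R}"
    then have h: "(of_int (g$1$1))\<^sup>2 + (of_int (g$1$2))\<^sup>2 + (of_int (g$2$1))\<^sup>2 + (of_int (g$2$2))\<^sup>2 \<le> 2 * R"
      by (simp add: half_frobenius_def)
    have sq: "0 \<le> (real_of_int x)\<^sup>2" for x by simp
    have "\<bar>g$1$1\<bar> \<le> N" "\<bar>g$1$2\<bar> \<le> N" "\<bar>g$2$1\<bar> \<le> N" "\<bar>g$2$2\<bar> \<le> N"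
      using h sq[of "g$1$1"] sq[of "g$1$2"] sq[of "g$2$1"] sq[of "g$2$2"]
      by (intro entry; linarith)+
    then show "g \<in> (\<lambda>(a, b, c, d). vector [vector [a, b], vector [c, d]]) ` ({-N..N} \<times> {-N..N} \<times> {-N..N} \<times> {-N..N})"
      by (intro image_eqI[of _ _ "(g$1$1, g$1$2, g$2$1, g$2$2)"]) (auto simp: mat2_eq_iff abs_le_iff)
  qed
  then show ?thesis by (rule finite_subset) simp
qed

lemma haagerup_SL2Z: "haagerup SL2Z"
proof -
  interpret group SL2Z by (rule group_SL2Z)
  \<comment> \<open>The exponents tend to 0, which gives pointwise convergence to 1. Each of them is
    positive, which gives c0 because sublevel sets of \<open>half_frobenius\<close> are
    finite.\<close>
  define s where "s n = 1 / (real n + 1)" for n :: nat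
  have s: "0 < s n" for n by (simp add: s_def)
  show ?thesis unfolding haagerup_def
  proof (intro exI[of _ "\<lambda>n g. complex_of_real (half_frobenius g powr (- s n))"] conjI allI ballI)
    fix n
    show "positive_definite_on SL2Z (\<lambda>g. complex_of_real (half_frobenius g powr (- s n)))"
      unfolding positive_definite_on_psd
    proof (intro allI impI)
      fix F assume F: "finite F \<and> F \<subseteq> carrier SL2Z"
      then have "psd F (\<lambda>g h. complex_of_real ((half_frobenius g * half_frobenius h - lor1 g * lor1 h - lor2 g * lor2 h) powr (- s n)))"
        by (intro psd_half_frobenius_powr s) auto
      then show "psd F (\<lambda>g h. complex_of_real (half_frobenius (inv\<^bsub>SL2Z\<^esub> g \<otimes>\<^bsub>SL2Z\<^esub> h) powr (- s n)))"
      proof (rule psd_cong[THEN iffD1, rotated])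
        fix g h assume "g \<in> F" "h \<in> F"
        then have gh: "g \<in> carrier SL2Z" "h \<in> carrier SL2Z" using F by auto
        then have "g \<otimes>\<^bsub>SL2Z\<^esub> (inv\<^bsub>SL2Z\<^esub> g \<otimes>\<^bsub>SL2Z\<^esub> h) = h"
          by (simp add: m_assoc[symmetric] del: SL2Z_simps)
        then have "half_frobenius (inv\<^bsub>SL2Z\<^esub> g \<otimes>\<^bsub>SL2Z\<^esub> h) = half_frobenius g * half_frobenius h - lor1 g * lor1 h - lor2 g * lor2 h"
          using gh by (intro half_frobenius_quotient) auto
        then show "complex_of_real ((half_frobenius g * half_frobenius h - lor1 g * lor1 h - lor2 g * lor2 h) powr (- s n)) =
           complex_of_real (half_frobenius (inv\<^bsub>SL2Z\<^esub> g \<otimes>\<^bsub>SL2Z\<^esub> h) powr (- s n))"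
          by (simp only:)
      qed
    qed
  next
    fix n
    show "c0_on SL2Z (\<lambda>g. complex_of_real (half_frobenius g powr (- s n)))"
      unfolding c0_on_def
    proof (intro allI impI)
      fix \<epsilon> :: real assume e: "\<epsilon> > 0"
      have "half_frobenius g \<le> \<epsilon> powr (- (1 / s n))" if "det g = 1" "\<epsilon> \<le> half_frobenius g powr (- s n)" for g
      proof -
        have p: "0 < half_frobenius g" using half_frobenius_ge_1[OF that(1)] by simp
        have "(half_frobenius g powr (- s n)) powr (- (1 / s n)) \<le> \<epsilon> powr (- (1 / s n))"
          using that(2) e s[of n] by (intro powr_mono2') auto
        then show ?thesis using p s[of n] by (simp add: powr_powr)
      qed
      then show "finite {g \<in> carrier SL2Z. \<epsilon> \<le> norm (complex_of_real (half_frobenius g powr (- s n)))}"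
        by (intro finite_subset[OF _ finite_half_frobenius_le[of "\<epsilon> powr (- (1 / s n))"]]) auto
    qed
  next
    fix g assume "g \<in> carrier SL2Z"
    then have "0 < half_frobenius g" using half_frobenius_ge_1[of g] by simp
    have "s = (\<lambda>n. inverse (real (Suc n)))" by (simp add: s_def fun_eq_iff inverse_eq_divide add.commute)
    then have "s \<longlonglongrightarrow> 0" using LIMSEQ_inverse_real_of_nat by simp
    then have "(\<lambda>n. half_frobenius g powr (- s n)) \<longlonglongrightarrow> half_frobenius g powr (- 0)"
      using \<open>0 < half_frobenius g\<close> by (intro tendsto_intros) auto
    then have "(\<lambda>n. complex_of_real (half_frobenius g powr (- s n))) \<longlonglongrightarrow> of_real (half_frobenius g powr (- 0))"
      by (rule tendsto_of_real)
    then show "(\<lambda>n. complex_of_real (half_frobenius g powr (- s n))) \<longlonglongrightarrow> 1"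
      using \<open>0 < half_frobenius g\<close> by simp
  qed
qed

section \<open>Folner sets\<close>

text \<open>In a group, left translation preserves cardinality, so the part of the translate outside
  \<open>F\<close> is half of the symmetric difference.\<close>

definition folner :: "('a, 'm) monoid_scheme \<Rightarrow> bool" where
  "folner G \<longleftrightarrow> (\<forall>E \<epsilon>. finite E \<and> E \<subseteq> carrier G \<and> 0 < \<epsilon> \<longrightarrow>
     (\<exists>F. finite F \<and> F \<noteq> {} \<and> F \<subseteq> carrier G \<and>
       (\<forall>t\<in>E. real (card ((\<lambda>x. t \<otimes>\<^bsub>G\<^esub> x) ` F - F)) \<le> \<epsilon> * real (card F))))"

text \<open>If every ratio exceeded \<open>1 + \<epsilon>\<close>, the sequence would grow
  exponentially, against its polynomial bound.\<close>

lemma polynomial_growth_ratio: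
  fixes c :: "nat \<Rightarrow> nat"
  assumes c: "\<And>n. 0 < c n" "\<And>n. c n \<le> (n + 1) ^ k" and e: "0 < \<epsilon>"
  obtains n where "real (c (Suc n)) \<le> (1 + \<epsilon>) * real (c n)"
proof (rule ccontr)
  assume "\<not> thesis"
  with that have grow: "(1 + \<epsilon>) * real (c n) < real (c (Suc n))" for n by (meson not_le)
  have lower: "(1 + \<epsilon>) ^ n \<le> real (c n)" for n
  proof (induction n)
    case 0 then show ?case using c(1)[of 0] by simp
  next
    case (Suc n)
    have "(1 + \<epsilon>) * (1 + \<epsilon>) ^ n \<le> (1 + \<epsilon>) * real (c n)" using Suc e by simp
    with grow[of n] show ?case by simp
  qed
  \<comment> \<open>With this \<open>x\<close>, the limit of \<open>n * x ^ n\<close> controls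
    \<open>(n + 1) ^ Suc k / (1 + \<epsilon>) ^ n\<close>. The index \<open>Suc k\<close> instead of
    \<open>k\<close> covers the case \<open>k = 0\<close>.\<close>
  define x where "x = root (Suc k) (1 / (1 + \<epsilon>))"
  have x: "0 < x" "x < 1" "x ^ Suc k = 1 / (1 + \<epsilon>)" 
    using e by (auto simp: x_def simp del: power_Suc)
  have "(\<lambda>n. of_nat n * x ^ n) \<longlonglongrightarrow> 0" using x by (intro powser_times_n_limit_0) simp
  then have "(\<lambda>n. of_nat (Suc n) * x ^ Suc n) \<longlonglongrightarrow> 0" by (rule LIMSEQ_Suc)
  then have "(\<lambda>n. (of_nat (Suc n) * x ^ Suc n / x) ^ Suc k) \<longlonglongrightarrow> (0 / x) ^ Suc k"
    using x(1) by (intro tendsto_power tendsto_divide tendsto_const) auto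
  moreover have "(of_nat (Suc n) * x ^ Suc n / x) ^ Suc k = real (n + 1) ^ Suc k / (1 + \<epsilon>) ^ n" for n
  proof -
    have "(of_nat (Suc n) * x ^ Suc n / x) ^ Suc k = real (n + 1) ^ Suc k * (x ^ Suc k) ^ n"
      using x(1) by (simp add: power_mult_distrib flip: power_mult) (simp add: mult_ac power_add power_mult_distrib)
    also have "\<dots> = real (n + 1) ^ Suc k / (1 + \<epsilon>) ^ n" unfolding x(3) by (simp add: power_divide)
    finally show ?thesis .
  qed
  ultimately have "(\<lambda>n. real (n + 1) ^ Suc k / (1 + \<epsilon>) ^ n) \<longlonglongrightarrow> 0" by simp
  then have "\<forall>\<^sub>F n in sequentially. real (n + 1) ^ Suc k / (1 + \<epsilon>) ^ n < 1"
    by (rule order_tendstoD) simp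
  then obtain n where n: "real (n + 1) ^ Suc k / (1 + \<epsilon>) ^ n < 1"
    using eventually_happens'[OF sequentially_bot] by blast
  have "real (c n) \<le> real ((n + 1) ^ k)" using c(2)[of n] by (simp only: of_nat_le_iff)
  also have "\<dots> \<le> real (n + 1) ^ Suc k" using power_increasing[of k "Suc k" "real (n + 1)"] by simp
  also have "\<dots> < (1 + \<epsilon>) ^ n" using n e by (simp add: divide_less_eq)
  finally show False using lower[of n] by simp
qed

text \<open>Generators are adjoined one at a time: by commutativity a new one enters only through a
  power with exponent at most \<open>n\<close>, at the cost of one factor \<open>n + 1\<close>.
  Exponents stay nonnegative because only translation by \<open>E\<close> itself has to be
  controlled.\<close>

lemma comm_word_growth:
  fixes G (structure)
  assumes "comm_group G" "finite E" "E \<subseteq> carrier G"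
  shows "\<exists>B :: nat \<Rightarrow> _ set. \<forall>n. finite (B n) \<and> B n \<noteq> {} \<and> B n \<subseteq> carrier G \<and> B n \<subseteq> B (Suc n) \<and>
     card (B n) \<le> (n + 1) ^ card E \<and> (\<forall>t\<in>E. (\<lambda>x. t \<otimes> x) ` B n \<subseteq> B (Suc n))"
  using assms(2,3)
proof (induction E rule: finite_induct)
  case empty
  interpret comm_group G by fact
  show ?case by (intro exI[of _ "\<lambda>_. {\<one>}"]) simp
next
  case (insert t E)
  interpret comm_group G by fact
  obtain B :: "nat \<Rightarrow> _ set" where "\<forall>n. finite (B n) \<and> B n \<noteq> {} \<and> B n \<subseteq> carrier G \<and> B n \<subseteq> B (Suc n) \<and>
     card (B n) \<le> (n + 1) ^ card E \<and> (\<forall>t\<in>E. (\<lambda>x. t \<otimes> x) ` B n \<subseteq> B (Suc n))"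
    using insert by blast
  then have B: "\<And>n. finite (B n)" "\<And>n. B n \<noteq> {}" "\<And>n. B n \<subseteq> carrier G" "\<And>n. B n \<subseteq> B (Suc n)"
     "\<And>n. card (B n) \<le> (n + 1) ^ card E" "\<And>n s. s \<in> E \<Longrightarrow> (\<lambda>x. s \<otimes> x) ` B n \<subseteq> B (Suc n)"
    by blast+
  have t: "t \<in> carrier G" using insert by simp
  define C where "C n = (\<lambda>(i, x). t [^] i \<otimes> x) ` ({..n} \<times> B n)" for n :: nat
  have Cmem: "t [^] i \<otimes> x \<in> C n" if "i \<le> n" "x \<in> B n" for i x n
    unfolding C_def using that by force
  show ?case
  proof (intro exI[of _ C] allI conjI ballI)
    fix n
    show "finite (C n)" by (simp add: C_def B)
    show "C n \<noteq> {}" by (simp add: C_def B)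
    show "C n \<subseteq> carrier G" using B(3) t by (auto simp: C_def)
    show "C n \<subseteq> C (Suc n)"
      using B(4)[of n] by (auto simp: C_def[of n] intro!: Cmem)
    have "card (C n) \<le> card ({..n} \<times> B n)" unfolding C_def by (rule card_image_le) (simp add: B)
    also have "\<dots> \<le> (n + 1) * (n + 1) ^ card E" using B(5)[of n] by (simp add: card_cartesian_product del: mult_Suc)
    finally show "card (C n) \<le> (n + 1) ^ card (insert t E)" using insert by simp
    fix s assume s: "s \<in> insert t E"
    show "(\<lambda>x. s \<otimes> x) ` C n \<subseteq> C (Suc n)"
    proof clarify
      fix y assume "y \<in> C n"
      then obtain i x where ix: "i \<le> n" "x \<in> B n" "y = t [^] i \<otimes> x" by (auto simp: C_def)
      have x: "x \<in> carrier G" using ix B(3) by auto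
      show "s \<otimes> y \<in> C (Suc n)"
      proof (cases "s = t")
        case True
        have "s \<otimes> y = t [^] Suc i \<otimes> x"
          using x t ix True by (simp add: m_ac)
        then show ?thesis using ix B(4)[of n] Cmem[of "Suc i" "Suc n" x] by auto
      next
        case False
        then have sE: "s \<in> E" "s \<in> carrier G" using s insert by auto
        have "s \<otimes> y = t [^] i \<otimes> (s \<otimes> x)"
          using x t ix sE by (simp add: m_ac)
        then show ?thesis using ix B(6)[OF sE(1), of n] Cmem[of i "Suc n" "s \<otimes> x"] by auto
      qed
    qed
  qed
qed

lemma folner_comm_group:
  fixes G (structure)
  assumes "comm_group G" shows "folner G"
  unfolding folner_def
proof (intro allI impI)
  fix E and \<epsilon> :: real assume E: "finite E \<and> E \<subseteq> carrier G \<and> 0 < \<epsilon>"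
  then obtain B :: "nat \<Rightarrow> _ set" where "\<forall>n. finite (B n) \<and> B n \<noteq> {} \<and> B n \<subseteq> carrier G \<and> B n \<subseteq> B (Suc n) \<and>
     card (B n) \<le> (n + 1) ^ card E \<and> (\<forall>t\<in>E. (\<lambda>x. t \<otimes> x) ` B n \<subseteq> B (Suc n))"
    using comm_word_growth[OF assms, of E] by blast
  then have B: "\<And>n. finite (B n)" "\<And>n. B n \<noteq> {}" "\<And>n. B n \<subseteq> carrier G" "\<And>n. B n \<subseteq> B (Suc n)"
     "\<And>n. card (B n) \<le> (n + 1) ^ card E" "\<And>n s. s \<in> E \<Longrightarrow> (\<lambda>x. s \<otimes> x) ` B n \<subseteq> B (Suc n)"
    by blast+
  obtain n where n: "real (card (B (Suc n))) \<le> (1 + \<epsilon>) * real (card (B n))"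
    using polynomial_growth_ratio[of "\<lambda>n. card (B n)" "card E" \<epsilon>] B E by (auto simp: card_gt_0_iff)
  have "real (card ((\<lambda>x. t \<otimes> x) ` B n - B n)) \<le> \<epsilon> * real (card (B n))" if "t \<in> E" for t
  proof -
    have "card ((\<lambda>x. t \<otimes> x) ` B n - B n) \<le> card (B (Suc n) - B n)"
      using B(6)[OF that, of n] by (intro card_mono) (auto simp: B)
    also have "\<dots> = card (B (Suc n)) - card (B n)" using B by (intro card_Diff_subset) auto
    finally have "real (card ((\<lambda>x. t \<otimes> x) ` B n - B n)) \<le> real (card (B (Suc n))) - real (card (B n))"
      using card_mono[OF B(1) B(4), of n] by linarith
    with n show ?thesis by (simp add: algebra_simps)
  qed
  then show "\<exists>F. finite F \<and> F \<noteq> {} \<and> F \<subseteq> carrier G \<and>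
       (\<forall>t\<in>E. real (card ((\<lambda>x. t \<otimes> x) ` F - F)) \<le> \<epsilon> * real (card F))" by (intro exI[of _ "B n"] conjI ballI B)
qed

text \<open>\<open>inv s \<otimes> s' \<in> N\<close> says that \<open>s\<close> and
  \<open>s'\<close> lie in the same left coset of \<open>N\<close>, so \<open>cosets\<close>
  supplies partial transversals that are almost invariant in the coset space. The Folner set is a
  product \<open>F K\<close>. Translation by \<open>t\<close> sends most fibres \<open>s K\<close>
  to \<open>s' d K\<close> with \<open>d\<close> in \<open>N\<close>; only finitely many
  \<open>d\<close> occur once \<open>F\<close> is fixed, and \<open>K\<close> is chosen afterwards
  for them.\<close>

lemma folner_extension:
  fixes G (structure)
  assumes G: "group G" and N: "subgroup N G" and fN: "folner (G\<lparr>carrier := N\<rparr>)"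
    and cosets: "\<And>E \<epsilon>. finite E \<Longrightarrow> E \<subseteq> carrier G \<Longrightarrow> 0 < (\<epsilon>::real) \<Longrightarrow>
      \<exists>F. finite F \<and> F \<noteq> {} \<and> F \<subseteq> carrier G \<and>
        (\<forall>s\<in>F. \<forall>s'\<in>F. inv s \<otimes> s' \<in> N \<longrightarrow> s = s') \<and>
        (\<forall>t\<in>E. real (card {s \<in> F. \<forall>s'\<in>F. inv s' \<otimes> (t \<otimes> s) \<notin> N}) \<le> \<epsilon> * real (card F))"
  shows "folner G"
  unfolding folner_def
proof (intro allI impI)
  fix E and \<epsilon> :: real assume E: "finite E \<and> E \<subseteq> carrier G \<and> 0 < \<epsilon>"
  interpret group G by fact
  have "\<exists>F. finite F \<and> F \<noteq> {} \<and> F \<subseteq> carrier G \<and>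
        (\<forall>s\<in>F. \<forall>s'\<in>F. inv s \<otimes> s' \<in> N \<longrightarrow> s = s') \<and>
        (\<forall>t\<in>E. real (card {s \<in> F. \<forall>s'\<in>F. inv s' \<otimes> (t \<otimes> s) \<notin> N}) \<le> \<epsilon> / 2 * real (card F))"
    by (rule cosets) (use E in auto)
  then obtain F where FF: "finite F \<and> F \<noteq> {} \<and> F \<subseteq> carrier G \<and>
        (\<forall>s\<in>F. \<forall>s'\<in>F. inv s \<otimes> s' \<in> N \<longrightarrow> s = s') \<and>
        (\<forall>t\<in>E. real (card {s \<in> F. \<forall>s'\<in>F. inv s' \<otimes> (t \<otimes> s) \<notin> N}) \<le> \<epsilon> / 2 * real (card F))" ..
  have F: "finite F" "F \<noteq> {}" "F \<subseteq> carrier G"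
    and sep: "\<And>s s'. s \<in> F \<Longrightarrow> s' \<in> F \<Longrightarrow> inv s \<otimes> s' \<in> N \<Longrightarrow> s = s'"
    and bad: "\<And>t. t \<in> E \<Longrightarrow> real (card {s \<in> F. \<forall>s'\<in>F. inv s' \<otimes> (t \<otimes> s) \<notin> N}) \<le> \<epsilon> / 2 * real (card F)"
  proof -
    show "finite F" "F \<noteq> {}" "F \<subseteq> carrier G" using FF by simp_all
    show "s = s'" if "s \<in> F" "s' \<in> F" "inv s \<otimes> s' \<in> N" for s s' using FF that by simp
    show "real (card {s \<in> F. \<forall>s'\<in>F. inv s' \<otimes> (t \<otimes> s) \<notin> N}) \<le> \<epsilon> / 2 * real (card F)" if "t \<in> E" for t
      using FF that by simp
  qed
  define D where "D = (\<lambda>(t, s, s'). inv s' \<otimes> (t \<otimes> s)) ` (E \<times> F \<times> F) \<inter> N"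
  have "finite D" using E F by (auto simp: D_def)
  moreover have "D \<subseteq> N" by (simp add: D_def)
  ultimately have "\<exists>K. finite K \<and> K \<noteq> {} \<and> K \<subseteq> N \<and>
      (\<forall>d\<in>D. real (card ((\<lambda>x. d \<otimes> x) ` K - K)) \<le> \<epsilon> / 2 * real (card K))"
    using spec[OF spec[OF fN[unfolded folner_def], of D], of "\<epsilon> / 2"] E by simp
  then obtain K where KK: "finite K \<and> K \<noteq> {} \<and> K \<subseteq> N \<and>
      (\<forall>d\<in>D. real (card ((\<lambda>x. d \<otimes> x) ` K - K)) \<le> \<epsilon> / 2 * real (card K))" ..
  have K: "finite K" "K \<noteq> {}" "K \<subseteq> N"
    and Kinv: "\<And>d. d \<in> D \<Longrightarrow> real (card ((\<lambda>x. d \<otimes> x) ` K - K)) \<le> \<epsilon> / 2 * real (card K)"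
    using KK by blast+
  have NG: "N \<subseteq> carrier G" using N by (rule subgroup.subset)
  have mem: "\<And>s. s \<in> F \<Longrightarrow> s \<in> carrier G" "\<And>k. k \<in> K \<Longrightarrow> k \<in> carrier G" "\<And>t. t \<in> E \<Longrightarrow> t \<in> carrier G"
    using F K NG E by auto
  define P where "P = (\<lambda>(s, k). s \<otimes> k) ` (F \<times> K)"
  have inj: "inj_on (\<lambda>(s, k). s \<otimes> k) (F \<times> K)"
  proof (intro inj_onI, clarify)
    fix s k s' k' assume m: "s \<in> F" "k \<in> K" "s' \<in> F" "k' \<in> K" and eq: "s \<otimes> k = s' \<otimes> k'"
    have c: "s \<in> carrier G" "k \<in> carrier G" "s' \<in> carrier G" "k' \<in> carrier G" using m mem by auto
    have "k = inv s \<otimes> (s' \<otimes> k')" using eq c by (metis inv_solve_left m_closed)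
    then have "inv s \<otimes> s' = k \<otimes> inv k'"
      using c by (simp add: inv_solve_right m_assoc)
    also have "\<dots> \<in> N" using m K N by (meson subgroup.m_closed subgroup.m_inv_closed subsetD)
    finally have "s = s'" using sep m by blast
    with eq c show "s = s' \<and> k = k'" by simp
  qed
  have cardP: "card P = card F * card K"
    unfolding P_def using inj by (simp add: card_image card_cartesian_product)
  have "real (card ((\<lambda>x. t \<otimes> x) ` P - P)) \<le> \<epsilon> * real (card P)" if t: "t \<in> E" for t
  proof -
    define Bd where "Bd = {s \<in> F. \<forall>s'\<in>F. inv s' \<otimes> (t \<otimes> s) \<notin> N}"
    define \<sigma> where "\<sigma> s = (SOME s'. s' \<in> F \<and> inv s' \<otimes> (t \<otimes> s) \<in> N)" for s
    define d where "d s = inv (\<sigma> s) \<otimes> (t \<otimes> s)" for s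
    have \<sigma>: "\<sigma> s \<in> F" "d s \<in> N" "d s \<in> D" "t \<otimes> s = \<sigma> s \<otimes> d s" if "s \<in> F - Bd" for s
    proof -
      have "\<exists>s'. s' \<in> F \<and> inv s' \<otimes> (t \<otimes> s) \<in> N" using that by (auto simp: Bd_def)
      then have *: "\<sigma> s \<in> F \<and> inv (\<sigma> s) \<otimes> (t \<otimes> s) \<in> N"
        unfolding \<sigma>_def by (rule someI_ex)
      then show "\<sigma> s \<in> F" "d s \<in> N" by (auto simp: d_def)
      then show "d s \<in> D" using that t unfolding D_def d_def by force
      show "t \<otimes> s = \<sigma> s \<otimes> d s"
        using * that t mem by (simp add: d_def m_assoc[symmetric])
    qed
    \<comment> \<open>A point leaves \<open>P\<close> either because its new coset has no
      representative in \<open>F\<close>, or because its component in \<open>N\<close> leaves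
      \<open>K\<close>. Each cause is charged \<open>\<epsilon> / 2\<close>.\<close>
    have sub: "(\<lambda>x. t \<otimes> x) ` P - P \<subseteq> (\<lambda>(s, k). t \<otimes> (s \<otimes> k)) ` (Bd \<times> K) \<union>
       (\<Union>s\<in>F - Bd. (\<lambda>x. \<sigma> s \<otimes> x) ` ((\<lambda>x. d s \<otimes> x) ` K - K))"
    proof
      fix y assume y: "y \<in> (\<lambda>x. t \<otimes> x) ` P - P"
      then obtain s k where sk: "s \<in> F" "k \<in> K" "y = t \<otimes> (s \<otimes> k)" by (auto simp: P_def)
      show "y \<in> (\<lambda>(s, k). t \<otimes> (s \<otimes> k)) ` (Bd \<times> K) \<union>
       (\<Union>s\<in>F - Bd. (\<lambda>x. \<sigma> s \<otimes> x) ` ((\<lambda>x. d s \<otimes> x) ` K - K))"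
      proof (cases "s \<in> Bd")
        case True then show ?thesis using sk by force
      next
        case False
        then have s: "s \<in> F - Bd" using sk by simp
        note s' = \<sigma>[OF s]
        have y_eq: "y = \<sigma> s \<otimes> (d s \<otimes> k)"
        proof -
          have c: "t \<in> carrier G" "s \<in> carrier G" "k \<in> carrier G" "\<sigma> s \<in> carrier G" "d s \<in> carrier G"
            using sk s' mem t NG by auto
          have "y = (t \<otimes> s) \<otimes> k" using sk(3) c by (simp add: m_assoc)
          then show ?thesis unfolding s'(4) using c by (simp add: m_assoc)
        qed
        have "d s \<otimes> k \<notin> K"
        proof
          assume "d s \<otimes> k \<in> K"
          then have "y \<in> P" unfolding P_def using s'(1) y_eq by force
          with y show False by simp
        qed
        then show ?thesis using y_eq s sk by blast
      qed
    qed
    have finBd: "finite Bd" using F by (simp add: Bd_def)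
    have "card ((\<lambda>x. t \<otimes> x) ` P - P) \<le> card ((\<lambda>(s, k). t \<otimes> (s \<otimes> k)) ` (Bd \<times> K)) +
       card (\<Union>s\<in>F - Bd. (\<lambda>x. \<sigma> s \<otimes> x) ` ((\<lambda>x. d s \<otimes> x) ` K - K))"
      by (rule order.trans[OF card_mono[OF _ sub] card_Un_le]) (use F K finBd in auto)
    also have "\<dots> \<le> card Bd * card K + (\<Sum>s\<in>F - Bd. card ((\<lambda>x. d s \<otimes> x) ` K - K))"
    proof (rule add_mono)
      show "card ((\<lambda>(s, k). t \<otimes> (s \<otimes> k)) ` (Bd \<times> K)) \<le> card Bd * card K"
        unfolding card_cartesian_product[symmetric] by (rule card_image_le) (use finBd K in simp)
      have "card (\<Union>s\<in>F - Bd. (\<lambda>x. \<sigma> s \<otimes> x) ` ((\<lambda>x. d s \<otimes> x) ` K - K)) \<le>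
        (\<Sum>s\<in>F - Bd. card ((\<lambda>x. \<sigma> s \<otimes> x) ` ((\<lambda>x. d s \<otimes> x) ` K - K)))"
        by (rule card_UN_le) (use F in simp)
      also have "\<dots> \<le> (\<Sum>s\<in>F - Bd. card ((\<lambda>x. d s \<otimes> x) ` K - K))"
        by (intro sum_mono card_image_le) (use K in simp)
      finally show "card (\<Union>s\<in>F - Bd. (\<lambda>x. \<sigma> s \<otimes> x) ` ((\<lambda>x. d s \<otimes> x) ` K - K)) \<le>
        (\<Sum>s\<in>F - Bd. card ((\<lambda>x. d s \<otimes> x) ` K - K))" .
    qed
    finally have "real (card ((\<lambda>x. t \<otimes> x) ` P - P)) \<le> real (card Bd) * real (card K) + (\<Sum>s\<in>F - Bd. real (card ((\<lambda>x. d s \<otimes> x) ` K - K)))"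
      by (simp flip: of_nat_mult of_nat_sum of_nat_add)
    also have "\<dots> \<le> \<epsilon> / 2 * real (card F) * real (card K) + (\<Sum>s\<in>F - Bd. \<epsilon> / 2 * real (card K))"
      using bad[OF t] by (intro add_mono sum_mono Kinv mult_right_mono \<sigma>) (auto simp: Bd_def)
    also have "(\<Sum>s\<in>F - Bd. \<epsilon> / 2 * real (card K)) \<le> (\<Sum>s\<in>F. \<epsilon> / 2 * real (card K))"
      using E F by (intro sum_mono2) auto
    finally show ?thesis by (simp add: cardP algebra_simps)
  qed
  moreover have "finite P" "P \<noteq> {}" "P \<subseteq> carrier G" using F K mem by (auto simp: P_def)
  ultimately show "\<exists>F. finite F \<and> F \<noteq> {} \<and> F \<subseteq> carrier G \<and>
       (\<forall>t\<in>E. real (card ((\<lambda>x. t \<otimes> x) ` F - F)) \<le> \<epsilon> * real (card F))" by blast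
qed

section \<open>Folner sequences, the Haagerup property and invariant means\<close>

lemma folner_sequence:
  fixes G :: "('a::countable, 'm) monoid_scheme" (structure)
  assumes "folner G"
  obtains F where "\<And>n::nat. finite (F n)" "\<And>n. F n \<noteq> {}" "\<And>n. F n \<subseteq> carrier G"
    "\<And>t. t \<in> carrier G \<Longrightarrow> (\<lambda>n. real (card ((\<lambda>x. t \<otimes> x) ` F n - F n)) / real (card (F n))) \<longlonglongrightarrow> 0"
proof -
  define E where "E n = {g \<in> carrier G. to_nat g \<le> n}" for n
  have E: "finite (E n)" for n
    unfolding E_def by (rule finite_subset[OF _ finite_vimageI[OF finite_atMost[of n] inj_to_nat]]) auto
  have "\<forall>n. \<exists>F. finite F \<and> F \<noteq> {} \<and> F \<subseteq> carrier G \<and>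
     (\<forall>t\<in>E n. real (card ((\<lambda>x. t \<otimes> x) ` F - F)) \<le> inverse (real (Suc n)) * real (card F))"
  proof
    fix n
    have "E n \<subseteq> carrier G" by (auto simp: E_def)
    then show "\<exists>F. finite F \<and> F \<noteq> {} \<and> F \<subseteq> carrier G \<and>
     (\<forall>t\<in>E n. real (card ((\<lambda>x. t \<otimes> x) ` F - F)) \<le> inverse (real (Suc n)) * real (card F))"
      using spec[OF spec[OF assms[unfolded folner_def], of "E n"], of "inverse (real (Suc n))"] E[of n] by simp
  qed
  then obtain F where F: "\<And>n. finite (F n)" "\<And>n. F n \<noteq> {}" "\<And>n. F n \<subseteq> carrier G"
    "\<And>n t. t \<in> E n \<Longrightarrow> real (card ((\<lambda>x. t \<otimes> x) ` F n - F n)) \<le> inverse (real (Suc n)) * real (card (F n))"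
    by metis
  show ?thesis
  proof (rule that[of F])
    fix t assume t: "t \<in> carrier G"
    have trig_eval: "\<forall>\<^sub>F n in sequentially. real (card ((\<lambda>x. t \<otimes> x) ` F n - F n)) / real (card (F n)) \<le> inverse (real (Suc n))"
      using eventually_ge_at_top[of "to_nat t"]
    proof eventually_elim
      case (elim n)
      then have "t \<in> E n" using t by (simp add: E_def)
      moreover have "0 < card (F n)" using F by (simp add: card_gt_0_iff)
      ultimately show ?case using F(4)[of t n] by (simp add: divide_le_eq)
    qed
    show "(\<lambda>n. real (card ((\<lambda>x. t \<otimes> x) ` F n - F n)) / real (card (F n))) \<longlonglongrightarrow> 0"
      by (rule tendsto_sandwich[OF _ trig_eval tendsto_const LIMSEQ_inverse_real_of_nat]) simp
  qed (use F in auto)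
qed

text \<open>The function \<open>\<phi> n\<close> is the coefficient of the left regular
  representation at the normalised indicator of \<open>F n\<close>. Its support consists of
  quotients of elements of \<open>F n\<close>, hence is finite, and almost invariance brings its
  values to 1.\<close>

lemma folner_haagerup:
  fixes G :: "('a::countable, 'm) monoid_scheme" (structure)
  assumes "group G" "folner G" shows "haagerup G"
proof -
  interpret group G by fact
  obtain F where F: "\<And>n::nat. finite (F n)" "\<And>n. F n \<noteq> {}" "\<And>n. F n \<subseteq> carrier G"
    and lim: "\<And>t. t \<in> carrier G \<Longrightarrow> (\<lambda>n. real (card ((\<lambda>x. t \<otimes> x) ` F n - F n)) / real (card (F n))) \<longlonglongrightarrow> 0"
    by (rule folner_sequence[OF assms(2)]) (rule that)
  have cF: "0 < card (F n)" for n using F by (simp add: card_gt_0_iff)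
  define \<phi> where "\<phi> n g = real (card ((\<lambda>x. g \<otimes> x) ` F n \<inter> F n)) / real (card (F n))" for n g
  show ?thesis unfolding haagerup_def
  proof (intro exI[of _ "\<lambda>n g. complex_of_real (\<phi> n g)"] conjI allI ballI)
    fix n
    show "positive_definite_on G (\<lambda>g. complex_of_real (\<phi> n g))"
      unfolding positive_definite_on_psd
    proof (intro allI impI)
      fix S assume S: "finite S \<and> S \<subseteq> carrier G"
      define U where "U = (\<Union>g\<in>S. (\<lambda>x. g \<otimes> x) ` F n)"
      \<comment> \<open>The rank-one factor at \<open>x\<close> records which translates of
        \<open>F n\<close> contain \<open>x\<close>; summation over \<open>x\<close> counts the
        intersection of two translates.\<close>
      define u :: "'a \<Rightarrow> 'a \<Rightarrow> complex" where "u x g = of_bool (x \<in> (\<lambda>x. g \<otimes> x) ` F n)" for x g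
      have U: "finite U" using S F by (auto simp: U_def)
      have "psd S (\<lambda>g h. of_real (1 / real (card (F n))) * (\<Sum>x\<in>U. cnj (u x g) * u x h))"
        by (intro psd_scale psd_sum psd_rank_one) simp
      then show "psd S (\<lambda>g h. complex_of_real (\<phi> n (inv g \<otimes> h)))"
      proof (rule psd_cong[THEN iffD1, rotated])
        fix g h assume "g \<in> S" "h \<in> S"
        then have c: "g \<in> carrier G" "h \<in> carrier G" using S by auto
        have "(\<Sum>x\<in>U. cnj (u x g) * u x h) = (\<Sum>x\<in>U. of_bool (x \<in> (\<lambda>x. g \<otimes> x) ` F n \<inter> (\<lambda>x. h \<otimes> x) ` F n))"
          by (intro sum.cong refl) (simp add: u_def)
        also have "\<dots> = of_nat (card (U \<inter> {x. x \<in> (\<lambda>x. g \<otimes> x) ` F n \<inter> (\<lambda>x. h \<otimes> x) ` F n}))"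
          by (simp add: U)
        also have "U \<inter> {x. x \<in> (\<lambda>x. g \<otimes> x) ` F n \<inter> (\<lambda>x. h \<otimes> x) ` F n} = (\<lambda>x. g \<otimes> x) ` ((\<lambda>x. (inv g \<otimes> h) \<otimes> x) ` F n \<inter> F n)"
        proof -
          have m: "x \<in> carrier G" if "x \<in> F n" for x using that F by auto
          have "g \<otimes> (inv g \<otimes> h \<otimes> x) = h \<otimes> x" if "x \<in> F n" for x
            using m[OF that] c by (simp add: m_assoc[symmetric])
          then have "(\<lambda>x. g \<otimes> x) ` (\<lambda>x. (inv g \<otimes> h) \<otimes> x) ` F n = (\<lambda>x. h \<otimes> x) ` F n"
            by (auto simp: image_image)
          moreover have "inj_on (\<lambda>x. g \<otimes> x) (carrier G)" using c by (simp add: inj_on_cmult)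
          ultimately show ?thesis using \<open>g \<in> S\<close> F(3)[of n] c m
            by (subst inj_on_image_Int) (auto simp: U_def)
        qed
        also have "card \<dots> = card ((\<lambda>x. (inv g \<otimes> h) \<otimes> x) ` F n \<inter> F n)"
          using c F(3)[of n] by (intro card_image inj_on_subset[OF inj_on_cmult[of g]]) auto
        finally show "of_real (1 / real (card (F n))) * (\<Sum>x\<in>U. cnj (u x g) * u x h) = complex_of_real (\<phi> n (inv g \<otimes> h))"
          by (simp add: \<phi>_def)
      qed
    qed
  next
    fix n
    show "c0_on G (\<lambda>g. complex_of_real (\<phi> n g))"
      unfolding c0_on_def
    proof (intro allI impI)
      fix \<epsilon> :: real assume e: "\<epsilon> > 0"
      have "{g \<in> carrier G. \<epsilon> \<le> norm (complex_of_real (\<phi> n g))} \<subseteq> (\<lambda>(x, y). x \<otimes> inv y) ` (F n \<times> F n)"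
      proof
        fix g assume g: "g \<in> {g \<in> carrier G. \<epsilon> \<le> norm (complex_of_real (\<phi> n g))}"
        then have "\<phi> n g \<noteq> 0" using e by auto
        then have "(\<lambda>x. g \<otimes> x) ` F n \<inter> F n \<noteq> {}" unfolding \<phi>_def by auto
        then obtain x where x: "x \<in> F n" "g \<otimes> x \<in> F n" by blast
        then have "x \<in> carrier G" using F by auto
        then have "g = (g \<otimes> x) \<otimes> inv x" using g by (simp add: m_assoc)
        with x show "g \<in> (\<lambda>(x, y). x \<otimes> inv y) ` (F n \<times> F n)" by force
      qed
      then show "finite {g \<in> carrier G. \<epsilon> \<le> norm (complex_of_real (\<phi> n g))}"
        by (rule finite_subset) (simp add: F)
    qed
  next
    fix g assume g: "g \<in> carrier G"
    have "\<phi> n g = 1 - real (card ((\<lambda>x. g \<otimes> x) ` F n - F n)) / real (card (F n))" for n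
    proof -
      have "card ((\<lambda>x. g \<otimes> x) ` F n) = card (F n)"
        using g F(3)[of n] by (intro card_image inj_on_subset[OF inj_on_cmult[of g]]) auto
      moreover have "card ((\<lambda>x. g \<otimes> x) ` F n) = card ((\<lambda>x. g \<otimes> x) ` F n \<inter> F n) + card ((\<lambda>x. g \<otimes> x) ` F n - F n)"
        using F(1)[of n] by (metis card_Int_Diff finite_imageI)
      ultimately show ?thesis using cF[of n] unfolding \<phi>_def by (simp add: field_simps)
    qed
    then have "(\<lambda>n. \<phi> n g) \<longlonglongrightarrow> 1 - 0" by (simp only:) (intro tendsto_intros lim g)
    then show "(\<lambda>n. complex_of_real (\<phi> n g)) \<longlonglongrightarrow> 1" using tendsto_of_real by fastforce
  qed
qed

text \<open>A mean is evaluated on all subsets, in general too many for a diagonal subsequence.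
  Tychonoff's theorem gives a cluster point in the cube, and \<open>U\<close> is
  \<open>sequentially\<close> refined by the neighbourhoods of that point, so that all coordinates
  converge along one filter.\<close>

lemma cluster_point_fun:
  fixes X :: "nat \<Rightarrow> 'b \<Rightarrow> real"
  assumes "\<And>n b. X n b \<in> {0..1}"
  obtains \<mu> U where "U \<noteq> bot" "U \<le> sequentially" "\<And>b. ((\<lambda>n. X n b) \<longlongrightarrow> \<mu> b) U"
proof -
  have "compactin (product_topology (\<lambda>b::'b. euclideanreal) UNIV) (PiE UNIV (\<lambda>_. {0..1}))"
    by (simp add: compactin_PiE)
  then have "compact (PiE UNIV (\<lambda>_::'b. {0..1::real}))" by (simp add: euclidean_product_topology)
  moreover have "filtermap X sequentially \<noteq> bot" by (simp add: filtermap_bot_iff)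
  moreover have "eventually (\<lambda>x. x \<in> PiE UNIV (\<lambda>_::'b. {0..1::real})) (filtermap X sequentially)"
    using assms by (simp add: eventually_filtermap PiE_iff extensional_def)
  ultimately obtain \<mu> where \<mu>: "inf (nhds \<mu>) (filtermap X sequentially) \<noteq> bot"
    unfolding compact_filter by blast
  define U where "U = inf (filtercomap X (nhds \<mu>)) sequentially"
  show ?thesis
  proof (rule that[of U \<mu>])
    show "U \<noteq> bot"
    proof
      assume "U = bot"
      then have "eventually (\<lambda>_. False) U" by simp
      then obtain P Q where PQ: "eventually P (nhds \<mu>)" "eventually Q sequentially" "\<And>n. P (X n) \<Longrightarrow> Q n \<Longrightarrow> False"
        unfolding U_def eventually_inf eventually_filtercomap by metis
      have "eventually (\<lambda>x. \<not> P x) (filtermap X sequentially)"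
        using PQ(2) unfolding eventually_filtermap by eventually_elim (use PQ(3) in blast)
      with PQ(1) have "eventually (\<lambda>_. False) (inf (nhds \<mu>) (filtermap X sequentially))"
        unfolding eventually_inf by (intro exI[of _ P] exI[of _ "\<lambda>x. \<not> P x"]) auto
      with \<mu> show False by (simp add: eventually_False)
    qed
    show "U \<le> sequentially" by (simp add: U_def)
    fix b
    have "filterlim X (nhds \<mu>) U" unfolding U_def
      by (meson filterlim_filtercomap filterlim_mono inf_le1 order_refl)
    moreover have "open ((\<lambda>x::'b \<Rightarrow> real. x b) -` V)" if "open V" for V
      using open_vimage[OF that continuous_on_product_coordinates] .
    ultimately show "((\<lambda>n. X n b) \<longlongrightarrow> \<mu> b) U"
      using topological_tendstoD[of X \<mu> U] by (intro topological_tendstoI) force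
  qed
qed

lemma folner_amenable:
  fixes G :: "('a::countable, 'm) monoid_scheme" (structure)
  assumes "group G" "folner G" shows "amenable G"
proof -
  interpret group G by fact
  obtain F where F: "\<And>n::nat. finite (F n)" "\<And>n. F n \<noteq> {}" "\<And>n. F n \<subseteq> carrier G"
    and lim: "\<And>t. t \<in> carrier G \<Longrightarrow> (\<lambda>n. real (card ((\<lambda>x. t \<otimes> x) ` F n - F n)) / real (card (F n))) \<longlonglongrightarrow> 0"
    by (rule folner_sequence[OF assms(2)]) (rule that)
  have cF: "0 < card (F n)" for n using F by (simp add: card_gt_0_iff)
  define X where "X n A = real (card (A \<inter> F n)) / real (card (F n))" for n A
  have X01: "X n A \<in> {0..1}" for n A
    using cF[of n] card_mono[OF F(1), of "A \<inter> F n" n] by (auto simp: X_def divide_le_eq_1)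
  obtain \<mu> U where U: "U \<noteq> bot" "U \<le> sequentially" and \<mu>: "\<And>A. ((\<lambda>n. X n A) \<longlongrightarrow> \<mu> A) U"
    using cluster_point_fun[of X] X01 by metis
  show ?thesis unfolding amenable_def
  proof (intro exI[of _ \<mu>] conjI allI impI)
    fix A show "0 \<le> \<mu> A"
      using X01 by (intro tendsto_lowerbound[OF \<mu> _ U(1)] always_eventually) auto
  next
    have "X n (carrier G) = 1" for n using cF[of n] F(3)[of n] by (simp add: X_def Int_absorb1)
    then have "((\<lambda>n. X n (carrier G)) \<longlongrightarrow> 1) U" by simp
    then show "\<mu> (carrier G) = 1" using tendsto_unique[OF U(1) \<mu>] by blast
  next
    fix A B assume AB: "A \<subseteq> carrier G \<and> B \<subseteq> carrier G \<and> A \<inter> B = {}"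
    have "X n (A \<union> B) = X n A + X n B" for n
      using AB F(1)[of n] by (subst X_def, subst Int_Un_distrib2, subst card_Un_disjoint) (auto simp: X_def add_divide_distrib)
    then have "((\<lambda>n. X n (A \<union> B)) \<longlongrightarrow> \<mu> A + \<mu> B) U" by (simp only:) (intro tendsto_intros \<mu>)
    then show "\<mu> (A \<union> B) = \<mu> A + \<mu> B" using tendsto_unique[OF U(1) \<mu>] by blast
  next
    fix g A assume gA: "g \<in> carrier G \<and> A \<subseteq> carrier G"
    \<comment> \<open>One inequality suffices: for \<open>inv g\<close> and the translated set it
      becomes the reverse one.\<close>
    have le: "\<mu> B \<le> \<mu> (g <# B)" if g: "g \<in> carrier G" and B: "B \<subseteq> carrier G" for g B
    proof -
      have "X n B \<le> X n (g <# B) + real (card ((\<lambda>x. g \<otimes> x) ` F n - F n)) / real (card (F n))" for n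
      proof -
        have "card (B \<inter> F n) = card ((\<lambda>x. g \<otimes> x) ` (B \<inter> F n))"
          using g F(3)[of n] by (intro card_image[symmetric] inj_on_subset[OF inj_on_cmult[of g]]) auto
        also have "\<dots> \<le> card ((g <# B) \<inter> F n \<union> ((\<lambda>x. g \<otimes> x) ` F n - F n))"
          using F(1)[of n] by (intro card_mono) (auto simp: l_coset_def)
        also have "\<dots> \<le> card ((g <# B) \<inter> F n) + card ((\<lambda>x. g \<otimes> x) ` F n - F n)"
          by (rule card_Un_le)
        finally have "real (card (B \<inter> F n)) \<le> real (card ((g <# B) \<inter> F n)) + real (card ((\<lambda>x. g \<otimes> x) ` F n - F n))"
          by linarith
        then have "real (card (B \<inter> F n)) / real (card (F n)) \<le> (real (card ((g <# B) \<inter> F n)) + real (card ((\<lambda>x. g \<otimes> x) ` F n - F n))) / real (card (F n))"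
          by (rule divide_right_mono) simp
        then show ?thesis by (simp add: X_def add_divide_distrib)
      qed
      then have "\<mu> B \<le> \<mu> (g <# B) + 0"
        by (intro tendsto_le[OF U(1) tendsto_add[OF \<mu> filterlim_mono[OF lim[OF g] order_refl U(2)]] \<mu>] always_eventually allI)
      then show ?thesis by simp
    qed
    have "inv g <# (g <# A) = A"
      using gA by (simp add: lcos_m_assoc lcos_mult_one)
    then show "\<mu> (g <# A) = \<mu> A"
      using le[of g A] le[of "inv g" "g <# A"] gA l_coset_subset_G[of A g] by simp
  qed
qed

section \<open>Amenable subgroups of SL2Z\<close>

definition pairwise_elementary :: "Z2x2 set \<Rightarrow> bool" where
  "pairwise_elementary S \<longleftrightarrow> (\<forall>g\<in>S. \<forall>h\<in>S. \<not> noncomm_pair g h)"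

lemma subgroup_SL2Z_D:
  assumes "subgroup S SL2Z"
  shows "\<And>g. g \<in> S \<Longrightarrow> det g = 1" "\<And>g h. g \<in> S \<Longrightarrow> h \<in> S \<Longrightarrow> g ** h \<in> S" "mat 1 \<in> S"
    "\<And>g. g \<in> S \<Longrightarrow> inv\<^bsub>SL2Z\<^esub> g \<in> S" "S \<subseteq> carrier SL2Z"
  using subgroup.subset[OF assms] subgroup.m_closed[OF assms] subgroup.one_closed[OF assms]
    subgroup.m_inv_closed[OF assms] by auto

lemma subgroup_group: "group G \<Longrightarrow> subgroup H G \<Longrightarrow> group (G\<lparr>carrier := H\<rparr>)"
  by (simp add: subgroup.subgroup_is_group)

lemma subgroup_pow_closed:
  assumes "subgroup S SL2Z" "g \<in> S" shows "g [^]\<^bsub>SL2Z\<^esub> (n::nat) \<in> S"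
  using assms by (induction n) (auto simp: subgroup_SL2Z_D)

lemma amenable_pairwise_elementary:
  assumes S: "subgroup S SL2Z" and am: "amenable (SL2Z\<lparr>carrier := S\<rparr>)"
  shows "pairwise_elementary S"
  unfolding pairwise_elementary_def
proof (intro ballI notI)
  fix g h assume gh: "g \<in> S" "h \<in> S" and nc: "noncomm_pair g h"
  have lc: "k <#\<^bsub>SL2Z\<lparr>carrier := S\<rparr>\<^esub> A = (\<lambda>x. k ** x) ` A" for k A by (auto simp: l_coset_def)
  obtain \<mu> where "(\<forall>A. A \<subseteq> S \<longrightarrow> 0 \<le> \<mu> A) \<and> \<mu> S = (1::real) \<and>
      (\<forall>A B. A \<subseteq> S \<and> B \<subseteq> S \<and> A \<inter> B = {} \<longrightarrow> \<mu> (A \<union> B) = \<mu> A + \<mu> B) \<and>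
      (\<forall>g A. g \<in> S \<and> A \<subseteq> S \<longrightarrow> \<mu> ((\<lambda>x. g ** x) ` A) = \<mu> A)"
    using am unfolding amenable_def lc by (elim exE) (rule that, simp)
  then have \<mu>: "\<And>A. A \<subseteq> S \<Longrightarrow> 0 \<le> \<mu> A" "\<mu> S = (1::real)"
     "\<And>A B. A \<subseteq> S \<Longrightarrow> B \<subseteq> S \<Longrightarrow> A \<inter> B = {} \<Longrightarrow> \<mu> (A \<union> B) = \<mu> A + \<mu> B"
     "\<And>g A. g \<in> S \<Longrightarrow> A \<subseteq> S \<Longrightarrow> \<mu> ((\<lambda>x. g ** x) ` A) = \<mu> A"
    by simp_all
  have mono: "\<mu> A \<le> \<mu> B" if "A \<subseteq> B" "B \<subseteq> S" for A B
  proof -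
    have "\<mu> (A \<union> (B - A)) = \<mu> A + \<mu> (B - A)" using that by (intro \<mu>(3)) auto
    moreover have "A \<union> (B - A) = B" using that by auto
    moreover have "0 \<le> \<mu> (B - A)" using that by (intro \<mu>(1)) auto
    ultimately show ?thesis by simp
  qed
  obtain \<delta> where \<delta>: "0 < \<delta>" "\<And>p. \<delta> * nsq p \<le> \<bar>qform g p\<bar> + \<bar>qform h p\<bar>"
    using noncomm_pair_bound[OF nc] by blast
  \<comment> \<open>The orbit map of the vector \<open>(1, 0)\<close> turns left multiplication into
    the action on the plane, so cones pull back to subsets of \<open>S\<close>. With
    \<open>\<delta> / 2\<close>, a bound on the sum of the two forms puts every nonzero vector into
    one of the two cones.\<close>
  define A where "A k = {s \<in> S. act s (1, 0) \<in> qcone k (\<delta> / 2)}" for k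
  have third: "3 * \<mu> (A k) \<le> 1" if k: "k \<in> S" "4 \<le> (tr k)\<^sup>2" for k
  proof -
    obtain f where f: "f \<in> range (\<lambda>n::nat. k [^]\<^bsub>SL2Z\<^esub> n)"
      "\<And>p. p \<in> qcone k (\<delta> / 2) \<Longrightarrow> act f p \<notin> qcone k (\<delta> / 2) \<and> act f (act f p) \<notin> qcone k (\<delta> / 2)"
      using cone_escape[of k "\<delta> / 2"] k \<delta>(1) subgroup_SL2Z_D(1)[OF S] by (metis half_gt_zero)
    have fS: "f \<in> S" using f(1) subgroup_pow_closed[OF S k(1)] by auto
    have inj: "x = y" if "f ** x = f ** y" "x \<in> S" "y \<in> S" for x y
    proof -
      interpret group SL2Z by (rule group_SL2Z)
      have "inj_on (\<lambda>x. f ** x) {x. det x = 1}" using inj_on_cmult[of f] subgroup_SL2Z_D(1)[OF S fS] by (simp add: SL2Z_def)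
      then show ?thesis by (rule inj_onD) (use that subgroup_SL2Z_D(1)[OF S] in auto)
    qed
    let ?A = "A k" and ?B = "(\<lambda>x. f ** x) ` A k" and ?C = "(\<lambda>x. f ** x) ` (\<lambda>x. f ** x) ` A k"
    have sub: "?A \<subseteq> S" by (auto simp: A_def)
    then have sub2: "?B \<subseteq> S" using fS subgroup_SL2Z_D(2)[OF S] by blast
    then have sub3: "?C \<subseteq> S" using fS subgroup_SL2Z_D(2)[OF S] by blast
    have out: "f ** x \<notin> A k" "f ** (f ** x) \<notin> A k" if "x \<in> A k" for x
      using f(2)[of "act x (1, 0)"] that by (simp_all add: A_def act_mult)
    have d1: "?A \<inter> ?B = {}" using out(1) by blast
    have d2: "?A \<inter> ?C = {}" using out(2) by blast
    \<comment> \<open>This is the translate by \<open>f\<close> of the disjointness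
      \<open>d1\<close>, as left multiplication is injective.\<close>
    have d3: "?B \<inter> ?C = {}"
    proof -
      have False if "x \<in> A k" "y \<in> A k" "f ** x = f ** (f ** y)" for x y
        using that inj[of x "f ** y"] d1 sub sub2 by blast
      then show ?thesis by blast
    qed
    have "\<mu> ((?A \<union> ?B) \<union> ?C) = \<mu> (?A \<union> ?B) + \<mu> ?C" using sub sub2 sub3 d2 d3 by (intro \<mu>(3)) blast+
    also have "\<dots> = \<mu> ?A + \<mu> ?B + \<mu> ?C" using sub sub2 d1 by (simp add: \<mu>(3))
    also have "\<dots> = 3 * \<mu> (A k)" using \<mu>(4)[OF fS sub] \<mu>(4)[OF fS sub2] by simp
    finally show ?thesis using mono[of "(?A \<union> ?B) \<union> ?C" S] sub sub2 sub3 \<mu>(2) by simp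
  qed
  have "S \<subseteq> A g \<union> A h"
  proof
    fix s assume s: "s \<in> S"
    then have "act s (1, 0) \<noteq> 0" by (intro act_nonzero subgroup_SL2Z_D(1)[OF S]) (auto simp: zero_prod_def)
    then show "s \<in> A g \<union> A h" using \<delta>(2)[of "act s (1, 0)"] s by (auto simp: A_def qcone_def)
  qed
  then have "1 \<le> \<mu> (A g \<union> (A h - A g))" using mono[of S "A g \<union> (A h - A g)"] \<mu>(2) by (auto simp: A_def)
  also have "\<dots> = \<mu> (A g) + \<mu> (A h - A g)" by (rule \<mu>(3)) (auto simp: A_def)
  also have "\<mu> (A h - A g) \<le> \<mu> (A h)" by (rule mono) (auto simp: A_def)
  finally show False using third[OF gh(1)] third[OF gh(2)] nc by (simp add: noncomm_pair_def)
qed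

section \<open>The congruence subgroup of level 3\<close>

definition cong3 :: "Z2x2 \<Rightarrow> Z2x2 \<Rightarrow> bool" where
  "cong3 g h \<longleftrightarrow> (\<forall>i j. 3 dvd g$i$j - h$i$j)"

lemma cong3_expand: "cong3 g h \<longleftrightarrow> 3 dvd g$1$1 - h$1$1 \<and> 3 dvd g$1$2 - h$1$2 \<and> 3 dvd g$2$1 - h$2$1 \<and> 3 dvd g$2$2 - h$2$2"
  unfolding cong3_def forall_2 by (rule conj_assoc)

text \<open>With entries written as those of the identity plus multiples of 3, the determinant
  forces the trace to be 2 modulo 9, which avoids -1, 0 and 1.\<close>

lemma cong3_trace:
  assumes "det g = 1" "cong3 g (mat 1)" shows "4 \<le> (tr g)\<^sup>2"
proof -
  obtain a b c d where "g$1$1 - 1 = 3 * a" "g$1$2 = 3 * b" "g$2$1 = 3 * c" "g$2$2 - 1 = 3 * d"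
    using assms(2) unfolding cong3_expand mat_def dvd_def by auto
  then have e: "g$1$1 = 1 + 3 * a" "g$1$2 = 3 * b" "g$2$1 = 3 * c" "g$2$2 = 1 + 3 * d" by auto
  define k where "k = a * d - b * c"
  have "3 * (a + d) + 9 * k = 0" using assms(1) unfolding det_2 e k_def by algebra
  then have t: "tr g = 2 - 9 * k" unfolding e by (simp add: algebra_simps)
  have "2 \<le> \<bar>tr g\<bar>" unfolding t by presburger
  then have "2\<^sup>2 \<le> \<bar>tr g\<bar>\<^sup>2" by (intro power_mono) auto
  then show ?thesis by simp
qed

text \<open>Multiplication by \<open>g\<close> is invertible modulo 3, since the adjugate recovers
  \<open>k\<close> from \<open>h\<close>. Thus left cosets of the congruence subgroup are congruence
  classes.\<close>

lemma cong3_mult_left: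
  assumes "g ** k = h" "det g = 1" shows "cong3 k (mat 1) \<longleftrightarrow> cong3 h g"
proof -
  obtain a b c d where g: "g$1$1 = a" "g$1$2 = b" "g$2$1 = c" "g$2$2 = d" by blast
  have dt: "a * d - b * c = 1" using assms(2) by (simp add: det_2 g)
  obtain p q r s where k: "k$1$1 = 1 + p" "k$1$2 = q" "k$2$1 = r" "k$2$2 = 1 + s"
    by (metis add_diff_cancel_left' diff_add_cancel add.commute)
  have h: "h$1$1 - a = a * p + b * r" "h$1$2 - b = a * q + b * s" "h$2$1 - c = c * p + d * r" "h$2$2 - d = c * q + d * s"
    unfolding assms(1)[symmetric] mat_mult_entries g k by (simp_all add: algebra_simps)
  have b: "p = d * (a * p + b * r) - b * (c * p + d * r)" "r = a * (c * p + d * r) - c * (a * p + b * r)"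
    "q = d * (a * q + b * s) - b * (c * q + d * s)" "s = a * (c * q + d * s) - c * (a * q + b * s)"
    using dt by algebra+
  have "cong3 h g \<longleftrightarrow> 3 dvd a * p + b * r \<and> 3 dvd a * q + b * s \<and> 3 dvd c * p + d * r \<and> 3 dvd c * q + d * s"
    unfolding cong3_expand g h ..
  also have "\<dots> \<longleftrightarrow> 3 dvd p \<and> 3 dvd q \<and> 3 dvd r \<and> 3 dvd s"
  proof (intro iffI conjI; elim conjE)
    assume "3 dvd a * p + b * r" "3 dvd a * q + b * s" "3 dvd c * p + d * r" "3 dvd c * q + d * s"
    then show "3 dvd p" "3 dvd q" "3 dvd r" "3 dvd s" by (subst b, simp)+
  qed simp_all
  also have "\<dots> \<longleftrightarrow> cong3 k (mat 1)" unfolding cong3_expand k by (simp add: mat_def)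
  finally show ?thesis by simp
qed

lemma cong3_sym: "cong3 g h \<Longrightarrow> cong3 h g"
  unfolding cong3_def by (simp add: dvd_diff_commute)

lemma cong3_trans: "cong3 g h \<Longrightarrow> cong3 h k \<Longrightarrow> cong3 g k"
  unfolding cong3_def 
proof (intro allI)
  fix i j assume "\<forall>i j. 3 dvd g$i$j - h$i$j" "\<forall>i j. 3 dvd h$i$j - k$i$j"
  then have "3 dvd (g$i$j - h$i$j) + (h$i$j - k$i$j)" by (intro dvd_add) blast+
  then show "3 dvd g$i$j - k$i$j" by simp
qed

text \<open>Presents congruence classes as fibres of a map with finite range, which is how finite
  index enters.\<close>

definition residues3 :: "Z2x2 \<Rightarrow> int \<times> int \<times> int \<times> int" where
  "residues3 g = (g$1$1 mod 3, g$1$2 mod 3, g$2$1 mod 3, g$2$2 mod 3)"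

lemma residues3_eq_iff: "residues3 g = residues3 h \<longleftrightarrow> cong3 g h"
  by (simp add: residues3_def cong3_expand mod_eq_dvd_iff)

lemma finite_range_residues3: "finite (range residues3)"
  by (rule finite_subset[of _ "{0..<3} \<times> {0..<3} \<times> {0..<3} \<times> {0..<3}"]) (auto simp: residues3_def)

lemma pairwise_elementary_folner:
  assumes S: "subgroup S SL2Z" and pe: "pairwise_elementary S"
  shows "folner (SL2Z\<lparr>carrier := S\<rparr>)"
proof -
  interpret SL: group SL2Z by (rule group_SL2Z)
  define G where "G = SL2Z\<lparr>carrier := S\<rparr>"
  interpret G: group G unfolding G_def by (rule subgroup_group[OF group_SL2Z S])
  note SD = subgroup_SL2Z_D[OF S]
  have G_simps [simp]: "carrier G = S" "mult G = (**)" "one G = mat 1" by (simp_all add: G_def)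
  have invG: "g ** inv\<^bsub>G\<^esub> g = mat 1" "inv\<^bsub>G\<^esub> g \<in> S" if "g \<in> S" for g
    using G.r_inv[of g] G.inv_closed[of g] that by auto
  define N where "N = {g \<in> S. cong3 g (mat 1)}"
  have quot: "inv\<^bsub>G\<^esub> g ** h \<in> N \<longleftrightarrow> cong3 h g" if "g \<in> S" "h \<in> S" for g h
  proof -
    have "g ** (inv\<^bsub>G\<^esub> g ** h) = h" using invG[OF that(1)] by (simp add: matrix_mul_assoc)
    then have "cong3 (inv\<^bsub>G\<^esub> g ** h) (mat 1) \<longleftrightarrow> cong3 h g" by (rule cong3_mult_left) (simp add: SD that)
    then show ?thesis using that invG SD by (simp add: N_def)
  qed
  have subN: "subgroup N G"
  proof (rule G.subgroupI)
    show "N \<subseteq> carrier G" by (auto simp: N_def)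
    have "mat 1 \<in> N" using SD by (simp add: N_def cong3_def)
    then show "N \<noteq> {}" by blast
  next
    fix g assume "g \<in> N"
    then have g: "g \<in> S" "cong3 g (mat 1)" by (auto simp: N_def)
    have "inv\<^bsub>G\<^esub> g ** mat 1 \<in> N" using g SD by (simp only: quot cong3_sym)
    then show "inv\<^bsub>G\<^esub> g \<in> N" by simp
  next
    fix g h assume "g \<in> N" "h \<in> N"
    then have gh: "g \<in> S" "cong3 g (mat 1)" "h \<in> S" "cong3 h (mat 1)" by (auto simp: N_def)
    have "cong3 (g ** h) g" using cong3_mult_left[OF refl, of g h] gh SD by simp
    then show "g \<otimes>\<^bsub>G\<^esub> h \<in> N" using cong3_trans gh SD by (auto simp: N_def)
  qed
  have "comm_group (G\<lparr>carrier := N\<rparr>)"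
  proof (rule group.group_comm_groupI)
    show "group (G\<lparr>carrier := N\<rparr>)" by (rule subgroup_group[OF G.group_axioms subN])
    fix g h assume "g \<in> carrier (G\<lparr>carrier := N\<rparr>)" "h \<in> carrier (G\<lparr>carrier := N\<rparr>)"
    then have gh: "g \<in> N" "h \<in> N" by auto
    then have "\<not> noncomm_pair g h" using pe by (auto simp: pairwise_elementary_def N_def)
    then show "g \<otimes>\<^bsub>G\<lparr>carrier := N\<rparr>\<^esub> h = h \<otimes>\<^bsub>G\<lparr>carrier := N\<rparr>\<^esub> g"
      using gh cong3_trace SD by (auto simp: noncomm_pair_def N_def)
  qed
  then have "folner (G\<lparr>carrier := N\<rparr>)" by (rule folner_comm_group)
  then show ?thesis unfolding G_def[symmetric]
  proof (rule folner_extension[OF G.group_axioms subN])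
    fix E and \<epsilon> :: real assume E: "finite E" "E \<subseteq> carrier G" "0 < \<epsilon>"
    \<comment> \<open>One representative for each congruence class that meets \<open>S\<close>. A
      translate of a representative lies in a represented class again, so the set of bad
      representatives is empty.\<close>
    define F where "F = inv_into S residues3 ` residues3 ` S"
    have rep: "inv_into S residues3 (residues3 g) \<in> S" "cong3 (inv_into S residues3 (residues3 g)) g" if "g \<in> S" for g
      using that by (auto simp: inv_into_into f_inv_into_f simp flip: residues3_eq_iff)
    have FS: "F \<subseteq> S" using rep by (auto simp: F_def)
    show "\<exists>F. finite F \<and> F \<noteq> {} \<and> F \<subseteq> carrier G \<and>
        (\<forall>s\<in>F. \<forall>s'\<in>F. inv\<^bsub>G\<^esub> s \<otimes>\<^bsub>G\<^esub> s' \<in> N \<longrightarrow> s = s') \<and>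
        (\<forall>t\<in>E. real (card {s \<in> F. \<forall>s'\<in>F. inv\<^bsub>G\<^esub> s' \<otimes>\<^bsub>G\<^esub> (t \<otimes>\<^bsub>G\<^esub> s) \<notin> N}) \<le> \<epsilon> * real (card F))"
    proof (intro exI[of _ F] conjI ballI impI)
      show "finite F" unfolding F_def by (intro finite_imageI finite_subset[OF _ finite_range_residues3]) auto
      show "F \<noteq> {}" using SD by (auto simp: F_def)
      show "F \<subseteq> carrier G" using FS by simp
      fix s s' assume s: "s \<in> F" "s' \<in> F" "inv\<^bsub>G\<^esub> s \<otimes>\<^bsub>G\<^esub> s' \<in> N"
      then have "residues3 s' = residues3 s" using quot[of s s'] FS by (auto simp: residues3_eq_iff)
      moreover obtain g g' where "s = inv_into S residues3 (residues3 g)" "g \<in> S" "s' = inv_into S residues3 (residues3 g')" "g' \<in> S"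
        using s by (auto simp: F_def)
      ultimately show "s = s'" by (metis f_inv_into_f imageI)
    next
      fix t assume t: "t \<in> E"
      have "\<exists>s'\<in>F. inv\<^bsub>G\<^esub> s' \<otimes>\<^bsub>G\<^esub> (t \<otimes>\<^bsub>G\<^esub> s) \<in> N" if "s \<in> F" for s
      proof -
        have ts: "t ** s \<in> S" using that t E FS by (intro SD(2)) auto
        then have "inv_into S residues3 (residues3 (t ** s)) \<in> F" by (auto simp: F_def)
        moreover have "inv\<^bsub>G\<^esub> (inv_into S residues3 (residues3 (t ** s))) ** (t ** s) \<in> N"
          using quot rep[OF ts] ts cong3_sym by blast
        ultimately show ?thesis by auto
      qed
      then have empty: "{s \<in> F. \<forall>s'\<in>F. inv\<^bsub>G\<^esub> s' \<otimes>\<^bsub>G\<^esub> (t \<otimes>\<^bsub>G\<^esub> s) \<notin> N} = {}" by blast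
      then show "real (card {s \<in> F. \<forall>s'\<in>F. inv\<^bsub>G\<^esub> s' \<otimes>\<^bsub>G\<^esub> (t \<otimes>\<^bsub>G\<^esub> s) \<notin> N}) \<le> \<epsilon> * real (card F)"
        unfolding empty using E by simp
    qed
  qed
qed

section \<open>Folner sets in the semidirect product\<close>

lemma Z2_SL2Z_simps [simp]:
  "(a, g) \<in> carrier Z2_SL2Z \<longleftrightarrow> det g = 1" "mult Z2_SL2Z (a, g) (b, h) = (a + g *v b, g ** h)"
  "one Z2_SL2Z = (0, mat 1)"
  by (auto simp: Z2_SL2Z_def)

lemma snd_hom: "snd \<in> hom Z2_SL2Z SL2Z"
  by (auto simp: hom_def Z2_SL2Z_def)

lemma subgroup_Times:
  assumes S: "subgroup S SL2Z" shows "subgroup (UNIV \<times> S) Z2_SL2Z"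
proof -
  interpret group Z2_SL2Z by (rule group_Z2_SL2Z)
  interpret sh: group_hom Z2_SL2Z SL2Z snd
    by (simp add: group_hom_def group_hom_axioms_def group_Z2_SL2Z group_SL2Z snd_hom)
  note SD = subgroup_SL2Z_D[OF S]
  show ?thesis
  proof (rule subgroupI)
    show "UNIV \<times> S \<subseteq> carrier Z2_SL2Z" using SD by auto
    show "UNIV \<times> S \<noteq> {}" using SD by auto
    fix x assume x: "x \<in> (UNIV :: Z2 set) \<times> S"
    then have "snd (inv\<^bsub>Z2_SL2Z\<^esub> x) = inv\<^bsub>SL2Z\<^esub> (snd x)" using SD by (intro sh.hom_inv) auto
    then show "inv\<^bsub>Z2_SL2Z\<^esub> x \<in> UNIV \<times> S" using x SD by (cases "inv\<^bsub>Z2_SL2Z\<^esub> x") auto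
  next
    fix x y assume "x \<in> (UNIV :: Z2 set) \<times> S" "y \<in> (UNIV :: Z2 set) \<times> S"
    then show "x \<otimes>\<^bsub>Z2_SL2Z\<^esub> y \<in> UNIV \<times> S" using SD by auto
  qed
qed

text \<open>Cosets of the abelian group of translations are indexed by matrix parts. A Folner set of
  \<open>S\<close>, lifted with translation part 0, is therefore the transversal that
  \<open>folner_extension\<close> asks for.\<close>

lemma folner_Times:
  assumes S: "subgroup S SL2Z" and fS: "folner (SL2Z\<lparr>carrier := S\<rparr>)"
  shows "folner (Z2_SL2Z\<lparr>carrier := UNIV \<times> S\<rparr>)"
proof -
  define G where "G = Z2_SL2Z\<lparr>carrier := UNIV \<times> S\<rparr>"
  interpret G: group G unfolding G_def by (rule subgroup_group[OF group_Z2_SL2Z subgroup_Times[OF S]])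
  note SD = subgroup_SL2Z_D[OF S]
  have G_simps [simp]: "carrier G = UNIV \<times> S" "mult G (a, g) (b, h) = (a + g *v b, g ** h)" "one G = (0, mat 1)"
    for a g b h by (simp_all add: G_def)
  define N where "N = (UNIV :: Z2 set) \<times> {mat 1 :: Z2x2}"
  have quot: "inv\<^bsub>G\<^esub> x \<otimes>\<^bsub>G\<^esub> y \<in> N \<longleftrightarrow> snd x = snd y" if "x \<in> carrier G" "y \<in> carrier G" for x y
  proof -
    define z where "z = inv\<^bsub>G\<^esub> x \<otimes>\<^bsub>G\<^esub> y"
    have z: "z \<in> carrier G" and y: "y = x \<otimes>\<^bsub>G\<^esub> z" using that by (simp_all add: z_def G.m_assoc[symmetric] del: G_simps)
    obtain a g where x: "x = (a, g)" by (cases x)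
    obtain b k where zz: "z = (b, k)" by (cases z)
    have g: "g \<in> S" "k \<in> S" using that(1) z x zz by auto
    have "g ** k = g \<longleftrightarrow> k = mat 1"
    proof
      interpret SL: group SL2Z by (rule group_SL2Z)
      assume "g ** k = g"
      then show "k = mat 1" using SL.l_cancel_one[of g k] g SD by auto
    qed simp
    moreover have "snd y = g ** k" using y by (simp add: x zz)
    moreover have "inv\<^bsub>G\<^esub> x \<otimes>\<^bsub>G\<^esub> y = (b, k)" using zz by (simp only: z_def)
    ultimately show ?thesis by (auto simp: N_def x)
  qed
  have subN: "subgroup N G"
  proof (rule G.subgroupI)
    show "N \<subseteq> carrier G" "N \<noteq> {}" using SD by (auto simp: N_def)
    fix x assume "x \<in> N"
    then have x: "x \<in> carrier G" "snd x = mat 1" using SD by (auto simp: N_def)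
    have "inv\<^bsub>G\<^esub> x \<otimes>\<^bsub>G\<^esub> \<one>\<^bsub>G\<^esub> \<in> N" using x SD by (subst quot) auto
    then show "inv\<^bsub>G\<^esub> x \<in> N" using x(1) by (simp del: G_simps)
  next
    fix x y assume "x \<in> N" "y \<in> N"
    then show "x \<otimes>\<^bsub>G\<^esub> y \<in> N" by (auto simp: N_def)
  qed
  have "comm_group (G\<lparr>carrier := N\<rparr>)"
  proof (rule group.group_comm_groupI)
    show "group (G\<lparr>carrier := N\<rparr>)" by (rule subgroup_group[OF G.group_axioms subN])
    fix x y assume "x \<in> carrier (G\<lparr>carrier := N\<rparr>)" "y \<in> carrier (G\<lparr>carrier := N\<rparr>)"
    then show "x \<otimes>\<^bsub>G\<lparr>carrier := N\<rparr>\<^esub> y = y \<otimes>\<^bsub>G\<lparr>carrier := N\<rparr>\<^esub> x"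
      by (auto simp: N_def)
  qed
  then have "folner (G\<lparr>carrier := N\<rparr>)" by (rule folner_comm_group)
  then show ?thesis unfolding G_def[symmetric]
  proof (rule folner_extension[OF G.group_axioms subN])
    fix E and \<epsilon> :: real assume E: "finite E" "E \<subseteq> carrier G" "0 < \<epsilon>"
    have sndE: "snd ` E \<subseteq> S" using E(2) by auto
    have "\<exists>F. finite F \<and> F \<noteq> {} \<and> F \<subseteq> S \<and> (\<forall>t\<in>snd ` E. real (card ((\<lambda>x. t ** x) ` F - F)) \<le> \<epsilon> * real (card F))"
      using spec[OF spec[OF fS[unfolded folner_def], of "snd ` E"], of \<epsilon>] E sndE by simp
    then obtain F where FF: "finite F \<and> F \<noteq> {} \<and> F \<subseteq> S \<and> (\<forall>t\<in>snd ` E. real (card ((\<lambda>x. t ** x) ` F - F)) \<le> \<epsilon> * real (card F))" ..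
    define F' where "F' = (\<lambda>s. (0 :: Z2, s)) ` F"
    have cF: "card F' = card F" unfolding F'_def by (rule card_image) (auto intro: inj_onI)
    show "\<exists>F. finite F \<and> F \<noteq> {} \<and> F \<subseteq> carrier G \<and>
        (\<forall>s\<in>F. \<forall>s'\<in>F. inv\<^bsub>G\<^esub> s \<otimes>\<^bsub>G\<^esub> s' \<in> N \<longrightarrow> s = s') \<and>
        (\<forall>t\<in>E. real (card {s \<in> F. \<forall>s'\<in>F. inv\<^bsub>G\<^esub> s' \<otimes>\<^bsub>G\<^esub> (t \<otimes>\<^bsub>G\<^esub> s) \<notin> N}) \<le> \<epsilon> * real (card F))"
    proof (intro exI[of _ F'] conjI ballI impI)
      show "finite F'" "F' \<noteq> {}" "F' \<subseteq> carrier G" using FF by (auto simp: F'_def)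
      fix s s' assume "s \<in> F'" "s' \<in> F'" "inv\<^bsub>G\<^esub> s \<otimes>\<^bsub>G\<^esub> s' \<in> N"
      then obtain x y where "s = (0, x)" "s' = (0, y)" "x \<in> S" "y \<in> S" using FF by (auto simp: F'_def)
      with \<open>inv\<^bsub>G\<^esub> s \<otimes>\<^bsub>G\<^esub> s' \<in> N\<close> show "s = s'" using quot[of s s'] by simp
    next
      fix t assume t: "t \<in> E"
      have "{s \<in> F'. \<forall>s'\<in>F'. inv\<^bsub>G\<^esub> s' \<otimes>\<^bsub>G\<^esub> (t \<otimes>\<^bsub>G\<^esub> s) \<notin> N} \<subseteq> (\<lambda>s. (0, s)) ` {s \<in> F. snd t ** s \<notin> F}"
      proof (intro subsetI, elim CollectE conjE)
        fix x assume x: "x \<in> F'" "\<forall>s'\<in>F'. inv\<^bsub>G\<^esub> s' \<otimes>\<^bsub>G\<^esub> (t \<otimes>\<^bsub>G\<^esub> x) \<notin> N"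
        then obtain s where s: "x = (0, s)" "s \<in> F" by (auto simp: F'_def)
        obtain b g where tt: "t = (b, g)" by (cases t)
        have "snd t ** s \<notin> F"
        proof
          assume *: "snd t ** s \<in> F"
          then have "inv\<^bsub>G\<^esub> (0, snd t ** s) \<otimes>\<^bsub>G\<^esub> (t \<otimes>\<^bsub>G\<^esub> x) \<notin> N" using x(2) by (auto simp: F'_def)
          moreover have "inv\<^bsub>G\<^esub> (0, snd t ** s) \<otimes>\<^bsub>G\<^esub> (t \<otimes>\<^bsub>G\<^esub> x) \<in> N"
            using * FF tt by (subst quot) (auto simp: s)
          ultimately show False by contradiction
        qed
        then show "x \<in> (\<lambda>s. (0, s)) ` {s \<in> F. snd t ** s \<notin> F}" using s by auto
      qed
      then have "card {s \<in> F'. \<forall>s'\<in>F'. inv\<^bsub>G\<^esub> s' \<otimes>\<^bsub>G\<^esub> (t \<otimes>\<^bsub>G\<^esub> s) \<notin> N} \<le> card ((\<lambda>s. (0 :: Z2, s)) ` {s \<in> F. snd t ** s \<notin> F})"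
        using FF by (intro card_mono) auto
      also have "\<dots> = card {s \<in> F. snd t ** s \<notin> F}" by (rule card_image) (auto intro: inj_onI)
      also have "\<dots> = card ((\<lambda>x. snd t ** x) ` {s \<in> F. snd t ** s \<notin> F})"
      proof (rule card_image[symmetric], rule inj_onI)
        interpret SL: group SL2Z by (rule group_SL2Z)
        fix x y assume "x \<in> {s \<in> F. snd t ** s \<notin> F}" "y \<in> {s \<in> F. snd t ** s \<notin> F}" "snd t ** x = snd t ** y"
        then have eq: "snd t ** x = snd t ** y" and xy: "det x = 1" "det y = 1" using FF SD(1) by auto
        have "snd t \<in> S" using E t by auto
        then have "inj_on (\<lambda>x. snd t ** x) {x. det x = 1}" using SL.inj_on_cmult[of "snd t"] SD(1) by (simp add: SL2Z_def)
        then show "x = y" using eq by (rule inj_onD) (use xy in auto)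
      qed
      also have "\<dots> \<le> card ((\<lambda>x. snd t ** x) ` F - F)" using FF by (intro card_mono) auto
      finally show "real (card {s \<in> F'. \<forall>s'\<in>F'. inv\<^bsub>G\<^esub> s' \<otimes>\<^bsub>G\<^esub> (t \<otimes>\<^bsub>G\<^esub> s) \<notin> N}) \<le> \<epsilon> * real (card F')"
        using FF t unfolding cF by fastforce
    qed
  qed
qed

section \<open>Trigonometric polynomials and positive definite functions\<close>

text \<open>Formal sums in which a frequency may occur repeatedly: addition is concatenation, and a
  linear functional is a sum over the list.\<close>

type_synonym trig = "(complex \<times> int \<times> int) list"

definition dotp :: "int \<times> int \<Rightarrow> real \<times> real \<Rightarrow> real" where
  "dotp a u = of_int (fst a) * fst u + of_int (snd a) * snd u"

definition trig_eval :: "trig \<Rightarrow> real \<times> real \<Rightarrow> complex" where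
  "trig_eval xs u = (\<Sum>(c, a)\<leftarrow>xs. c * cis (dotp a u))"

text \<open>For positive definite \<open>\<psi>\<close> this is integration against the spectral
  measure with Fourier coefficients \<open>\<psi>\<close>, written without the measure.\<close>

definition trig_functional :: "(int \<times> int \<Rightarrow> complex) \<Rightarrow> trig \<Rightarrow> complex" where
  "trig_functional \<psi> xs = (\<Sum>(c, a)\<leftarrow>xs. c * \<psi> a)"

lemma trig_eval_simps [simp]:
  "trig_eval [] u = 0" "trig_eval ((c, a) # xs) u = c * cis (dotp a u) + trig_eval xs u"
  "trig_eval (xs @ ys) u = trig_eval xs u + trig_eval ys u"
  by (simp_all add: trig_eval_def)

lemma trig_functional_simps [simp]:
  "trig_functional \<psi> [] = 0" "trig_functional \<psi> ((c, a) # xs) = c * \<psi> a + trig_functional \<psi> xs"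
  "trig_functional \<psi> (xs @ ys) = trig_functional \<psi> xs + trig_functional \<psi> ys"
  by (simp_all add: trig_functional_def)

definition scale :: "complex \<Rightarrow> trig \<Rightarrow> trig" where
  "scale r xs = map (\<lambda>(c, a). (r * c, a)) xs"

lemma trig_eval_scale [simp]: "trig_eval (scale r xs) u = r * trig_eval xs u"
  by (induction xs) (auto simp: scale_def algebra_simps)

lemma trig_functional_scale [simp]: "trig_functional \<psi> (scale r xs) = r * trig_functional \<psi> xs"
  by (induction xs) (auto simp: scale_def algebra_simps)

lemma dotp_add: "dotp (a + b) u = dotp a u + dotp b u"
  by (simp add: dotp_def algebra_simps)

lemma dotp_diff: "dotp (a - b) u = dotp a u - dotp b u"
  by (simp add: dotp_def algebra_simps)

lemma cis_dotp_diff: "cis (dotp (a - b) u) = cis (dotp a u) * cis (- dotp b u)"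
  by (simp add: dotp_diff cis_mult)

lemma dotp_zero [simp]: "dotp (0, 0) u = 0" "dotp 0 u = 0"
  by (simp_all add: dotp_def)

lemma sum_roots_of_unity:
  fixes k :: int
  assumes "\<bar>k\<bar> < int M"
  shows "(\<Sum>y<M. cis (of_int k * (2 * pi * real y / real M))) = (if k = 0 then of_nat M else 0)"
proof (cases "k = 0")
  case False
  define w where "w = cis (2 * pi * of_int k / real M)"
  have M: "M > 0" using assms by linarith
  have p: "cis (of_int k * (2 * pi * real y / real M)) = w ^ y" for y
    unfolding w_def Complex.DeMoivre by (simp add: field_simps)
  have "w ^ M = cis (2 * pi * of_int k)"
    unfolding w_def Complex.DeMoivre using M by simp
  also have "\<dots> = 1" by (rule cis_multiple_2pi) simp
  finally have wM: "w ^ M = 1" .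
  have "w \<noteq> 1"
  proof
    assume "w = 1"
    then have "cos (2 * pi * of_int k / real M) = 1" unfolding w_def by (metis Re_complex_of_real cis.sel(1) of_real_1)
    then obtain n :: int where "2 * pi * of_int k / real M = of_int n * 2 * pi" by (auto simp: cos_one_2pi_int)
    then have "of_int k = of_int n * real M" using M by (simp add: field_simps)
    then have "k = n * int M" by (metis of_int_eq_iff of_int_mult of_int_of_nat_eq)
    with assms False show False by (auto simp: abs_mult mult_less_cancel_right2)
  qed
  then have "(\<Sum>y<M. w ^ y) = 0" by (simp add: geometric_sum wM)
  with False show ?thesis by (simp only: p if_False)
qed simp

text \<open>Discrete orthogonality of characters; the bounds on \<open>a\<close> exclude aliasing
  with nonzero multiples of \<open>M\<close>.\<close>

lemma sum_grid:
  assumes "\<bar>fst a\<bar> < int M" "\<bar>snd a\<bar> < int M"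
  shows "(\<Sum>(y, z)\<in>{..<M} \<times> {..<M}. cis (dotp a (2 * pi * real y / real M, 2 * pi * real z / real M))) =
    (if a = 0 then of_nat (M\<^sup>2) else 0)"
proof -
  have "(\<Sum>(y, z)\<in>{..<M} \<times> {..<M}. cis (dotp a (2 * pi * real y / real M, 2 * pi * real z / real M))) =
    (\<Sum>y<M. cis (of_int (fst a) * (2 * pi * real y / real M))) * (\<Sum>z<M. cis (of_int (snd a) * (2 * pi * real z / real M)))"
    by (simp add: dotp_def sum_product sum.cartesian_product cis_mult)
  also have "\<dots> = (if a = 0 then of_nat (M\<^sup>2) else 0)"
    unfolding sum_roots_of_unity[OF assms(1)] sum_roots_of_unity[OF assms(2)]
    by (cases a) (simp add: zero_prod_def power2_eq_square)
  finally show ?thesis .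
qed

definition int_box :: "nat \<Rightarrow> (int \<times> int) set" where
  "int_box N = {0..<int N} \<times> {0..<int N}"

text \<open>Divided by the square of \<open>N\<close>, this is the Fejer weight of the frequency
  \<open>a\<close>.\<close>

definition difference_count :: "nat \<Rightarrow> int \<times> int \<Rightarrow> nat" where
  "difference_count N a = card {(b, b') \<in> int_box N \<times> int_box N. b' - b = a}"

lemma difference_count_eq:
  assumes "\<bar>fst a\<bar> \<le> int N" "\<bar>snd a\<bar> \<le> int N"
  shows "real (difference_count N a) = (real N - \<bar>of_int (fst a)\<bar>) * (real N - \<bar>of_int (snd a)\<bar>)"
proof -
  obtain i j where a: "a = (i, j)" by (cases a)
  define S where "S = {max 0 (- i)..<min (int N) (int N - i)} \<times> {max 0 (- j)..<min (int N) (int N - j)}"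
  have "{(b, b') \<in> int_box N \<times> int_box N. b' - b = a} = (\<lambda>b. (b, b + a)) ` S"
    by (force simp: int_box_def S_def a image_iff)
  moreover have "inj_on (\<lambda>b. (b, b + a)) S" by (auto intro: inj_onI)
  ultimately have "difference_count N a = card S" by (simp add: difference_count_def card_image)
  also have "\<dots> = nat (int N - \<bar>i\<bar>) * nat (int N - \<bar>j\<bar>)"
    unfolding S_def card_cartesian_product card_atLeastLessThan_int using assms a
    by (intro arg_cong2[where f = "(*)"] arg_cong[where f = nat]) auto
  finally show ?thesis using assms a by (simp add: of_nat_nat)
qed

text \<open>Averaging over a grid extracts Fourier coefficients, so a nonnegative trigonometric
  polynomial pairs nonnegatively with a positive definite sequence multiplied by the Fejer weights;
  these tend to 1.\<close>

lemma trig_functional_nonneg: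
  assumes psd: "\<And>F. finite F \<Longrightarrow> psd F (\<lambda>a b. \<psi> (b - a))"
    and pos: "\<And>u. trig_eval xs u \<in> \<real>\<^sub>\<ge>\<^sub>0"
  shows "trig_functional \<psi> xs \<in> \<real>\<^sub>\<ge>\<^sub>0"
proof -
  define B where "B = Max (insert 1 ((\<lambda>(c, a). max \<bar>fst a\<bar> \<bar>snd a\<bar>) ` set xs))"
  have B: "\<bar>fst a\<bar> \<le> B" "\<bar>snd a\<bar> \<le> B" if "(c, a) \<in> set xs" for c a
  proof -
    have "max \<bar>fst a\<bar> \<bar>snd a\<bar> \<le> B" unfolding B_def using that by (intro Max_ge) force+
    then show "\<bar>fst a\<bar> \<le> B" "\<bar>snd a\<bar> \<le> B" by auto
  qed
  have B1: "B \<ge> 1" unfolding B_def by (intro Max_ge) auto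
  have weighted: "(\<Sum>(c, a)\<leftarrow>xs. c * \<psi> a * of_nat (difference_count N a)) \<in> \<real>\<^sub>\<ge>\<^sub>0" for N
  proof -
    \<comment> \<open>The grid is finer than every frequency \<open>a - (b' - b)\<close> that occurs
      below, so that averaging over it picks out exactly \<open>b' - b = a\<close>.\<close>
    define M where "M = nat B + N + 1"
    have M: "int M > B + int N" using B1 by (simp add: M_def)
    define \<Theta> :: "nat \<times> nat \<Rightarrow> real \<times> real" where "\<Theta> = (\<lambda>(y, z). (2 * pi * real y / real M, 2 * pi * real z / real M))"
    \<comment> \<open>The Fejer mean of \<open>\<psi>\<close> up to normalisation; it is nonnegative
      as the value of the positive semidefinite kernel on the vector of characters
      \<open>cis (- dotp b u)\<close>.\<close>
    define S where "S u = (\<Sum>b\<in>int_box N. \<Sum>b'\<in>int_box N. cis (- dotp (b' - b) u) * \<psi> (b' - b))" for u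
    have Spos: "S u \<in> \<real>\<^sub>\<ge>\<^sub>0" for u
    proof -
      have "(\<Sum>b\<in>int_box N. \<Sum>b'\<in>int_box N. cnj (cis (- dotp b u)) * cis (- dotp b' u) * \<psi> (b' - b)) \<in> \<real>\<^sub>\<ge>\<^sub>0"
        using psd[of "int_box N"] by (simp add: psd_def int_box_def)
      also have "(\<Sum>b\<in>int_box N. \<Sum>b'\<in>int_box N. cnj (cis (- dotp b u)) * cis (- dotp b' u) * \<psi> (b' - b)) = S u"
        unfolding S_def by (intro sum.cong refl) (simp add: cis_cnj cis_mult dotp_diff)
      finally show ?thesis .
    qed
    have "(\<Sum>y\<in>{..<M} \<times> {..<M}. trig_eval xs (\<Theta> y) * S (\<Theta> y)) \<in> \<real>\<^sub>\<ge>\<^sub>0"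
      by (intro sum_nonneg_Reals nonneg_Reals_mult_I pos Spos)
    also have "(\<Sum>y\<in>{..<M} \<times> {..<M}. trig_eval xs (\<Theta> y) * S (\<Theta> y)) = (\<Sum>(c, a)\<leftarrow>xs. c * \<psi> a * of_nat (difference_count N a) * of_nat (M\<^sup>2))"
      using B
    proof (induction xs)
      case (Cons x xs)
      obtain c a where x: "x = (c, a)" by (cases x)
      have a: "\<bar>fst a\<bar> \<le> B" "\<bar>snd a\<bar> \<le> B" using Cons.prems[of c a] x by auto
      have "(\<Sum>y\<in>{..<M} \<times> {..<M}. c * cis (dotp a (\<Theta> y)) * S (\<Theta> y)) =
         (\<Sum>y\<in>{..<M} \<times> {..<M}. \<Sum>p\<in>int_box N \<times> int_box N. c * \<psi> (snd p - fst p) * cis (dotp (a - (snd p - fst p)) (\<Theta> y)))"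
        unfolding S_def sum.cartesian_product sum_distrib_left
        by (intro sum.cong refl) (simp add: cis_dotp_diff[of a] mult_ac case_prod_unfold)
      also have "\<dots> = (\<Sum>p\<in>int_box N \<times> int_box N. c * \<psi> (snd p - fst p) * (\<Sum>y\<in>{..<M} \<times> {..<M}. cis (dotp (a - (snd p - fst p)) (\<Theta> y))))"
        unfolding sum_distrib_left by (rule sum.swap)
      also have "\<dots> = (\<Sum>p\<in>int_box N \<times> int_box N. if snd p - fst p = a then c * \<psi> a * of_nat (M\<^sup>2) else 0)"
      proof (intro sum.cong refl)
        fix p assume p: "p \<in> int_box N \<times> int_box N"
        have "\<bar>fst (a - (snd p - fst p))\<bar> < int M" "\<bar>snd (a - (snd p - fst p))\<bar> < int M"
          using p a M by (auto simp: int_box_def)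
        from sum_grid[OF this]
        have "(\<Sum>y\<in>{..<M} \<times> {..<M}. cis (dotp (a - (snd p - fst p)) (\<Theta> y))) = (if a - (snd p - fst p) = 0 then of_nat (M\<^sup>2) else 0)"
          by (simp add: \<Theta>_def case_prod_unfold)
        then show "c * \<psi> (snd p - fst p) * (\<Sum>y\<in>{..<M} \<times> {..<M}. cis (dotp (a - (snd p - fst p)) (\<Theta> y))) =
           (if snd p - fst p = a then c * \<psi> a * of_nat (M\<^sup>2) else 0)"
          by auto
      qed
      also have "\<dots> = c * \<psi> a * of_nat (difference_count N a) * of_nat (M\<^sup>2)"
      proof -
        have "{p \<in> int_box N \<times> int_box N. snd p - fst p = a} = {(b, b') \<in> int_box N \<times> int_box N. b' - b = a}" by auto
        then show ?thesis by (subst sum.inter_filter[symmetric]) (auto simp: int_box_def difference_count_def)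
      qed
      finally have head: "(\<Sum>y\<in>{..<M} \<times> {..<M}. c * cis (dotp a (\<Theta> y)) * S (\<Theta> y)) =
        c * \<psi> a * of_nat (difference_count N a) * of_nat (M\<^sup>2)" .
      have tail: "(\<Sum>y\<in>{..<M} \<times> {..<M}. trig_eval xs (\<Theta> y) * S (\<Theta> y)) =
        (\<Sum>(c, a)\<leftarrow>xs. c * \<psi> a * of_nat (difference_count N a) * of_nat (M\<^sup>2))"
        by (rule Cons.IH) (meson Cons.prems list.set_intros(2))+
      show ?case
        by (simp only: x trig_eval_simps distrib_right sum.distrib head tail list.map sum_list.Cons prod.case)
    qed simp
    also have "\<dots> = (\<Sum>(c, a)\<leftarrow>xs. c * \<psi> a * of_nat (difference_count N a)) * of_nat (M\<^sup>2)"
      by (simp add: sum_list_mult_const[symmetric] case_prod_unfold)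
    finally have "(\<Sum>(c, a)\<leftarrow>xs. c * \<psi> a * of_nat (difference_count N a)) * of_nat (M\<^sup>2) * of_real (1 / real (M\<^sup>2)) \<in> \<real>\<^sub>\<ge>\<^sub>0"
      by (rule nonneg_Reals_mult_I) simp
    moreover have "M \<noteq> 0" by (simp add: M_def)
    ultimately show ?thesis by simp
  qed
  have lim1: "(\<lambda>N. of_nat (difference_count N a) / of_nat (N\<^sup>2)) \<longlonglongrightarrow> (1 :: complex)" for a
  proof -
    have "(\<lambda>N. (1 - \<bar>of_int (fst a)\<bar> * inverse (real N)) * (1 - \<bar>of_int (snd a)\<bar> * inverse (real N))) \<longlonglongrightarrow> (1 - \<bar>of_int (fst a)\<bar> * 0) * (1 - \<bar>of_int (snd a)\<bar> * 0)"
      by (intro tendsto_intros lim_inverse_n)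
    moreover have "\<forall>\<^sub>F N in sequentially. (1 - \<bar>of_int (fst a)\<bar> * inverse (real N)) * (1 - \<bar>of_int (snd a)\<bar> * inverse (real N)) = real (difference_count N a) / real (N\<^sup>2)"
      using eventually_ge_at_top[of "nat (1 + \<bar>fst a\<bar> + \<bar>snd a\<bar>)"]
    proof eventually_elim
      case (elim N)
      then have "\<bar>fst a\<bar> \<le> int N" "\<bar>snd a\<bar> \<le> int N" "N > 0" by linarith+
      then show ?case by (simp add: difference_count_eq field_simps power2_eq_square)
    qed
    ultimately have "(\<lambda>N. real (difference_count N a) / real (N\<^sup>2)) \<longlonglongrightarrow> 1"
      using Lim_transform_eventually by fastforce
    then have "(\<lambda>N. complex_of_real (real (difference_count N a) / real (N\<^sup>2))) \<longlonglongrightarrow> of_real 1" by (rule tendsto_of_real)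
    then show ?thesis by simp
  qed
  have lim: "(\<lambda>N. (\<Sum>(c, a)\<leftarrow>xs. c * \<psi> a * of_nat (difference_count N a)) * of_real (1 / real (N\<^sup>2))) \<longlonglongrightarrow> trig_functional \<psi> xs"
  proof (induction xs)
    case (Cons x xs)
    obtain c a where x: "x = (c, a)" by (cases x)
    have "(\<lambda>N. c * \<psi> a * (of_nat (difference_count N a) / of_nat (N\<^sup>2)) + (\<Sum>(c, a)\<leftarrow>xs. c * \<psi> a * of_nat (difference_count N a)) * of_real (1 / real (N\<^sup>2))) \<longlonglongrightarrow> c * \<psi> a * 1 + trig_functional \<psi> xs"
      by (intro tendsto_intros lim1 Cons.IH)
    then show ?case by (simp add: x add_divide_distrib)
  qed simp
  have "(\<Sum>(c, a)\<leftarrow>xs. c * \<psi> a * of_nat (difference_count N a)) * of_real (1 / real (N\<^sup>2)) \<in> \<real>\<^sub>\<ge>\<^sub>0" for N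
    by (intro nonneg_Reals_mult_I weighted) simp
  then show ?thesis
    by (intro Lim_in_closed_set[OF closed_nonneg_Reals_complex _ sequentially_bot lim] always_eventually allI)
qed

section \<open>Approximation by trigonometric polynomials on the torus\<close>

definition torus :: "(complex \<times> complex) set" where
  "torus = sphere 0 1 \<times> sphere 0 1"

definition torus_point :: "real \<times> real \<Rightarrow> complex \<times> complex" where
  "torus_point u = (cis (fst u), cis (snd u))"

lemma torus_point_torus: "torus_point u \<in> torus"
  by (simp add: torus_point_def torus_def)

definition trig_prod :: "trig \<Rightarrow> trig \<Rightarrow> trig" where
  "trig_prod xs ys = concat (map (\<lambda>(c, a). map (\<lambda>(d, b). (c * d, a + b)) ys) xs)"

lemma trig_eval_trig_prod: "trig_eval (trig_prod xs ys) u = trig_eval xs u * trig_eval ys u"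
proof -
  have *: "trig_eval (map (\<lambda>(d, b). (c * d, a + b)) ys) u = c * cis (dotp a u) * trig_eval ys u" for c a
    by (induction ys) (auto simp: dotp_add algebra_simps simp flip: cis_mult)
  have **: "trig_prod ((c, a) # xs) ys = map (\<lambda>(d, b). (c * d, a + b)) ys @ trig_prod xs ys" for c a xs
    by (simp add: trig_prod_def)
  show ?thesis
  proof (induction xs)
    case (Cons x xs)
    obtain c a where x: "x = (c, a)" by (cases x)
    show ?case unfolding x ** using Cons by (simp only: trig_eval_simps * distrib_right)
  qed (simp add: trig_prod_def)
qed

text \<open>Stone-Weierstrass for the real algebra of functions that have a trigonometric expansion:
  it contains the real and imaginary parts of both coordinates, which separate points.\<close>

lemma trig_approximation:
  assumes U: "continuous_on torus U" and e: "0 < (\<eta>::real)"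
  obtains xs where "\<And>u. trig_eval xs u \<in> \<real>" "\<And>u. \<bar>Re (trig_eval xs u) - U (torus_point u)\<bar> < \<eta>"
proof -
  define R :: "(complex \<times> complex \<Rightarrow> real) set" where
    "R = {f. continuous_on torus f \<and> (\<exists>xs. \<forall>u. trig_eval xs u = of_real (f (torus_point u)))}"
  have base: "(\<lambda>p. Re (fst p)) \<in> R" "(\<lambda>p. Im (fst p)) \<in> R" "(\<lambda>p. Re (snd p)) \<in> R" "(\<lambda>p. Im (snd p)) \<in> R"
  proof -
    \<comment> \<open>Euler's formulas for the cosine and the sine of each coordinate.\<close>
    have e: "trig_eval [(1/2, 1, 0), (1/2, -1, 0)] u = of_real (Re (fst (torus_point u)))"
      "trig_eval [(- \<i>/2, 1, 0), (\<i>/2, -1, 0)] u = of_real (Im (fst (torus_point u)))"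
      "trig_eval [(1/2, 0, 1), (1/2, 0, -1)] u = of_real (Re (snd (torus_point u)))"
      "trig_eval [(- \<i>/2, 0, 1), (\<i>/2, 0, -1)] u = of_real (Im (snd (torus_point u)))" for u
      by (simp_all add: torus_point_def dotp_def complex_eq_iff)
    show "(\<lambda>p. Re (fst p)) \<in> R" unfolding R_def
      by (intro CollectI conjI exI[of _ "[(1/2, 1, 0), (1/2, -1, 0)]"] allI e(1) continuous_intros)
    show "(\<lambda>p. Im (fst p)) \<in> R" unfolding R_def
      by (intro CollectI conjI exI[of _ "[(- \<i>/2, 1, 0), (\<i>/2, -1, 0)]"] allI e(2) continuous_intros)
    show "(\<lambda>p. Re (snd p)) \<in> R" unfolding R_def
      by (intro CollectI conjI exI[of _ "[(1/2, 0, 1), (1/2, 0, -1)]"] allI e(3) continuous_intros)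
    show "(\<lambda>p. Im (snd p)) \<in> R" unfolding R_def
      by (intro CollectI conjI exI[of _ "[(- \<i>/2, 0, 1), (\<i>/2, 0, -1)]"] allI e(4) continuous_intros)
  qed
  interpret function_ring_on R torus
  proof
    show "compact torus" unfolding torus_def by (intro compact_Times compact_sphere)
  next
    fix f assume "f \<in> R" then show "continuous_on torus f" by (simp add: R_def)
  next
    fix f g assume "f \<in> R" "g \<in> R"
    then obtain xs ys where *: "continuous_on torus f" "continuous_on torus g"
      "\<And>u. trig_eval xs u = of_real (f (torus_point u))" "\<And>u. trig_eval ys u = of_real (g (torus_point u))" unfolding R_def by auto
    have "trig_eval (xs @ ys) u = of_real (f (torus_point u) + g (torus_point u))" for u by (simp add: *)
    then show "(\<lambda>x. f x + g x) \<in> R" unfolding R_def using *(1,2) by (blast intro: continuous_intros)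
    have "trig_eval (trig_prod xs ys) u = of_real (f (torus_point u) * g (torus_point u))" for u by (simp add: * trig_eval_trig_prod)
    then show "(\<lambda>x. f x * g x) \<in> R" unfolding R_def using *(1,2) by (blast intro: continuous_intros)
  next
    fix c :: real
    have "trig_eval [(of_real c, 0)] u = of_real c" for u by simp
    then show "(\<lambda>_. c) \<in> R" unfolding R_def by (intro CollectI conjI exI allI continuous_on_const)
  next
    fix x y :: "complex \<times> complex" assume "x \<noteq> y"
    then have "Re (fst x) \<noteq> Re (fst y) \<or> Im (fst x) \<noteq> Im (fst y) \<or> Re (snd x) \<noteq> Re (snd y) \<or> Im (snd x) \<noteq> Im (snd y)"
      by (auto simp: prod_eq_iff complex_eq_iff)
    then show "\<exists>f\<in>R. f x \<noteq> f y" by (elim disjE) (erule bexI[OF _ base(1)] bexI[OF _ base(2)] bexI[OF _ base(3)] bexI[OF _ base(4)])+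
  qed
  obtain f where f: "f \<in> R" "\<And>x. x \<in> torus \<Longrightarrow> \<bar>U x - f x\<bar> < \<eta>"
    using Stone_Weierstrass_basic[OF U e] by (elim bexE) (rule that, auto)
  obtain xs where xs: "\<And>u. trig_eval xs u = of_real (f (torus_point u))" using f(1) unfolding R_def by blast
  show ?thesis
  proof (rule that[of xs])
    fix u
    show "trig_eval xs u \<in> \<real>" by (simp add: xs)
    show "\<bar>Re (trig_eval xs u) - U (torus_point u)\<bar> < \<eta>" using f(2)[OF torus_point_torus, of u] by (simp add: xs abs_minus_commute)
  qed
qed

section \<open>Bump functions on the torus\<close>

definition iact :: "Z2x2 \<Rightarrow> int \<times> int \<Rightarrow> int \<times> int" where
  "iact f a = (f$1$1 * fst a + f$1$2 * snd a, f$2$1 * fst a + f$2$2 * snd a)"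

text \<open>The action on characters is dual to the action on the integer lattice. This is why
  transposed matrices appear on the torus side.\<close>

lemma dotp_iact: "dotp (iact f a) u = dotp a (act (transpose f) u)"
  by (simp add: dotp_def iact_def act_def transpose_def algebra_simps)

definition precomp :: "Z2x2 \<Rightarrow> trig \<Rightarrow> trig" where
  "precomp f xs = map (\<lambda>(c, a). (c, iact f a)) xs"

lemma trig_eval_precomp [simp]: "trig_eval (precomp f xs) u = trig_eval xs (act (transpose f) u)"
  by (induction xs) (auto simp: precomp_def dotp_iact)

lemma trig_functional_precomp: "trig_functional \<psi> (precomp f xs) = trig_functional (\<lambda>a. \<psi> (iact f a)) xs"
  by (induction xs) (auto simp: precomp_def)

definition torus_args :: "complex \<times> complex \<Rightarrow> real \<times> real" where
  "torus_args p = (Arg (fst p), Arg (snd p))"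

lemma torus_point_args:
  assumes "p \<in> torus" shows "torus_point (torus_args p) = p"
proof -
  have "cis (Arg z) = z" if "norm z = 1" for z
    using that by (subst cis_Arg) (auto simp: sgn_div_norm)
  with assms show ?thesis by (cases p) (simp add: torus_def torus_point_def torus_args_def)
qed

lemma args_torus_point:
  assumes "\<bar>fst u\<bar> < pi" "\<bar>snd u\<bar> < pi" shows "torus_args (torus_point u) = u"
  using assms by (cases u) (auto simp: torus_args_def torus_point_def intro!: cis_Arg_unique)

text \<open>Matrix entries are integers, so the linear action descends to the torus.\<close>

lemma torus_point_act_cong:
  assumes "torus_point u = torus_point u'" shows "torus_point (act f u) = torus_point (act f u')"
proof -
  have "cis (of_int m * s + of_int n * t) = cis s powi m * cis t powi n" for m n s t
    by (simp add: cis_power_int cis_mult)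
  then show ?thesis using assms by (simp add: torus_point_def act_def)
qed

text \<open>On the torus it measures the distance to the trivial character, and as a trigonometric
  polynomial it involves only the frequency 0 and the four unit vectors.\<close>

definition energy :: "complex \<times> complex \<Rightarrow> real" where
  "energy p = 2 - Re (fst p) - Re (snd p)"

lemma energy_nonneg: "p \<in> torus \<Longrightarrow> 0 \<le> energy p"
  using complex_Re_le_cmod[of "fst p"] complex_Re_le_cmod[of "snd p"]
  by (auto simp: energy_def torus_def)

text \<open>For positive \<open>N\<close> it is 1 at the trivial character, while its integral is a
  mean of Fourier coefficients along one axis, hence small for large \<open>N\<close> if these tend
  to 0.\<close>

definition dirichlet :: "nat \<Rightarrow> complex \<times> complex \<Rightarrow> real" where
  "dirichlet N p = (norm ((\<Sum>k<N. fst p ^ k) / of_nat N))\<^sup>2"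

lemma dirichlet_bounds:
  assumes "p \<in> torus" shows "0 \<le> dirichlet N p" "dirichlet N p \<le> 1"
proof -
  have "norm (\<Sum>k<N. fst p ^ k) \<le> (\<Sum>k<N. norm (fst p ^ k))" by (rule norm_sum)
  also have "\<dots> = real N" using assms by (simp add: norm_power torus_def mem_Times_iff)
  finally have "norm ((\<Sum>k<N. fst p ^ k) / of_nat N) \<le> 1" by (cases "N = 0") (simp_all add: norm_divide divide_le_eq_1)
  then show "dirichlet N p \<le> 1" unfolding dirichlet_def by (simp add: power_le_one)
qed (simp add: dirichlet_def)

lemma dirichlet_one: "0 < N \<Longrightarrow> dirichlet N (1, 1) = 1"
  by (simp add: dirichlet_def)

text \<open>A cut-off depending on the direction only: for positive \<open>\<epsilon>\<close> it is
  0 off the cone with parameter \<open>\<epsilon>\<close>, 1 on the cone with parameter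
  \<open>2 * \<epsilon>\<close>, and continuous away from the origin.\<close>

definition ramp :: "Z2x2 \<Rightarrow> real \<Rightarrow> real \<times> real \<Rightarrow> real" where
  "ramp g \<epsilon> p = max 0 (min 1 ((\<bar>qform g p\<bar> - \<epsilon> * nsq p) / (\<epsilon> * nsq p)))"

lemma ramp_bounds: "0 \<le> ramp g \<epsilon> p" "ramp g \<epsilon> p \<le> 1"
  by (auto simp: ramp_def)

lemma ramp_outside_cone:
  assumes "0 < \<epsilon>" "p \<noteq> 0" "p \<notin> qcone g \<epsilon>" shows "ramp g \<epsilon> p = 0"
proof -
  have "(\<bar>qform g p\<bar> - \<epsilon> * nsq p) / (\<epsilon> * nsq p) \<le> 0"
    using assms nsq_pos[of p] by (intro divide_nonpos_pos) (auto simp: qcone_def)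
  then show ?thesis by (simp add: ramp_def)
qed

lemma ramp_eq_1:
  assumes "0 < \<epsilon>" "p \<noteq> 0" "2 * \<epsilon> * nsq p \<le> \<bar>qform g p\<bar>" shows "ramp g \<epsilon> p = 1"
proof -
  have "1 \<le> (\<bar>qform g p\<bar> - \<epsilon> * nsq p) / (\<epsilon> * nsq p)"
    using assms nsq_pos[of p] by (simp add: le_divide_eq)
  then show ?thesis by (simp add: ramp_def)
qed

text \<open>The weight \<open>1 - dirichlet N\<close> vanishes at the trivial character, which makes the bump continuous there.\<close>

definition bump :: "Z2x2 \<Rightarrow> real \<Rightarrow> real \<Rightarrow> nat \<Rightarrow> complex \<times> complex \<Rightarrow> real" where
  "bump g \<epsilon> C N p = max 0 (1 - C * energy p) * (1 - dirichlet N p) * ramp g \<epsilon> (torus_args p)"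

lemma bump_bounds:
  assumes "p \<in> torus" "0 < C" shows "0 \<le> bump g \<epsilon> C N p" "bump g \<epsilon> C N p \<le> ramp g \<epsilon> (torus_args p)" "bump g \<epsilon> C N p \<le> 1"
proof -
  have o: "0 \<le> max 0 (1 - C * energy p)" "max 0 (1 - C * energy p) \<le> 1"
    using energy_nonneg[OF assms(1)] assms(2) by auto
  have i: "0 \<le> 1 - dirichlet N p" "1 - dirichlet N p \<le> 1" using dirichlet_bounds[OF assms(1)] by auto
  have oi: "0 \<le> max 0 (1 - C * energy p) * (1 - dirichlet N p)" "max 0 (1 - C * energy p) * (1 - dirichlet N p) \<le> 1"
    using o i by (auto simp only: mult_nonneg_nonneg mult_le_one)
  show "0 \<le> bump g \<epsilon> C N p" unfolding bump_def using oi(1) ramp_bounds(1) by (rule mult_nonneg_nonneg)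
  show *: "bump g \<epsilon> C N p \<le> ramp g \<epsilon> (torus_args p)"
    unfolding bump_def using mult_right_mono[OF oi(2) ramp_bounds(1)] by simp
  show "bump g \<epsilon> C N p \<le> 1" using * ramp_bounds(2)[of g \<epsilon> "torus_args p"] by linarith
qed

text \<open>Continuity is in danger at two places. At the trivial character \<open>ramp\<close> has
  no limit in general, but \<open>1 - dirichlet N\<close> tends to 0 there. Where a coordinate is
  -1, \<open>Arg\<close> jumps, but the energy exceeds 1 and by \<open>1 \<le> C\<close> the cut-off
  vanishes nearby.\<close>

lemma continuous_on_bump:
  assumes C: "1 \<le> C" and N: "0 < N" and e: "0 < \<epsilon>"
  shows "continuous_on torus (bump g \<epsilon> C N)"
  unfolding continuous_on_def
proof (intro ballI)
  have "continuous_on UNIV energy" unfolding energy_def by (intro continuous_intros)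
  then have ec: "isCont energy p" for p using continuous_on_eq_continuous_at[OF open_UNIV] by blast
  have "continuous_on UNIV (dirichlet N)" unfolding dirichlet_def using N by (intro continuous_intros) auto
  then have dc: "isCont (dirichlet N) p" for p using continuous_on_eq_continuous_at[OF open_UNIV] by blast
  fix p assume p: "p \<in> torus"
  consider "p = (1, 1)" | "fst p = -1 \<or> snd p = -1" | "p \<noteq> (1, 1)" "fst p \<noteq> -1" "snd p \<noteq> -1" by blast
  then show "(bump g \<epsilon> C N \<longlongrightarrow> bump g \<epsilon> C N p) (at p within torus)"
  proof cases
    case 1
    have "((\<lambda>p. 1 - dirichlet N p) \<longlongrightarrow> 1 - dirichlet N p) (at p)"
      using dc[of p] by (intro tendsto_intros) (simp add: isCont_def)
    then have "((\<lambda>p. 1 - dirichlet N p) \<longlongrightarrow> 0) (at p within torus)"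
      using N by (auto simp: 1 dirichlet_one intro: tendsto_within_subset)
    moreover have "norm (bump g \<epsilon> C N q) \<le> (1 - dirichlet N q) * 1" if "q \<in> torus" for q
    proof -
      have d: "0 \<le> 1 - dirichlet N q" using dirichlet_bounds[OF that] by simp
      have "max 0 (1 - C * energy q) * ramp g \<epsilon> (torus_args q) \<le> 1"
        using energy_nonneg[OF that] C ramp_bounds[of g \<epsilon>] by (intro mult_le_one) auto
      then have "(1 - dirichlet N q) * (max 0 (1 - C * energy q) * ramp g \<epsilon> (torus_args q)) \<le> (1 - dirichlet N q) * 1"
        using d by (rule mult_left_mono)
      then show ?thesis using bump_bounds(1)[OF that, of C g \<epsilon> N] C by (simp add: bump_def mult_ac)
    qed
    ultimately have "(bump g \<epsilon> C N \<longlongrightarrow> 0) (at p within torus)"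
      by (intro Lim_null_comparison[of "bump g \<epsilon> C N" "\<lambda>q. 1 - dirichlet N q"])
         (auto simp: eventually_at_filter)
    then show ?thesis using N by (simp add: 1 bump_def dirichlet_one)
  next
    case 2
    have "1 < energy p" using 2 p complex_Re_le_cmod[of "fst p"] complex_Re_le_cmod[of "snd p"]
      by (auto simp: energy_def torus_def)
    then have "\<forall>\<^sub>F q in at p. 1 < energy q"
      using ec[of p] by (intro order_tendstoD) (simp_all add: isCont_def)
    moreover have zero: "bump g \<epsilon> C N q = 0" if "1 < energy q" for q
    proof -
      have "1 * 1 \<le> C * energy q" using C that by (intro mult_mono) auto
      then show ?thesis by (simp add: bump_def)
    qed
    ultimately have "\<forall>\<^sub>F q in at p. bump g \<epsilon> C N q = 0" by (auto elim: eventually_mono)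
    then have "(bump g \<epsilon> C N \<longlongrightarrow> 0) (at p)" by (rule tendsto_eventually)
    then show ?thesis using zero[OF \<open>1 < energy p\<close>] by (auto intro: tendsto_within_subset)
  next
    case 3
    have np: "z \<notin> \<real>\<^sub>\<le>\<^sub>0" if "norm z = 1" "z \<noteq> -1" for z :: complex
    proof
      assume "z \<in> \<real>\<^sub>\<le>\<^sub>0"
      then have "Re z \<le> 0" "Im z = 0" by (auto simp: complex_nonpos_Reals_iff)
      then have "z = - of_real (norm z)" by (simp add: complex_eq_iff cmod_eq_Re)
      with that show False by simp
    qed
    have "isCont (\<lambda>q. Arg (fst q)) p" "isCont (\<lambda>q. Arg (snd q)) p"
      using 3 p np by (auto intro!: isCont_o2[OF isCont_fst[OF continuous_ident] continuous_at_Arg]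
        isCont_o2[OF isCont_snd[OF continuous_ident] continuous_at_Arg] simp: torus_def mem_Times_iff)
    then have ac: "isCont torus_args p" unfolding torus_args_def by (rule isCont_Pair)
    have "torus_args p \<noteq> 0" using 3(1) torus_point_args[OF p] by (auto simp: torus_point_def)
    have "continuous_on (- {0}) (ramp g \<epsilon>)" unfolding ramp_def using e
      by (intro continuous_intros) (auto simp: nsq_eq_0_iff)
    then have "isCont (ramp g \<epsilon>) (torus_args p)"
      using \<open>torus_args p \<noteq> 0\<close> by (simp add: continuous_on_eq_continuous_at open_Compl)
    then have "isCont (\<lambda>q. ramp g \<epsilon> (torus_args q)) p" using ac by (rule isCont_o2[rotated])
    then have "isCont (bump g \<epsilon> C N) p" unfolding bump_def
      using ec[of p] dc[of p] by (intro continuous_intros)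
    then show ?thesis by (auto simp: isCont_def intro: tendsto_within_subset)
  qed
qed

lemma small_energy:
  assumes "0 < r"
  obtains C where "1 \<le> C" "\<And>u. \<bar>fst u\<bar> \<le> pi \<Longrightarrow> \<bar>snd u\<bar> \<le> pi \<Longrightarrow> C * energy (torus_point u) < 1 \<Longrightarrow> norm u < r"
proof -
  \<comment> \<open>The bound 1 keeps \<open>cos r'\<close> strictly between 0 and 1, so that
    \<open>1 / (1 - cos r')\<close> is at least 1. The factor 1/2 is there because the norm of
    \<open>u\<close> is estimated by the sum of its coordinates.\<close>
  define r' where "r' = min (r / 2) 1"
  have r': "0 < r'" "r' \<le> 1" "2 * r' \<le> r" using assms by (auto simp: r'_def)
  have pi: "3 < pi" by (rule pi_gt3)
  have c1: "cos r' < 1" using cos_monotone_0_pi[of 0 r'] r' pi by simp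
  have c0: "0 < cos r'" using r' pi by (intro cos_gt_zero) auto
  define C where "C = 1 / (1 - cos r')"
  show ?thesis
  proof (rule that[of C])
    show "1 \<le> C" using c1 c0 by (simp add: C_def)
    fix u assume t: "\<bar>fst u\<bar> \<le> pi" "\<bar>snd u\<bar> \<le> pi" "C * energy (torus_point u) < 1"
    have "energy (torus_point u) < 1 - cos r'" using t(3) c1 by (simp add: C_def divide_less_eq)
    then have "2 - cos (fst u) - cos (snd u) < 1 - cos r'" by (simp add: energy_def torus_point_def)
    then have "cos r' < cos (fst u)" "cos r' < cos (snd u)"
      using cos_le_one[of "fst u"] cos_le_one[of "snd u"] by linarith+
    then have "cos r' < cos \<bar>fst u\<bar>" "cos r' < cos \<bar>snd u\<bar>" by (simp_all only: cos_abs_real)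
    then have "\<bar>fst u\<bar> < r'" "\<bar>snd u\<bar> < r'"
      using cos_monotone_0_pi_le[of r' "\<bar>fst u\<bar>"] cos_monotone_0_pi_le[of r' "\<bar>snd u\<bar>"] t r' by linarith+
    then show "norm u < r" using norm_Pair_le[of "fst u" "snd u"] r' by simp
  qed
qed

lemma act_bounded:
  obtains K where "0 < K" "\<And>u. norm (act f u) \<le> K * norm u"
proof -
  have "linear (act f)" by (intro linearI) (auto simp: act_def algebra_simps)
  then have "bounded_linear (act f)" by (simp add: linear_conv_bounded_linear)
  then obtain K where "0 < K" "\<And>u. norm (act f u) \<le> norm u * K"
    using bounded_linear.pos_bounded by blast
  then show ?thesis using that by (simp add: mult.commute)
qed

text \<open>Within this radius two steps of the linear action stay inside the square on which
  \<open>torus_args\<close> inverts \<open>torus_point\<close>, so the action on the torus can be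
  computed in the plane.\<close>

lemma act_near:
  obtains r where "0 < r" "r \<le> 1" "\<And>u. norm u < r \<Longrightarrow> norm (act f u) < pi \<and> norm (act f (act f u)) < pi"
proof -
  obtain K where K: "0 < K" "\<And>u. norm (act f u) \<le> K * norm u" using act_bounded[of f] by metis
  define r where "r = 1 / (1 + K + K * K)"
  have den: "0 < 1 + K + K * K" using K(1) by (simp add: add_pos_pos)
  have r: "0 < r" "r \<le> 1" "K * r \<le> 1" "K * (K * r) \<le> 1"
    using K(1) den by (auto simp: r_def divide_le_eq_1)
  show ?thesis
  proof (rule that[OF r(1,2)])
    fix u :: "real \<times> real" assume "norm u < r"
    then have "K * norm u \<le> K * r" using K(1) by simp
    then have 1: "norm (act f u) \<le> K * r" using K(2)[of u] by linarith
    then have "K * norm (act f u) \<le> K * (K * r)" using K(1) by simp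
    then have 2: "norm (act f (act f u)) \<le> K * (K * r)" using K(2)[of "act f u"] by linarith
    show "norm (act f u) < pi \<and> norm (act f (act f u)) < pi" using 1 2 r pi_gt3 by linarith
  qed
qed

lemma args_torus_point_norm: "norm u < pi \<Longrightarrow> torus_args (torus_point u) = u"
  using norm_fst_le[of "fst u" "snd u"] norm_snd_le[of "snd u" "fst u"] by (intro args_torus_point) auto

text \<open>Near the trivial character the action is linear in the coordinates
  \<open>torus_args\<close>, and by \<open>escape\<close> at most one of three consecutive points
  lies in the cone, so at most one of the three bumps is nonzero.\<close>

lemma bump_orbit_sum:
  assumes f: "det f = 1" and e: "0 < \<epsilon>" and C: "1 \<le> C" and N: "0 < N" and r: "r \<le> 1"
    and escape: "\<And>p. p \<in> qcone g \<epsilon> \<Longrightarrow> act f p \<notin> qcone g \<epsilon> \<and> act f (act f p) \<notin> qcone g \<epsilon>"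
    and near: "\<And>u. norm u < r \<Longrightarrow> norm (act f u) < pi \<and> norm (act f (act f u)) < pi"
    and small: "\<And>u. \<bar>fst u\<bar> \<le> pi \<Longrightarrow> \<bar>snd u\<bar> \<le> pi \<Longrightarrow> C * energy (torus_point u) < 1 \<Longrightarrow> norm u < r"
  shows "bump g \<epsilon> C N (torus_point u) + bump g \<epsilon> C N (torus_point (act f u)) + bump g \<epsilon> C N (torus_point (act f (act f u)))
    \<le> 1 + 2 * C * energy (torus_point u)"
proof -
  define t where "t = torus_args (torus_point u)"
  have t: "torus_point t = torus_point u" unfolding t_def by (rule torus_point_args[OF torus_point_torus])
  have t1: "torus_point (act f t) = torus_point (act f u)" by (rule torus_point_act_cong[OF t])
  have t2: "torus_point (act f (act f t)) = torus_point (act f (act f u))" by (rule torus_point_act_cong[OF t1])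
  have C0: "0 < C" using C by simp
  have en: "0 \<le> C * energy (torus_point u)" using energy_nonneg[OF torus_point_torus] C0 by simp
  note bb = bump_bounds[OF torus_point_torus C0]
  show ?thesis
  proof (cases "C * energy (torus_point u) < 1")
    \<comment> \<open>Away from the trivial character the trivial bound 3 = 1 + 2 is enough, since
      the energy term is at least 2; this is the origin of its factor 2.\<close>
    case False
    then show ?thesis using bb(3)[of g \<epsilon> N u] bb(3)[of g \<epsilon> N "act f u"] bb(3)[of g \<epsilon> N "act f (act f u)"]
      by (simp add: mult.assoc)
  next
    case True
    have bd: "\<bar>fst t\<bar> \<le> pi" "\<bar>snd t\<bar> \<le> pi"
      using mpi_less_Arg[of "fst (torus_point u)"] Arg_le_pi[of "fst (torus_point u)"] mpi_less_Arg[of "snd (torus_point u)"] Arg_le_pi[of "snd (torus_point u)"]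
      by (auto simp: t_def torus_args_def)
    have nt: "norm t < r" using small[OF bd] True t by simp
    have "bump g \<epsilon> C N (torus_point t) + bump g \<epsilon> C N (torus_point (act f t)) + bump g \<epsilon> C N (torus_point (act f (act f t))) \<le> 1"
    proof (cases "t = 0")
      case True
      then show ?thesis using N by (simp add: act_def torus_point_def bump_def dirichlet_one zero_prod_def)
    next
      case False
      note nz = act_nonzero[OF f False] act_nonzero[OF f act_nonzero[OF f False]]
      have "norm t < pi" using nt r pi_gt3 by linarith
      then have a: "torus_args (torus_point t) = t" "torus_args (torus_point (act f t)) = act f t" "torus_args (torus_point (act f (act f t))) = act f (act f t)"
        using near[OF nt] by (auto intro: args_torus_point_norm)
      have b: "bump g \<epsilon> C N (torus_point t) \<le> ramp g \<epsilon> t" "bump g \<epsilon> C N (torus_point (act f t)) \<le> ramp g \<epsilon> (act f t)"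
        "bump g \<epsilon> C N (torus_point (act f (act f t))) \<le> ramp g \<epsilon> (act f (act f t))"
        using bb(2)[of g \<epsilon> N t] bb(2)[of g \<epsilon> N "act f t"] bb(2)[of g \<epsilon> N "act f (act f t)"] by (simp_all add: a)
      have "ramp g \<epsilon> t + ramp g \<epsilon> (act f t) + ramp g \<epsilon> (act f (act f t)) \<le> 1"
        using escape[of t] escape[of "act f t"] ramp_outside_cone[OF e False, of g] ramp_outside_cone[OF e nz(1), of g] ramp_outside_cone[OF e nz(2), of g]
          ramp_bounds(2)[of g \<epsilon> t] ramp_bounds(2)[of g \<epsilon> "act f t"] ramp_bounds(2)[of g \<epsilon> "act f (act f t)"]
        by (cases "t \<in> qcone g \<epsilon>"; cases "act f t \<in> qcone g \<epsilon>") auto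
      with b show ?thesis by linarith
    qed
    then show ?thesis using en by (simp add: t t1 t2)
  qed
qed

text \<open>By \<open>cov\<close> one of the two ramps equals 1. What is lost by the other factors
  is estimated by \<open>(1 - x) * (1 - y) \<ge> 1 - x - y\<close> for nonnegative \<open>x\<close>
  and \<open>y\<close>; at the trivial character the Dirichlet term alone is 1.\<close>

lemma bump_cover:
  assumes e: "0 < \<epsilon>" and C: "1 \<le> C" and N: "0 < N"
    and cov: "\<And>p. 4 * \<epsilon> * nsq p \<le> \<bar>qform g p\<bar> + \<bar>qform h p\<bar>"
  shows "1 \<le> bump g \<epsilon> C N (torus_point u) + bump h \<epsilon> C N (torus_point u) + C * energy (torus_point u) + dirichlet N (torus_point u)"
proof -
  have C0: "0 < C" using C by simp
  note bb = bump_bounds[OF torus_point_torus C0] and db = dirichlet_bounds[OF torus_point_torus, of N u]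
  have en: "0 \<le> C * energy (torus_point u)" using energy_nonneg[OF torus_point_torus] C0 by simp
  define t where "t = torus_args (torus_point u)"
  show ?thesis
  proof (cases "t = 0")
    case True
    then have "torus_point u = (1, 1)" using torus_point_args[OF torus_point_torus, of u] by (simp add: t_def torus_point_def)
    then show ?thesis using bb(1)[of g \<epsilon> N u] bb(1)[of h \<epsilon> N u] en dirichlet_one[OF N] by simp
  next
    case False
    have "2 * \<epsilon> * nsq t \<le> \<bar>qform g t\<bar> \<or> 2 * \<epsilon> * nsq t \<le> \<bar>qform h t\<bar>" using cov[of t] by linarith
    then have one: "1 \<le> ramp g \<epsilon> t + ramp h \<epsilon> t"
      using ramp_eq_1[OF e False] ramp_bounds(1)[of g \<epsilon> t] ramp_bounds(1)[of h \<epsilon> t] by fastforce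
    define oi where "oi = max 0 (1 - C * energy (torus_point u)) * (1 - dirichlet N (torus_point u))"
    have oi: "0 \<le> oi" using db by (simp add: oi_def)
    have "oi * 1 \<le> oi * (ramp g \<epsilon> t + ramp h \<epsilon> t)" using one oi by (rule mult_left_mono)
    then have "oi \<le> bump g \<epsilon> C N (torus_point u) + bump h \<epsilon> C N (torus_point u)"
      by (simp add: bump_def oi_def t_def distrib_left)
    moreover have "1 - C * energy (torus_point u) - dirichlet N (torus_point u) \<le> oi"
    proof (cases "C * energy (torus_point u) \<le> 1")
      case True
      have "0 \<le> C * energy (torus_point u) * dirichlet N (torus_point u)" using en db by simp
      moreover have "oi = 1 - C * energy (torus_point u) - dirichlet N (torus_point u) + C * energy (torus_point u) * dirichlet N (torus_point u)"
        using True by (simp add: oi_def algebra_simps)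
      ultimately show ?thesis by linarith
    qed (use oi db in linarith)
    ultimately show ?thesis by linarith
  qed
qed

text \<open>Exactly what \<open>almost_invariance\<close> consumes: both the polynomial and 2 minus
  it are nonnegative.\<close>

definition trig_between_0_2 :: "trig \<Rightarrow> bool" where
  "trig_between_0_2 xs \<longleftrightarrow> (\<forall>u. trig_eval xs u \<in> \<real> \<and> 0 \<le> Re (trig_eval xs u) \<and> Re (trig_eval xs u) \<le> 2)"

lemma bump_trig:
  assumes "1 \<le> C" "0 < N" "0 < \<epsilon>"
  obtains xs where "trig_between_0_2 xs" "\<And>u. bump g \<epsilon> C N (torus_point u) \<le> Re (trig_eval xs u)"
    "\<And>u. Re (trig_eval xs u) \<le> bump g \<epsilon> C N (torus_point u) + 1/50"
proof -
  obtain xs where xs: "\<And>u. trig_eval xs u \<in> \<real>" "\<And>u. \<bar>Re (trig_eval xs u) - bump g \<epsilon> C N (torus_point u)\<bar> < 1/100"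
    using trig_approximation[OF continuous_on_bump[OF assms], of "1/100" g] by (metis zero_less_divide_1_iff zero_less_numeral)
  have C: "0 < C" using assms by simp
  \<comment> \<open>Adding the approximation error 1/100 makes the approximation one-sided, at the
    price of an excess of at most 1/50.\<close>
  let ?ys = "(1/100, 0, 0) # xs"
  have re: "Re (trig_eval ?ys u) = Re (trig_eval xs u) + 1/100" for u by simp
  have le: "bump g \<epsilon> C N (torus_point u) \<le> Re (trig_eval ?ys u)" "Re (trig_eval ?ys u) \<le> bump g \<epsilon> C N (torus_point u) + 1/50" for u
    using xs(2)[of u] unfolding re abs_less_iff by linarith+
  show ?thesis
  proof (rule that[of ?ys])
    have "trig_eval ?ys u \<in> \<real>" for u using xs(1)[of u] by (auto simp: complex_is_Real_iff)
    moreover have "0 \<le> Re (trig_eval ?ys u)" "Re (trig_eval ?ys u) \<le> 2" for u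
      using le[of u] bump_bounds(1,3)[OF torus_point_torus C, of g \<epsilon> N u] by linarith+
    ultimately show "trig_between_0_2 ?ys" unfolding trig_between_0_2_def by blast
  qed (use le in auto)
qed

text \<open>The matrices and \<open>C\<close> are fixed before \<open>N\<close>: the tolerance for
  the positive definite function will depend on \<open>C\<close>, and \<open>N\<close> will depend
  on that function. The constant 53/50 is 1 plus three excesses of 1/50.\<close>

lemma separating_trig:
  assumes nc: "noncomm_pair g h"
  obtains f1 f2 C where "f1 \<in> range (\<lambda>n::nat. g [^]\<^bsub>SL2Z\<^esub> n)" "f2 \<in> range (\<lambda>n::nat. h [^]\<^bsub>SL2Z\<^esub> n)" "1 \<le> C"
    "\<And>N. 0 < N \<Longrightarrow> \<exists>xs ys. trig_between_0_2 xs \<and> trig_between_0_2 ys \<and>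
       (\<forall>u. Re (trig_eval xs u) + Re (trig_eval xs (act f1 u)) + Re (trig_eval xs (act f1 (act f1 u))) \<le> 53/50 + 2 * C * energy (torus_point u)) \<and>
       (\<forall>u. Re (trig_eval ys u) + Re (trig_eval ys (act f2 u)) + Re (trig_eval ys (act f2 (act f2 u))) \<le> 53/50 + 2 * C * energy (torus_point u)) \<and>
       (\<forall>u. 1 \<le> Re (trig_eval xs u) + Re (trig_eval ys u) + C * energy (torus_point u) + dirichlet N (torus_point u))"
proof -
  obtain \<delta> where \<delta>: "0 < \<delta>" "\<And>p. \<delta> * nsq p \<le> \<bar>qform g p\<bar> + \<bar>qform h p\<bar>"
    using noncomm_pair_bound[OF nc] by metis
  \<comment> \<open>One factor 2 because only the sum of the two forms is bounded below, another
    because the ramp reaches 1 only at \<open>2 * \<epsilon>\<close>.\<close>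
  define \<epsilon> where "\<epsilon> = \<delta> / 4"
  have e: "0 < \<epsilon>" using \<delta> by (simp add: \<epsilon>_def)
  have dt: "det g = 1" "det h = 1" "4 \<le> (tr g)\<^sup>2" "4 \<le> (tr h)\<^sup>2" using nc by (auto simp: noncomm_pair_def)
  obtain f1 where f1: "f1 \<in> range (\<lambda>n::nat. g [^]\<^bsub>SL2Z\<^esub> n)"
    "\<And>p. p \<in> qcone g \<epsilon> \<Longrightarrow> act f1 p \<notin> qcone g \<epsilon> \<and> act f1 (act f1 p) \<notin> qcone g \<epsilon>"
    using cone_escape[OF dt(1,3) e] by metis
  obtain f2 where f2: "f2 \<in> range (\<lambda>n::nat. h [^]\<^bsub>SL2Z\<^esub> n)"
    "\<And>p. p \<in> qcone h \<epsilon> \<Longrightarrow> act f2 p \<notin> qcone h \<epsilon> \<and> act f2 (act f2 p) \<notin> qcone h \<epsilon>"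
    using cone_escape[OF dt(2,4) e] by metis
  have dpow: "det (k [^]\<^bsub>SL2Z\<^esub> (n::nat)) = 1" if "det k = 1" for k n
    using that by (induction n) (auto simp: det_mul)
  have df: "det f1 = 1" "det f2 = 1" using f1(1) f2(1) dpow dt by auto
  obtain r1 where r1: "0 < r1" "r1 \<le> 1" "\<And>u. norm u < r1 \<Longrightarrow> norm (act f1 u) < pi \<and> norm (act f1 (act f1 u)) < pi"
    using act_near[of f1] by metis
  obtain r2 where r2: "0 < r2" "r2 \<le> 1" "\<And>u. norm u < r2 \<Longrightarrow> norm (act f2 u) < pi \<and> norm (act f2 (act f2 u)) < pi"
    using act_near[of f2] by metis
  define r where "r = min r1 r2"
  have r: "0 < r" "r \<le> 1" using r1 r2 by (auto simp: r_def)
  obtain C where C: "1 \<le> C" "\<And>u. \<bar>fst u\<bar> \<le> pi \<Longrightarrow> \<bar>snd u\<bar> \<le> pi \<Longrightarrow> C * energy (torus_point u) < 1 \<Longrightarrow> norm u < r"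
    using small_energy[OF r(1)] by metis
  show ?thesis
  proof (rule that[OF f1(1) f2(1) C(1)])
    fix N :: nat assume N: "0 < N"
    obtain xs where xs: "trig_between_0_2 xs" "\<And>u. bump g \<epsilon> C N (torus_point u) \<le> Re (trig_eval xs u)"
      "\<And>u. Re (trig_eval xs u) \<le> bump g \<epsilon> C N (torus_point u) + 1/50" using bump_trig[OF C(1) N e, of g] by metis
    obtain ys where ys: "trig_between_0_2 ys" "\<And>u. bump h \<epsilon> C N (torus_point u) \<le> Re (trig_eval ys u)"
      "\<And>u. Re (trig_eval ys u) \<le> bump h \<epsilon> C N (torus_point u) + 1/50" using bump_trig[OF C(1) N e, of h] by metis
    have 1: "Re (trig_eval xs u) + Re (trig_eval xs (act f1 u)) + Re (trig_eval xs (act f1 (act f1 u))) \<le> 53/50 + 2 * C * energy (torus_point u)" for u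
      using bump_orbit_sum[OF df(1) e C(1) N r(2) f1(2) r1(3) C(2), of u] xs(3)[of u] xs(3)[of "act f1 u"] xs(3)[of "act f1 (act f1 u)"]
      by (simp add: r_def)
    have 2: "Re (trig_eval ys u) + Re (trig_eval ys (act f2 u)) + Re (trig_eval ys (act f2 (act f2 u))) \<le> 53/50 + 2 * C * energy (torus_point u)" for u
      using bump_orbit_sum[OF df(2) e C(1) N r(2) f2(2) r2(3) C(2), of u] ys(3)[of u] ys(3)[of "act f2 u"] ys(3)[of "act f2 (act f2 u)"]
      by (simp add: r_def)
    have 3: "1 \<le> Re (trig_eval xs u) + Re (trig_eval ys u) + C * energy (torus_point u) + dirichlet N (torus_point u)" for u
    proof -
      have "4 * \<epsilon> * nsq p \<le> \<bar>qform g p\<bar> + \<bar>qform h p\<bar>" for p using \<delta>(2)[of p] by (simp add: \<epsilon>_def)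
      from bump_cover[OF e C(1) N this, of u] show ?thesis using xs(2)[of u] ys(2)[of u] by linarith
    qed
    show "\<exists>xs ys. trig_between_0_2 xs \<and> trig_between_0_2 ys \<and>
       (\<forall>u. Re (trig_eval xs u) + Re (trig_eval xs (act f1 u)) + Re (trig_eval xs (act f1 (act f1 u))) \<le> 53/50 + 2 * C * energy (torus_point u)) \<and>
       (\<forall>u. Re (trig_eval ys u) + Re (trig_eval ys (act f2 u)) + Re (trig_eval ys (act f2 (act f2 u))) \<le> 53/50 + 2 * C * energy (torus_point u)) \<and>
       (\<forall>u. 1 \<le> Re (trig_eval xs u) + Re (trig_eval ys u) + C * energy (torus_point u) + dirichlet N (torus_point u))"
      by (rule exI[of _ xs], rule exI[of _ ys], intro conjI allI xs(1) ys(1) 1 2 3)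
  qed
qed

section \<open>Relative property T\<close>

lemma trig_functional_add: "trig_functional (\<lambda>a. \<psi> a + \<rho> a) xs = trig_functional \<psi> xs + trig_functional \<rho> xs"
  by (induction xs) (auto simp: algebra_simps)

lemma trig_functional_cmult: "trig_functional (\<lambda>a. c * \<psi> a) xs = c * trig_functional \<psi> xs"
  by (induction xs) (auto simp: algebra_simps)

lemma trig_between_0_2D:
  assumes "trig_between_0_2 xs" shows "trig_eval xs u \<in> \<real>" "0 \<le> Re (trig_eval xs u)" "Re (trig_eval xs u) \<le> 2"
  using assms unfolding trig_between_0_2_def by blast+

lemma nonneg_Reals_of_Re: "z \<in> \<real> \<Longrightarrow> 0 \<le> Re z \<Longrightarrow> z \<in> \<real>\<^sub>\<ge>\<^sub>0"
  by (simp add: complex_nonneg_Reals_iff complex_is_Real_iff)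

lemma nonneg_Reals_Re: "z \<in> \<real>\<^sub>\<ge>\<^sub>0 \<Longrightarrow> 0 \<le> Re z"
  by (simp add: complex_nonneg_Reals_iff)

text \<open>Positivity is applied to the vectors \<open>\<alpha> \<xi> + \<beta> \<tau>\<^sup>-\<^sup>1 \<xi>\<close> of the GNS representation, expressed through \<open>\<phi>\<close> only.\<close>

lemma almost_invariance:
  fixes G (structure) and L :: "int \<times> int \<Rightarrow> 'a"
  assumes G: "group G" and pd: "positive_definite_on G \<phi>"
    and L: "\<And>a. L a \<in> carrier G" "\<And>a b. L (a + b) = L a \<otimes> L b"
    and t: "\<tau> \<in> carrier G" and xs: "trig_between_0_2 xs"
  shows "Re (trig_functional (\<lambda>a. \<phi> (L a)) xs) \<le>
     4/3 * Re (trig_functional (\<lambda>a. \<phi> (\<tau> \<otimes> L a \<otimes> inv \<tau>)) xs) + 8 * (2 * Re (\<phi> \<one>) - Re (\<phi> \<tau>) - Re (\<phi> (inv \<tau>)))"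
proof -
  interpret group G by fact
  have L0: "L 0 = \<one>" using L(2)[of 0 0] L(1)[of 0] by simp
  have Linv: "inv (L a) = L (- a)" for a
    by (rule inv_equality) (use L(1) L(2)[of "- a" a] L0 in auto)
  define \<psi> where "\<psi> \<alpha> \<beta> a = of_real (\<alpha> * \<alpha>) * \<phi> (L a) + (of_real (\<beta> * \<beta>) * \<phi> (\<tau> \<otimes> L a \<otimes> inv \<tau>) +
     of_real (\<alpha> * \<beta>) * (\<phi> (L a \<otimes> inv \<tau>) + \<phi> (\<tau> \<otimes> L a)))" for \<alpha> \<beta> :: real and a
  have psd: "psd F (\<lambda>a b. \<psi> \<alpha> \<beta> (b - a))" if F: "finite F" for F \<alpha> \<beta>
    unfolding psd_def
  proof
    fix w :: "int \<times> int \<Rightarrow> complex"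
    \<comment> \<open>The flag selects one of the two summands of the vector: the index set is
      doubled, and \<open>psd_image\<close> allows coincidences among the resulting group
      elements.\<close>
    define \<gamma> where "\<gamma> p = (if snd p then L (fst p) \<otimes> inv \<tau> else L (fst p))" for p
    define x where "x p = w (fst p) * of_real (if snd p then \<beta> else \<alpha>)" for p
    have "psd (\<gamma> ` (F \<times> UNIV)) (\<lambda>g h. \<phi> (inv g \<otimes> h))"
      using F L t by (intro pd[unfolded positive_definite_on_psd, rule_format] conjI) (auto simp: \<gamma>_def)
    then have "psd (F \<times> UNIV) (\<lambda>p q. \<phi> (inv (\<gamma> p) \<otimes> \<gamma> q))"
      by (rule psd_image) (use F in simp)
    then have "(\<Sum>p\<in>F \<times> UNIV. \<Sum>q\<in>F \<times> UNIV. cnj (x p) * x q * \<phi> (inv (\<gamma> p) \<otimes> \<gamma> q)) \<in> \<real>\<^sub>\<ge>\<^sub>0"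
      by (simp add: psd_def)
    also have "(\<Sum>p\<in>F \<times> UNIV. \<Sum>q\<in>F \<times> UNIV. cnj (x p) * x q * \<phi> (inv (\<gamma> p) \<otimes> \<gamma> q)) =
      (\<Sum>a\<in>F. \<Sum>k\<in>UNIV. \<Sum>b\<in>F. \<Sum>l\<in>UNIV. cnj (x (a, k)) * x (b, l) * \<phi> (inv (\<gamma> (a, k)) \<otimes> \<gamma> (b, l)))"
    proof -
      have "sum f (F \<times> UNIV) = (\<Sum>a\<in>F. \<Sum>k\<in>UNIV. f (a, k))" for f :: "(int \<times> int) \<times> bool \<Rightarrow> complex"
        by (simp add: sum.cartesian_product)
      then show ?thesis by (simp only:)
    qed
    also have "\<dots> = (\<Sum>a\<in>F. \<Sum>b\<in>F. \<Sum>k\<in>UNIV. \<Sum>l\<in>UNIV. cnj (x (a, k)) * x (b, l) * \<phi> (inv (\<gamma> (a, k)) \<otimes> \<gamma> (b, l)))"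
      by (intro sum.cong refl sum.swap)
    also have "\<dots> = (\<Sum>a\<in>F. \<Sum>b\<in>F. cnj (w a) * w b * \<psi> \<alpha> \<beta> (b - a))"
    proof (intro sum.cong refl)
      fix a b
      have Lba: "L (b - a) = inv (L a) \<otimes> L b" using L(2)[of "- a" b] by (simp add: Linv)
      have "inv (\<gamma> (a, False)) \<otimes> \<gamma> (b, False) = L (b - a)" "inv (\<gamma> (a, False)) \<otimes> \<gamma> (b, True) = L (b - a) \<otimes> inv \<tau>"
        "inv (\<gamma> (a, True)) \<otimes> \<gamma> (b, False) = \<tau> \<otimes> L (b - a)" "inv (\<gamma> (a, True)) \<otimes> \<gamma> (b, True) = \<tau> \<otimes> L (b - a) \<otimes> inv \<tau>"
        using L(1) t by (simp_all add: \<gamma>_def Lba inv_mult_group m_assoc)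
      then show "(\<Sum>k\<in>UNIV. \<Sum>l\<in>UNIV. cnj (x (a, k)) * x (b, l) * \<phi> (inv (\<gamma> (a, k)) \<otimes> \<gamma> (b, l))) = cnj (w a) * w b * \<psi> \<alpha> \<beta> (b - a)"
        by (simp add: UNIV_bool x_def \<psi>_def algebra_simps)
    qed
    finally show "(\<Sum>a\<in>F. \<Sum>b\<in>F. cnj (w a) * w b * \<psi> \<alpha> \<beta> (b - a)) \<in> \<real>\<^sub>\<ge>\<^sub>0" .
  qed
  define m where "m = Re (trig_functional (\<lambda>a. \<phi> (L a)) xs)"
  define mt where "mt = Re (trig_functional (\<lambda>a. \<phi> (\<tau> \<otimes> L a \<otimes> inv \<tau>)) xs)"
  define X where "X = Re (trig_functional (\<lambda>a. \<phi> (L a \<otimes> inv \<tau>) + \<phi> (\<tau> \<otimes> L a)) xs)"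
  have lin: "Re (trig_functional (\<psi> \<alpha> \<beta>) xs) = \<alpha> * \<alpha> * m + (\<beta> * \<beta> * mt + \<alpha> * \<beta> * X)" for \<alpha> \<beta>
    unfolding \<psi>_def trig_functional_add[of "\<lambda>a. of_real (\<alpha> * \<alpha>) * \<phi> (L a)"]
      trig_functional_add[of "\<lambda>a. of_real (\<beta> * \<beta>) * \<phi> (\<tau> \<otimes> L a \<otimes> inv \<tau>)"] trig_functional_cmult
    by (simp add: m_def mt_def X_def)
  have nonneg: "trig_eval xs u \<in> \<real>\<^sub>\<ge>\<^sub>0" for u
    using trig_between_0_2D[OF xs, of u] by (intro nonneg_Reals_of_Re)
  \<comment> \<open>The cross term \<open>X\<close> is estimated twice. The weights -1 and 4/3 give
    X \<le> 3/4 m + 4/3 mt. The weights 1 and -1, applied to 2 minus the polynomial, give m + mt - X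
    \<le> 2 D, where D is the bracket in the claim. Together m / 4 \<le> mt / 3 + 2 D, whence the
    constants 4/3 and 8.\<close>
  have "trig_functional (\<psi> (- 1) (4/3)) xs \<in> \<real>\<^sub>\<ge>\<^sub>0"
    by (rule trig_functional_nonneg) (rule psd, assumption, rule nonneg)
  then have a: "0 \<le> 1 * m + (16/9 * mt + - (4/3) * X)"
    using nonneg_Reals_Re lin[of "-1" "4/3"] by force
  let ?ys = "(2, 0) # scale (- 1) xs"
  have ys: "trig_eval ?ys u \<in> \<real>\<^sub>\<ge>\<^sub>0" for u
    using trig_between_0_2D[OF xs, of u] by (intro nonneg_Reals_of_Re) (simp_all add: complex_is_Real_iff)
  have "trig_functional (\<psi> 1 (- 1)) ?ys \<in> \<real>\<^sub>\<ge>\<^sub>0"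
    by (rule trig_functional_nonneg) (rule psd, assumption, rule ys)
  then have "0 \<le> Re (trig_functional (\<psi> 1 (- 1)) ?ys)" by (rule nonneg_Reals_Re)
  then have b: "0 \<le> 2 * Re (\<psi> 1 (- 1) 0) - (m + mt - X)"
    using lin[of 1 "- 1"] by simp
  have "Re (\<psi> 1 (- 1) 0) = 2 * Re (\<phi> \<one>) - Re (\<phi> \<tau>) - Re (\<phi> (inv \<tau>))"
    using t by (simp add: \<psi>_def L0)
  with a b show ?thesis unfolding m_def[symmetric] mt_def[symmetric] by simp
qed

section \<open>The energy and Dirichlet polynomials\<close>

definition energy_trig :: trig where
  "energy_trig = [(2, 0, 0), (-1/2, 1, 0), (-1/2, -1, 0), (-1/2, 0, 1), (-1/2, 0, -1)]"

lemma trig_eval_energy_trig: "trig_eval energy_trig u = of_real (energy (torus_point u))"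
  by (simp add: energy_trig_def energy_def torus_point_def dotp_def complex_eq_iff)

definition dirichlet_trig :: "nat \<Rightarrow> trig" where
  "dirichlet_trig N = concat (map (\<lambda>k. map (\<lambda>l. (1 / of_nat (N\<^sup>2), int l - int k, 0)) [0..<N]) [0..<N])"

lemma trig_functional_dirichlet:
  "trig_functional \<psi> (dirichlet_trig N) = (\<Sum>k<N. \<Sum>l<N. \<psi> (int l - int k, 0)) / of_nat (N\<^sup>2)"
proof -
  have "trig_functional \<psi> (dirichlet_trig N) = (\<Sum>k\<leftarrow>[0..<N]. \<Sum>l\<leftarrow>[0..<N]. 1 / of_nat (N\<^sup>2) * \<psi> (int l - int k, 0))"
  proof -
    have "trig_functional \<psi> (concat (map G ks)) = (\<Sum>k\<leftarrow>ks. trig_functional \<psi> (G k))" for G and ks :: "nat list"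
      by (induction ks) auto
    moreover have "trig_functional \<psi> (map (\<lambda>l. (c, f l)) ls) = (\<Sum>l\<leftarrow>ls. c * \<psi> (f l))" for c f and ls :: "nat list"
      by (induction ls) auto
    ultimately show ?thesis by (simp only: dirichlet_trig_def)
  qed
  also have "\<dots> = (\<Sum>k<N. \<Sum>l<N. 1 / of_nat (N\<^sup>2) * \<psi> (int l - int k, 0))"
    by (simp only: interv_sum_list_conv_sum_set_nat set_upt atLeast0LessThan)
  finally show ?thesis by (simp add: sum_divide_distrib)
qed

lemma trig_eval_eq_trig_functional: "trig_eval xs u = trig_functional (\<lambda>a. cis (dotp a u)) xs"
  by (simp add: trig_eval_def trig_functional_def)

lemma trig_eval_dirichlet_trig: "trig_eval (dirichlet_trig N) u = of_real (dirichlet N (torus_point u))"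
proof -
  define z where "z = (\<Sum>k<N. cis (fst u) ^ k)"
  have "z * cnj z = (\<Sum>l<N. \<Sum>k<N. cis (dotp (int l - int k, 0) u))"
    unfolding z_def cnj_sum sum_product
    by (intro sum.cong refl) (simp add: Complex.DeMoivre cis_cnj cis_mult dotp_def algebra_simps)
  also have "\<dots> = (\<Sum>k<N. \<Sum>l<N. cis (dotp (int l - int k, 0) u))" by (rule sum.swap)
  finally have "trig_eval (dirichlet_trig N) u = z * cnj z / of_nat (N\<^sup>2)"
    by (simp add: trig_eval_eq_trig_functional trig_functional_dirichlet)
  also have "\<dots> = of_real (dirichlet N (torus_point u))"
    using complex_norm_square[of z] by (simp add: dirichlet_def torus_point_def norm_divide power_divide flip: z_def)
  finally show ?thesis .
qed

text \<open>Wiener's averaging argument: coefficients outside the finite set \<open>B\<close> are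
  small, and those in \<open>B\<close> add at most \<open>S\<close> to each row, which is negligible
  after division by \<open>N\<close>. In spectral terms, the trivial character has no mass.\<close>

lemma dirichlet_functional_small:
  assumes c0: "\<And>\<epsilon>. 0 < \<epsilon> \<Longrightarrow> finite {a. \<epsilon> \<le> norm (\<psi> a)}" and e: "0 < (\<eta>::real)"
  obtains N where "0 < N" "norm (trig_functional \<psi> (dirichlet_trig N)) \<le> \<eta>"
proof -
  define B where "B = {a. \<eta> / 2 \<le> norm (\<psi> a)}"
  have B: "finite B" unfolding B_def using e by (intro c0) simp
  define S where "S = (\<Sum>a\<in>B. norm (\<psi> a))"
  have S: "0 \<le> S" unfolding S_def by (intro sum_nonneg) simp
  obtain N :: nat where N: "2 * S / \<eta> + 1 < real N" using reals_Archimedean2 by blast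
  have "0 \<le> 2 * S / \<eta>" using S e by simp
  then have N0: "0 < real N" using N by linarith
  have "2 * S / \<eta> \<le> real N" using N by linarith
  then have SN: "S \<le> real N * (\<eta> / 2)" using e by (simp add: field_simps)
  have row: "(\<Sum>l<N. norm (\<psi> (int l - int k, 0))) \<le> real N * \<eta>" for k
  proof -
    have "(\<Sum>l<N. norm (\<psi> (int l - int k, 0))) \<le> (\<Sum>l<N. \<eta> / 2 + (if (int l - int k, 0) \<in> B then norm (\<psi> (int l - int k, 0)) else 0))"
      using e by (intro sum_mono) (auto simp: B_def)
    also have "\<dots> = real N * (\<eta> / 2) + (\<Sum>l\<in>{l. l < N \<and> (int l - int k, 0) \<in> B}. norm (\<psi> (int l - int k, 0)))"
      by (simp add: sum.distrib sum.If_cases Int_def)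
    also have "(\<Sum>l\<in>{l. l < N \<and> (int l - int k, 0) \<in> B}. norm (\<psi> (int l - int k, 0))) =
       (\<Sum>a\<in>(\<lambda>l. (int l - int k, 0)) ` {l. l < N \<and> (int l - int k, 0) \<in> B}. norm (\<psi> a))"
      by (subst sum.reindex) (auto intro: inj_onI)
    also have "\<dots> \<le> S" unfolding S_def by (intro sum_mono2) (auto simp: B)
    finally show ?thesis using SN by simp
  qed
  have "norm (\<Sum>k<N. \<Sum>l<N. \<psi> (int l - int k, 0)) \<le> (\<Sum>k<N. norm (\<Sum>l<N. \<psi> (int l - int k, 0)))" by (rule norm_sum)
  also have "\<dots> \<le> (\<Sum>k<N. real N * \<eta>)" by (intro sum_mono order.trans[OF norm_sum row])
  also have "\<dots> = \<eta> * (real N)\<^sup>2" by (simp add: power2_eq_square)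
  finally have "norm (trig_functional \<psi> (dirichlet_trig N)) \<le> \<eta>"
    using N0 by (simp add: trig_functional_dirichlet norm_divide norm_power divide_le_eq)
  with N0 that show ?thesis by simp
qed

lemma noncomm_pair_transpose:
  assumes "noncomm_pair g h" shows "noncomm_pair (transpose g) (transpose h)"
proof -
  have "transpose g ** transpose h \<noteq> transpose h ** transpose g"
  proof
    assume "transpose g ** transpose h = transpose h ** transpose g"
    then have "transpose (h ** g) = transpose (g ** h)" by (simp add: matrix_transpose_mul)
    then have "h ** g = g ** h" by (metis transpose_transpose)
    with assms show False by (simp add: noncomm_pair_def)
  qed
  moreover have "tr (transpose k) = tr k" for k by (simp add: transpose_def)
  ultimately show ?thesis using assms by (simp add: noncomm_pair_def)
qed

lemma transpose_pow:
  assumes "det g = 1" shows "transpose (transpose g [^]\<^bsub>SL2Z\<^esub> (n::nat)) = g [^]\<^bsub>SL2Z\<^esub> n"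
proof (induction n)
  case (Suc n)
  interpret group SL2Z by (rule group_SL2Z)
  have "transpose (transpose g [^]\<^bsub>SL2Z\<^esub> Suc n) = g ** g [^]\<^bsub>SL2Z\<^esub> n"
    using Suc by (simp add: matrix_transpose_mul)
  also have "\<dots> = g [^]\<^bsub>SL2Z\<^esub> Suc n" using nat_pow_Suc2[of g n] assms by simp
  finally show ?case .
qed (simp add: transpose_mat)

lemma subgroup_snd_image:
  assumes "subgroup H Z2_SL2Z" shows "subgroup (snd ` H) SL2Z"
proof -
  interpret group_hom Z2_SL2Z SL2Z snd
    by (simp add: group_hom_def group_hom_axioms_def group_Z2_SL2Z group_SL2Z snd_hom)
  show ?thesis by (rule subgroup_img_is_subgroup[OF assms])
qed


text \<open>Rescaling by \<open>n\<close> identifies the given lattice of translations with the full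
  integer lattice, compatibly with the matrix action. The order of choices is essential: the
  matrices and \<open>C\<close> determine the tolerance, the tolerance determines \<open>k\<close>,
  c0 of \<open>\<phi> k\<close> determines \<open>N\<close>, and \<open>N\<close> determines the
  polynomials.\<close>

lemma relative_property_T:
  assumes H: "subgroup H Z2_SL2Z" and n: "n \<noteq> 0"
    and lattice: "\<And>i j. (vector [n * i, n * j], mat 1) \<in> H"
    and gh: "g \<in> snd ` H" "h \<in> snd ` H" and nc: "noncomm_pair g h"
  shows "\<not> haagerup (Z2_SL2Z\<lparr>carrier := H\<rparr>)"
proof
  define G where "G = Z2_SL2Z\<lparr>carrier := H\<rparr>"
  assume "haagerup (Z2_SL2Z\<lparr>carrier := H\<rparr>)"
  then obtain \<phi> where pd: "\<And>k::nat. positive_definite_on G (\<phi> k)" and c0: "\<And>k. c0_on G (\<phi> k)"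
    and lim: "\<And>x. x \<in> carrier G \<Longrightarrow> (\<lambda>k. \<phi> k x) \<longlonglongrightarrow> 1"
    unfolding haagerup_def G_def by auto
  interpret G: group G unfolding G_def by (rule subgroup_group[OF group_Z2_SL2Z H])
  have G_simps [simp]: "carrier G = H" "mult G (a, k) (b, l) = (a + k *v b, k ** l)" "one G = (0, mat 1)" for a k b l
    by (simp_all add: G_def)
  define L :: "int \<times> int \<Rightarrow> Z2 \<times> Z2x2" where "L a = (vector [n * fst a, n * snd a], mat 1)" for a
  have L: "L a \<in> carrier G" "L (a + b) = L a \<otimes>\<^bsub>G\<^esub> L b" for a b
    using lattice by (simp_all add: L_def vec_eq_iff forall_2 distrib_left)
  have Linj: "inj L" using n by (auto simp: inj_def L_def vec_eq_iff forall_2 prod_eq_iff)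
  have conj: "\<tau> \<otimes>\<^bsub>G\<^esub> L a \<otimes>\<^bsub>G\<^esub> inv\<^bsub>G\<^esub> \<tau> = L (iact (snd \<tau>) a)" if "\<tau> \<in> carrier G" for \<tau> a
  proof -
    have "\<tau> \<otimes>\<^bsub>G\<^esub> L a = L (iact (snd \<tau>) a) \<otimes>\<^bsub>G\<^esub> \<tau>"
      by (cases \<tau>) (simp add: L_def iact_def vec_eq_iff forall_2 mat_vec_entries algebra_simps)
    then show ?thesis using that L(1) by (simp add: G.m_assoc del: G_simps)
  qed
  have sub: "subgroup (snd ` H) SL2Z" by (rule subgroup_snd_image[OF H])
  have dt: "det g = 1" "det h = 1" using nc by (auto simp: noncomm_pair_def)
  obtain f1 f2 C where f1: "f1 \<in> range (\<lambda>n::nat. transpose g [^]\<^bsub>SL2Z\<^esub> n)" and f2: "f2 \<in> range (\<lambda>n::nat. transpose h [^]\<^bsub>SL2Z\<^esub> n)" and C: "1 \<le> C"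
    and sep: "\<And>N. 0 < N \<Longrightarrow> \<exists>xs ys. trig_between_0_2 xs \<and> trig_between_0_2 ys \<and>
       (\<forall>u. Re (trig_eval xs u) + Re (trig_eval xs (act f1 u)) + Re (trig_eval xs (act f1 (act f1 u))) \<le> 53/50 + 2 * C * energy (torus_point u)) \<and>
       (\<forall>u. Re (trig_eval ys u) + Re (trig_eval ys (act f2 u)) + Re (trig_eval ys (act f2 (act f2 u))) \<le> 53/50 + 2 * C * energy (torus_point u)) \<and>
       (\<forall>u. 1 \<le> Re (trig_eval xs u) + Re (trig_eval ys u) + C * energy (torus_point u) + dirichlet N (torus_point u))"
    by (rule separating_trig[OF noncomm_pair_transpose[OF nc]]) (rule that)
  have "transpose f1 \<in> snd ` H" "transpose f2 \<in> snd ` H"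
    using f1 f2 transpose_pow[OF dt(1)] transpose_pow[OF dt(2)] subgroup_pow_closed[OF sub gh(1)] subgroup_pow_closed[OF sub gh(2)] by auto
  then obtain \<tau>1 \<tau>2 where t: "\<tau>1 \<in> carrier G" "snd \<tau>1 = transpose f1" "\<tau>2 \<in> carrier G" "snd \<tau>2 = transpose f2" by force
  \<comment> \<open>The energy enters the estimates with the factor \<open>C\<close>, so the
    tolerance is divided by it.\<close>
  define \<eta> where "\<eta> = 1 / (1000 * C)"
  have \<eta>: "0 < \<eta>" "C * \<eta> = 1/1000" "\<eta> \<le> 1/1000" using C by (auto simp: \<eta>_def divide_simps)
  \<comment> \<open>The unit vectors control the energy. The squares occur because the third
    translate is compared with the first directly, and the inverses because
    \<open>almost_invariance\<close> involves them.\<close>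
  define T where "T = {\<one>\<^bsub>G\<^esub>, \<tau>1, inv\<^bsub>G\<^esub> \<tau>1, \<tau>1 \<otimes>\<^bsub>G\<^esub> \<tau>1, inv\<^bsub>G\<^esub> (\<tau>1 \<otimes>\<^bsub>G\<^esub> \<tau>1), \<tau>2, inv\<^bsub>G\<^esub> \<tau>2, \<tau>2 \<otimes>\<^bsub>G\<^esub> \<tau>2, inv\<^bsub>G\<^esub> (\<tau>2 \<otimes>\<^bsub>G\<^esub> \<tau>2), L (1, 0), L (-1, 0), L (0, 1), L (0, -1)}"
  have "\<forall>\<^sub>F k in sequentially. \<forall>x\<in>T. dist (\<phi> k x) 1 < \<eta>"
  proof (rule eventually_ball_finite)
    show "finite T" by (simp add: T_def)
    show "\<forall>x\<in>T. \<forall>\<^sub>F k in sequentially. dist (\<phi> k x) 1 < \<eta>"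
    proof
      fix x assume "x \<in> T"
      then have "x \<in> carrier G" using t L unfolding T_def by (auto simp del: G_simps)
      then show "\<forall>\<^sub>F k in sequentially. dist (\<phi> k x) 1 < \<eta>" using lim \<eta>(1) by (intro tendstoD)
    qed
  qed
  then obtain k where k: "\<And>x. x \<in> T \<Longrightarrow> dist (\<phi> k x) 1 < \<eta>"
    using eventually_happens'[OF sequentially_bot] by blast
  have re: "\<bar>Re (\<phi> k x) - 1\<bar> < \<eta>" if "x \<in> T" for x
    using k[OF that] abs_Re_le_cmod[of "\<phi> k x - 1"] by (simp add: dist_norm)
  define \<psi> where "\<psi> a = \<phi> k (L a)" for a
  have psd: "psd F (\<lambda>a b. \<psi> (b - a))" if "finite F" for F
  proof -
    have "psd (L ` F) (\<lambda>x y. \<phi> k (inv\<^bsub>G\<^esub> x \<otimes>\<^bsub>G\<^esub> y))"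
      using that L(1) by (intro pd[unfolded positive_definite_on_psd, rule_format] conjI) (auto simp del: G_simps)
    then have "psd F (\<lambda>a b. \<phi> k (inv\<^bsub>G\<^esub> (L a) \<otimes>\<^bsub>G\<^esub> L b))" using that by (rule psd_image)
    moreover have "inv\<^bsub>G\<^esub> (L a) \<otimes>\<^bsub>G\<^esub> L b = L (b - a)" for a b
      using L(2)[of a "b - a"] L(1) by (simp add: G.m_assoc[symmetric] del: G_simps)
    ultimately show ?thesis by (simp add: \<psi>_def)
  qed
  have positive: "0 \<le> Re (trig_functional \<psi> zs)" if "\<And>u. trig_eval zs u \<in> \<real>" "\<And>u. 0 \<le> Re (trig_eval zs u)" for zs
  proof -
    have trig_eval: "trig_eval zs u \<in> \<real>\<^sub>\<ge>\<^sub>0" for u by (rule nonneg_Reals_of_Re[OF that])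
    have "trig_functional \<psi> zs \<in> \<real>\<^sub>\<ge>\<^sub>0"
      by (rule trig_functional_nonneg) (rule psd, assumption, rule trig_eval)
    then show ?thesis by (rule nonneg_Reals_Re)
  qed
  have c0\<psi>: "finite {a. \<epsilon> \<le> norm (\<psi> a)}" if "0 < \<epsilon>" for \<epsilon>
  proof -
    have "finite {x \<in> carrier G. \<epsilon> \<le> norm (\<phi> k x)}" using c0[of k] that by (simp add: c0_on_def del: G_simps)
    then have "finite (L -` {x \<in> carrier G. \<epsilon> \<le> norm (\<phi> k x)})" using Linj by (rule finite_vimageI)
    then show ?thesis using L(1) by (simp add: \<psi>_def del: G_simps)
  qed
  obtain N where N: "0 < N" "norm (trig_functional \<psi> (dirichlet_trig N)) \<le> \<eta>"
    by (rule dirichlet_functional_small[of \<psi> \<eta>]) (rule c0\<psi>, assumption, rule \<eta>(1), rule that)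
  obtain xs ys where xy: "trig_between_0_2 xs" "trig_between_0_2 ys"
    "\<And>u. Re (trig_eval xs u) + Re (trig_eval xs (act f1 u)) + Re (trig_eval xs (act f1 (act f1 u))) \<le> 53/50 + 2 * C * energy (torus_point u)"
    "\<And>u. Re (trig_eval ys u) + Re (trig_eval ys (act f2 u)) + Re (trig_eval ys (act f2 (act f2 u))) \<le> 53/50 + 2 * C * energy (torus_point u)"
    "\<And>u. 1 \<le> Re (trig_eval xs u) + Re (trig_eval ys u) + C * energy (torus_point u) + dirichlet N (torus_point u)"
    using sep[OF N(1)] by (elim exE conjE) (rule that, assumption, assumption, (erule spec)+)
  define m where "m zs = Re (trig_functional \<psi> zs)" for zs
  define v where "v = Re (\<phi> k \<one>\<^bsub>G\<^esub>)"
  have L0: "L (0, 0) = \<one>\<^bsub>G\<^esub>" by (simp add: L_def vec_eq_iff forall_2)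
  have v: "1 - \<eta> \<le> v" "v \<le> 1 + \<eta>" using re[of "\<one>\<^bsub>G\<^esub>"] by (auto simp: v_def T_def)
  have mE: "m energy_trig \<le> 4 * \<eta>"
    using re[of "L (1, 0)"] re[of "L (-1, 0)"] re[of "L (0, 1)"] re[of "L (0, -1)"] v
    by (simp add: m_def energy_trig_def \<psi>_def L0 v_def T_def)
  have mD: "m (dirichlet_trig N) \<le> \<eta>"
    using N(2) complex_Re_le_cmod[of "trig_functional \<psi> (dirichlet_trig N)"] by (simp add: m_def)
  have cover: "v \<le> m xs + m ys + C * m energy_trig + m (dirichlet_trig N)"
  proof -
    let ?zs = "(-1, 0, 0) # (xs @ ys @ scale C energy_trig @ dirichlet_trig N)"
    have "trig_eval ?zs u \<in> \<real>" "0 \<le> Re (trig_eval ?zs u)" for u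
      using trig_between_0_2D[OF xy(1), of u] trig_between_0_2D[OF xy(2), of u] xy(5)[of u]
      by (simp_all add: trig_eval_energy_trig trig_eval_dirichlet_trig complex_is_Real_iff)
    then have "0 \<le> Re (trig_functional \<psi> ?zs)" by (rule positive)
    then show ?thesis by (simp add: m_def \<psi>_def L0 v_def)
  qed
  \<comment> \<open>Each of the two translated polynomials keeps at least 3/4 of \<open>m zs\<close>
    up to \<open>24 * \<eta>\<close>, by \<open>almost_invariance\<close> with its error term
    bounded by \<open>32 * \<eta>\<close>. Hence 5/2 = 1 + 3/4 + 3/4 and 48 = 24 + 24.\<close>
  have orbit: "5/2 * m zs \<le> 53/50 * v + 2 * C * m energy_trig + 48 * \<eta>"
    if zs: "trig_between_0_2 zs" and tau: "\<tau> \<in> carrier G" "snd \<tau> = transpose f"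
      and T: "\<tau> \<in> T" "inv\<^bsub>G\<^esub> \<tau> \<in> T" "\<tau> \<otimes>\<^bsub>G\<^esub> \<tau> \<in> T" "inv\<^bsub>G\<^esub> (\<tau> \<otimes>\<^bsub>G\<^esub> \<tau>) \<in> T"
      and le: "\<And>u. Re (trig_eval zs u) + Re (trig_eval zs (act f u)) + Re (trig_eval zs (act f (act f u))) \<le> 53/50 + 2 * C * energy (torus_point u)"
    for zs \<tau> f
  proof -
    define F where "F = transpose f"
    let ?zs = "(53/50, 0, 0) # (scale (2 * C) energy_trig @ scale (-1) (zs @ precomp F zs @ precomp F (precomp F zs)))"
    have "trig_eval ?zs u \<in> \<real>" "0 \<le> Re (trig_eval ?zs u)" for u
      using trig_between_0_2D[OF zs, of u] trig_between_0_2D[OF zs, of "act f u"] trig_between_0_2D[OF zs, of "act f (act f u)"] le[of u]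
      by (simp_all add: trig_eval_energy_trig complex_is_Real_iff F_def transpose_transpose)
    then have "0 \<le> Re (trig_functional \<psi> ?zs)" by (rule positive)
    then have "m zs + m (precomp F zs) + m (precomp F (precomp F zs)) \<le> 53/50 * v + 2 * C * m energy_trig"
      by (simp add: m_def \<psi>_def L0 v_def)
    moreover have "m zs \<le> 4/3 * m (precomp F zs) + 32 * \<eta>"
      using almost_invariance[OF G.group_axioms pd L tau(1) zs, of k] re[OF T(1)] re[OF T(2)] v conj[OF tau(1)]
      by (simp add: m_def \<psi>_def[abs_def] trig_functional_precomp v_def F_def tau(2) del: G_simps)
    moreover have "m zs \<le> 4/3 * m (precomp F (precomp F zs)) + 32 * \<eta>"
    proof -
      have tt: "\<tau> \<otimes>\<^bsub>G\<^esub> \<tau> \<in> carrier G" using tau(1) by (rule G.m_closed[OF _ tau(1)])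
      have "snd (\<tau> \<otimes>\<^bsub>G\<^esub> \<tau>) = F ** F" using tau(2) by (cases \<tau>) (simp add: F_def)
      then have "\<tau> \<otimes>\<^bsub>G\<^esub> \<tau> \<otimes>\<^bsub>G\<^esub> L a \<otimes>\<^bsub>G\<^esub> inv\<^bsub>G\<^esub> (\<tau> \<otimes>\<^bsub>G\<^esub> \<tau>) = L (iact F (iact F a))" for a
        using conj[OF tt, of a] by (simp add: iact_def mat_mult_entries algebra_simps del: G_simps)
      then show ?thesis
        using almost_invariance[OF G.group_axioms pd L tt zs, of k] re[OF T(3)] re[OF T(4)] v
        by (simp add: m_def \<psi>_def[abs_def] trig_functional_precomp v_def del: G_simps)
    qed
    ultimately show ?thesis by linarith
  qed
  have "5/2 * m xs \<le> 53/50 * v + 2 * C * m energy_trig + 48 * \<eta>"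
    by (rule orbit[OF xy(1) t(1,2) _ _ _ _ xy(3)]) (simp_all add: T_def)
  moreover have "5/2 * m ys \<le> 53/50 * v + 2 * C * m energy_trig + 48 * \<eta>"
    by (rule orbit[OF xy(2) t(3,4) _ _ _ _ xy(4)]) (simp_all add: T_def)
  moreover have "C * m energy_trig \<le> 4 / 1000"
  proof -
    have "C * m energy_trig \<le> C * (4 * \<eta>)" using mE C by (intro mult_left_mono) auto
    also have "\<dots> = 4 * (C * \<eta>)" by simp
    finally show ?thesis using \<eta>(2) by simp
  qed
  \<comment> \<open>Numerically \<open>m xs\<close> and \<open>m ys\<close> are below 0.45 each,
    while \<open>cover\<close> requires their sum to exceed 0.99.\<close>
  ultimately show False using cover mD v \<eta> by (simp add: mult.assoc)
qed

section \<open>Maximal Haagerup subgroups\<close>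

lemma lattice_closed:
  assumes H: "subgroup H Z2_SL2Z"
  shows "(0, mat 1) \<in> H" "\<And>a b. (a, mat 1) \<in> H \<Longrightarrow> (b, mat 1) \<in> H \<Longrightarrow> (a + b, mat 1) \<in> H"
    "\<And>a. (a, mat 1) \<in> H \<Longrightarrow> (x *s a, mat 1) \<in> H"
proof -
  interpret group Z2_SL2Z by (rule group_Z2_SL2Z)
  show zero: "(0, mat 1) \<in> H" using subgroup.one_closed[OF H] by simp
  show add: "(a + b, mat 1) \<in> H" if "(a, mat 1) \<in> H" "(b, mat 1) \<in> H" for a b
    using subgroup.m_closed[OF H that] by simp
  have neg: "(- a, mat 1) \<in> H" if "(a, mat 1) \<in> H" for a
  proof -
    have "inv\<^bsub>Z2_SL2Z\<^esub> (a, mat 1) = (- a, mat 1)" by (rule inv_equality) simp_all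
    then show ?thesis using subgroup.m_inv_closed[OF H that] by simp
  qed
  show "(x *s a, mat 1) \<in> H" if a: "(a, mat 1) \<in> H" for a
  proof -
    have nat: "(of_nat n *s a, mat 1) \<in> H" for n
    proof (induction n)
      case (Suc n)
      have "(of_nat (Suc n) :: int) *s a = of_nat n *s a + a" by (simp add: vec_eq_iff algebra_simps)
      then show ?case using add[OF Suc a] by (simp only:)
    qed (use zero in simp)
    show ?thesis
    proof (cases "0 \<le> x")
      case True
      then show ?thesis using nat[of "nat x"] by simp
    next
      case False
      then have "x *s a = - (of_nat (nat (- x)) *s a)" by (simp add: vec_eq_iff)
      then show ?thesis using neg[OF nat] by (simp only:)
    qed
  qed
qed

lemma lattice_act:
  assumes H: "subgroup H Z2_SL2Z" and a: "(a, mat 1) \<in> H" and k: "(b, k) \<in> H"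
  shows "(k *v a, mat 1) \<in> H"
proof -
  interpret group Z2_SL2Z by (rule group_Z2_SL2Z)
  have c: "(a, mat 1) \<in> carrier Z2_SL2Z" "(b, k) \<in> carrier Z2_SL2Z" "(k *v a, mat 1) \<in> carrier Z2_SL2Z"
    using a k subgroup.subset[OF H] by auto
  have "(b, k) \<otimes>\<^bsub>Z2_SL2Z\<^esub> (a, mat 1) = (k *v a, mat 1) \<otimes>\<^bsub>Z2_SL2Z\<^esub> (b, k)" by (simp add: add.commute)
  then have "(k *v a, mat 1) = (b, k) \<otimes>\<^bsub>Z2_SL2Z\<^esub> (a, mat 1) \<otimes>\<^bsub>Z2_SL2Z\<^esub> inv\<^bsub>Z2_SL2Z\<^esub> (b, k)"
    using c by (simp add: m_assoc del: Z2_SL2Z_simps)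
  also have "\<dots> \<in> H" by (intro subgroup.m_closed[OF H] subgroup.m_inv_closed[OF H] a k)
  finally show ?thesis .
qed

text \<open>One matrix of a non-commuting pair moves the direction of \<open>a\<close>. Then
  \<open>a\<close> and its image span a lattice of finite index, to which
  \<open>relative_property_T\<close> applies.\<close>

lemma haagerup_with_translation:
  assumes H: "subgroup H Z2_SL2Z" and hH: "haagerup (Z2_SL2Z\<lparr>carrier := H\<rparr>)"
    and a: "(a, mat 1) \<in> H" "a \<noteq> 0"
  shows "pairwise_elementary (snd ` H)"
  unfolding pairwise_elementary_def
proof (intro ballI notI)
  fix g h assume gh: "g \<in> snd ` H" "h \<in> snd ` H" and nc: "noncomm_pair g h"
  define p where "p = (real_of_int (a$1), real_of_int (a$2))"
  have "p \<noteq> 0" using a(2) by (auto simp: p_def zero_prod_def vec_eq_iff forall_2)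
  then obtain k where k: "k \<in> snd ` H" "qform k p \<noteq> 0" using no_common_zero[OF nc] gh by blast
  obtain b where bk: "(b, k) \<in> H" using k(1) by force
  define a' where "a' = k *v a"
  have a': "(a', mat 1) \<in> H" unfolding a'_def by (rule lattice_act[OF H a(1) bk])
  define D where "D = a$1 * a'$2 - a$2 * a'$1"
  have "qform k p = of_int D"
    by (simp add: qform_def act_def p_def D_def a'_def mat_vec_entries)
  then have D: "D \<noteq> 0" using k(2) by auto
  have "(vector [D * i, D * j], mat 1) \<in> H" for i j
  proof -
    \<comment> \<open>Cramer's rule for the basis \<open>a\<close>, \<open>a'\<close> of determinant
      \<open>D\<close>.\<close>
    have "vector [D * i, D * j] = (i * a'$2 - j * a'$1) *s a + (j * a$1 - i * a$2) *s a'"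
      by (simp add: vec_eq_iff forall_2 D_def algebra_simps)
    then show ?thesis using lattice_closed(2)[OF H lattice_closed(3)[OF H a(1)] lattice_closed(3)[OF H a']] by (simp only:)
  qed
  then show False using relative_property_T[OF H D _ gh nc] hH by blast
qed

lemma amenable_iff_pairwise_elementary:
  assumes "subgroup S SL2Z"
  shows "amenable (SL2Z\<lparr>carrier := S\<rparr>) \<longleftrightarrow> pairwise_elementary S"
  using amenable_pairwise_elementary[OF assms] pairwise_elementary_folner[OF assms]
    folner_amenable[OF subgroup_group[OF group_SL2Z assms]] by blast

lemma haagerup_Times:
  assumes S: "subgroup S SL2Z" and "pairwise_elementary S"
  shows "haagerup (Z2_SL2Z\<lparr>carrier := UNIV \<times> S\<rparr>)"
  by (intro folner_haagerup subgroup_group[OF group_Z2_SL2Z subgroup_Times[OF S]]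
      folner_Times[OF S] pairwise_elementary_folner assms)

lemma haagerup_inj_snd:
  assumes H: "subgroup H Z2_SL2Z" and inj: "inj_on snd H"
  shows "haagerup (Z2_SL2Z\<lparr>carrier := H\<rparr>)"
proof (rule haagerup_pullback[OF subgroup_group[OF group_Z2_SL2Z H] group_SL2Z _ _ haagerup_SL2Z])
  show "snd \<in> hom (Z2_SL2Z\<lparr>carrier := H\<rparr>) SL2Z"
    using subgroup.subset[OF H] by (auto simp: hom_def)
qed (use inj in simp)

section \<open>Graphs of cocycles\<close>

lemma cocycle_one:
  assumes "cocycle S c" "mat 1 \<in> S" shows "c (mat 1) = 0"
proof -
  have "c (mat 1 ** mat 1) = mat 1 *v c (mat 1) + c (mat 1)" using assms unfolding cocycle_def by blast
  then show ?thesis by simp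
qed

lemma subgroup_cocycle_graph:
  assumes S: "subgroup S SL2Z" and c: "cocycle S c"
  shows "subgroup (cocycle_graph S c) Z2_SL2Z"
proof -
  interpret group Z2_SL2Z by (rule group_Z2_SL2Z)
  interpret SL: group SL2Z by (rule group_SL2Z)
  note SD = subgroup_SL2Z_D[OF S]
  have cm: "c (g ** h) = g *v c h + c g" if "g \<in> S" "h \<in> S" for g h
    using c that by (simp add: cocycle_def)
  show ?thesis
  proof (rule subgroupI)
    show "cocycle_graph S c \<subseteq> carrier Z2_SL2Z" using SD by (auto simp: cocycle_graph_def)
    show "cocycle_graph S c \<noteq> {}" using SD by (auto simp: cocycle_graph_def)
  next
    fix x assume "x \<in> cocycle_graph S c"
    then obtain g where g: "x = (c g, g)" "g \<in> S" by (auto simp: cocycle_graph_def)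
    define k where "k = inv\<^bsub>SL2Z\<^esub> g"
    have k: "k \<in> S" "k ** g = mat 1" using SD g SL.l_inv[of g] by (auto simp: k_def)
    have "k *v c g + c k = 0" using cm[OF k(1) g(2)] k(2) cocycle_one[OF c SD(3)] by simp
    then have "(c k, k) \<otimes>\<^bsub>Z2_SL2Z\<^esub> x = \<one>\<^bsub>Z2_SL2Z\<^esub>" using k by (simp add: g add.commute)
    then have "inv\<^bsub>Z2_SL2Z\<^esub> x = (c k, k)"
      by (rule inv_equality) (use g k SD in auto)
    then show "inv\<^bsub>Z2_SL2Z\<^esub> x \<in> cocycle_graph S c" using k by (auto simp: cocycle_graph_def)
  next
    fix x y assume "x \<in> cocycle_graph S c" "y \<in> cocycle_graph S c"
    then obtain g h where "x = (c g, g)" "g \<in> S" "y = (c h, h)" "h \<in> S" by (auto simp: cocycle_graph_def)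
    then show "x \<otimes>\<^bsub>Z2_SL2Z\<^esub> y \<in> cocycle_graph S c"
      using SD cm by (auto simp: cocycle_graph_def add.commute)
  qed
qed

lemma haagerup_cocycle_graph:
  assumes "subgroup S SL2Z" "cocycle S c"
  shows "haagerup (Z2_SL2Z\<lparr>carrier := cocycle_graph S c\<rparr>)"
  by (rule haagerup_inj_snd[OF subgroup_cocycle_graph[OF assms]]) (auto simp: cocycle_graph_def inj_on_def)

text \<open>Two elements of \<open>H\<close> over the same matrix differ by a translation in
  \<open>H\<close>, so \<open>H\<close> is a graph; its closure under multiplication is the cocycle
  identity.\<close>

lemma cocycle_graph_of_trivial_intersection:
  assumes H: "subgroup H Z2_SL2Z" and triv: "\<And>a. (a, mat 1) \<in> H \<Longrightarrow> a = 0"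
  obtains c where "cocycle (snd ` H) c" "H = cocycle_graph (snd ` H) c"
proof -
  interpret group Z2_SL2Z by (rule group_Z2_SL2Z)
  interpret SL: group SL2Z by (rule group_SL2Z)
  have HC: "H \<subseteq> carrier Z2_SL2Z" by (rule subgroup.subset[OF H])
  have uniq: "a = b" if ab: "(a, g) \<in> H" "(b, g) \<in> H" for a b g
  proof -
    define z where "z = (a, g) \<otimes>\<^bsub>Z2_SL2Z\<^esub> inv\<^bsub>Z2_SL2Z\<^esub> (b, g)"
    obtain d k where dk: "z = (d, k)" by (cases z)
    have zH: "z \<in> H" unfolding z_def by (intro subgroup.m_closed[OF H] subgroup.m_inv_closed[OF H] ab)
    have "z \<otimes>\<^bsub>Z2_SL2Z\<^esub> (b, g) = (a, g)"
      using subsetD[OF HC ab(1)] subsetD[OF HC ab(2)] by (simp add: z_def m_assoc del: Z2_SL2Z_simps)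
    then have eq: "d + k *v b = a" "k ** g = g" by (auto simp: dk)
    have "det k = 1" "det g = 1" using zH dk ab HC by auto
    then have "k = mat 1" using eq(2) SL.r_cancel_one[of g k] by simp
    then show ?thesis using eq(1) triv zH dk by auto
  qed
  define c where "c g = (THE a. (a, g) \<in> H)" for g
  have c: "c g = a" if "(a, g) \<in> H" for a g
    unfolding c_def using that uniq by (intro the_equality) auto
  show ?thesis
  proof (rule that[of c])
    show "cocycle (snd ` H) c" unfolding cocycle_def
    proof (intro ballI)
      fix g h assume "g \<in> snd ` H" "h \<in> snd ` H"
      then obtain a b where ab: "(a, g) \<in> H" "(b, h) \<in> H" by force
      then have "(a + g *v b, g ** h) \<in> H" using subgroup.m_closed[OF H ab] by simp
      then show "c (g ** h) = g *v c h + c g" using c ab by (simp add: add.commute)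
    qed
    show "H = cocycle_graph (snd ` H) c" using c by (force simp: cocycle_graph_def)
  qed
qed

lemma cocycle_coboundary: "cocycle S (\<lambda>g. \<xi> - g *v \<xi>)"
  by (simp add: cocycle_def matrix_vector_mul_assoc matrix_vector_mult_diff_distrib)

text \<open>The formula of a coboundary makes sense on the whole of \<open>SL2Z\<close> and provides
  an extension.\<close>

lemma inextendible_coboundary:
  assumes S: "subgroup S SL2Z" and ic: "inextendible_cocycle S c" and cb: "coboundary S c"
  shows "S = carrier SL2Z"
proof (rule ccontr)
  assume "S \<noteq> carrier SL2Z"
  then have ps: "S \<subset> carrier SL2Z" using subgroup.subset[OF S] by blast
  obtain \<xi> where \<xi>: "\<And>g. g \<in> S \<Longrightarrow> c g = \<xi> - g *v \<xi>" using cb unfolding coboundary_def by blast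
  have "cocycle_extends_beyond S c" unfolding cocycle_extends_beyond_def
    using group.subgroup_self[OF group_SL2Z] ps cocycle_coboundary[of "carrier SL2Z" \<xi>] \<xi>
    by (intro exI[of _ "carrier SL2Z"] exI[of _ "\<lambda>g. \<xi> - g *v \<xi>"]) auto
  then show False using ic by (simp add: inextendible_cocycle_def)
qed

text \<open>Comparing translation parts in \<open>y x = x k\<close>, with \<open>k\<close> of
  translation part 0, gives \<open>c t = a - t a\<close> for the translation part \<open>a\<close>
  of the conjugator. Its matrix part affects only which element of \<open>S\<close> corresponds to
  \<open>t\<close>, so the converse can take it to be the identity.\<close>

lemma conjugate_iff_coboundary:
  assumes S: "subgroup S SL2Z" and c: "cocycle S c"
  shows "conjugate_in Z2_SL2Z (cocycle_graph S c) ({0} \<times> S) \<longleftrightarrow> coboundary S c"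
proof -
  interpret group Z2_SL2Z by (rule group_Z2_SL2Z)
  note SD = subgroup_SL2Z_D[OF S]
  have conj_eq: "y = x \<otimes>\<^bsub>Z2_SL2Z\<^esub> k \<otimes>\<^bsub>Z2_SL2Z\<^esub> inv\<^bsub>Z2_SL2Z\<^esub> x \<longleftrightarrow> y \<otimes>\<^bsub>Z2_SL2Z\<^esub> x = x \<otimes>\<^bsub>Z2_SL2Z\<^esub> k"
    if "x \<in> carrier Z2_SL2Z" "y \<in> carrier Z2_SL2Z" "k \<in> carrier Z2_SL2Z" for x y k
    using that inv_solve_right[of y "x \<otimes>\<^bsub>Z2_SL2Z\<^esub> k" x] by auto
  show ?thesis
  proof
    assume "conjugate_in Z2_SL2Z (cocycle_graph S c) ({0} \<times> S)"
    then obtain x where x: "x \<in> carrier Z2_SL2Z"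
      "cocycle_graph S c = (\<lambda>k. x \<otimes>\<^bsub>Z2_SL2Z\<^esub> k \<otimes>\<^bsub>Z2_SL2Z\<^esub> inv\<^bsub>Z2_SL2Z\<^esub> x) ` ({0} \<times> S)"
      unfolding conjugate_in_def by blast
    obtain a g where ag: "x = (a, g)" by (cases x)
    have "c t = a - t *v a" if t: "t \<in> S" for t
    proof -
      have "(c t, t) \<in> cocycle_graph S c" using t by (auto simp: cocycle_graph_def)
      then obtain s where s: "s \<in> S" "(c t, t) = x \<otimes>\<^bsub>Z2_SL2Z\<^esub> (0, s) \<otimes>\<^bsub>Z2_SL2Z\<^esub> inv\<^bsub>Z2_SL2Z\<^esub> x"
        unfolding x(2) by blast
      then have "(c t, t) \<otimes>\<^bsub>Z2_SL2Z\<^esub> x = x \<otimes>\<^bsub>Z2_SL2Z\<^esub> (0, s)"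
        using conj_eq[OF x(1), of "(c t, t)" "(0, s)"] SD t by simp
      then show ?thesis by (simp add: ag algebra_simps)
    qed
    then show "coboundary S c" unfolding coboundary_def by blast
  next
    assume "coboundary S c"
    then obtain \<xi> where \<xi>: "\<And>g. g \<in> S \<Longrightarrow> c g = \<xi> - g *v \<xi>" unfolding coboundary_def by blast
    have xc: "(\<xi>, mat 1) \<in> carrier Z2_SL2Z" by simp
    have *: "(\<xi>, mat 1) \<otimes>\<^bsub>Z2_SL2Z\<^esub> (0, s) \<otimes>\<^bsub>Z2_SL2Z\<^esub> inv\<^bsub>Z2_SL2Z\<^esub> (\<xi>, mat 1) = (c s, s)" if "s \<in> S" for s
      using conj_eq[OF xc, of "(c s, s)" "(0, s)"] SD that \<xi> by simp
    have "cocycle_graph S c = (\<lambda>k. (\<xi>, mat 1) \<otimes>\<^bsub>Z2_SL2Z\<^esub> k \<otimes>\<^bsub>Z2_SL2Z\<^esub> inv\<^bsub>Z2_SL2Z\<^esub> (\<xi>, mat 1)) ` ({0} \<times> S)"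
    proof -
      have "(\<lambda>k. (\<xi>, mat 1) \<otimes>\<^bsub>Z2_SL2Z\<^esub> k \<otimes>\<^bsub>Z2_SL2Z\<^esub> inv\<^bsub>Z2_SL2Z\<^esub> (\<xi>, mat 1)) ` ({0} \<times> S) = (\<lambda>s. (c s, s)) ` S"
      proof -
        have "{0 :: Z2} \<times> S = (\<lambda>s. (0, s)) ` S" by auto
        then show ?thesis unfolding image_image[of _ "\<lambda>s. (0, s)" S, symmetric] by (simp only: image_image * cong: image_cong)
      qed
      then show ?thesis by (auto simp: cocycle_graph_def)
    qed
    then show "conjugate_in Z2_SL2Z (cocycle_graph S c) ({0} \<times> S)"
      unfolding conjugate_in_def using xc by blast
  qed
qed

lemma cocycle_graph_iso:
  assumes S: "subgroup S SL2Z"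
  shows "Z2_SL2Z\<lparr>carrier := cocycle_graph S c\<rparr> \<cong> SL2Z\<lparr>carrier := S\<rparr>"
proof -
  have "snd \<in> iso (Z2_SL2Z\<lparr>carrier := cocycle_graph S c\<rparr>) (SL2Z\<lparr>carrier := S\<rparr>)"
    by (auto simp: iso_def hom_def bij_betw_def inj_on_def cocycle_graph_def image_iff)
  then show ?thesis unfolding is_iso_def by blast
qed

section \<open>The two types of maximal Haagerup subgroups\<close>

lemma maximal_haagerupD:
  assumes "maximal_haagerup_subgroup H Z2_SL2Z"
  shows "subgroup H Z2_SL2Z" "haagerup (Z2_SL2Z\<lparr>carrier := H\<rparr>)"
    "\<And>K. subgroup K Z2_SL2Z \<Longrightarrow> haagerup (Z2_SL2Z\<lparr>carrier := K\<rparr>) \<Longrightarrow> H \<subseteq> K \<Longrightarrow> K = H"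
  using assms unfolding maximal_haagerup_subgroup_def by blast+

lemma subset_Times_snd_image: "H \<subseteq> UNIV \<times> snd ` H"
  by force

text \<open>The product of all translations with the image of \<open>H\<close> is Haagerup and
  contains \<open>H\<close>, so maximality gives equality. The same product over a larger amenable
  group would contradict maximality.\<close>

lemma maximal_haagerup_with_translation:
  assumes mx: "maximal_haagerup_subgroup H Z2_SL2Z" and a: "(a, mat 1) \<in> H" "a \<noteq> 0"
  shows "\<exists>C'. maximal_amenable_subgroup C' SL2Z \<and> H = UNIV \<times> C'"
proof -
  note mD = maximal_haagerupD[OF mx]
  define S where "S = snd ` H"
  have S: "subgroup S SL2Z" unfolding S_def by (rule subgroup_snd_image[OF mD(1)])
  have pe: "pairwise_elementary S" unfolding S_def by (rule haagerup_with_translation[OF mD(1,2) a])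
  have H: "H = UNIV \<times> S"
    using mD(3)[OF subgroup_Times[OF S] haagerup_Times[OF S pe]] subset_Times_snd_image[of H] S_def by simp
  have "maximal_amenable_subgroup S SL2Z"
    unfolding maximal_amenable_subgroup_def
  proof (intro conjI S notI)
    show "amenable (SL2Z\<lparr>carrier := S\<rparr>)" using amenable_iff_pairwise_elementary[OF S] pe by blast
    assume "\<exists>K. subgroup K SL2Z \<and> amenable (SL2Z\<lparr>carrier := K\<rparr>) \<and> S \<subset> K"
    then obtain K where K: "subgroup K SL2Z" "amenable (SL2Z\<lparr>carrier := K\<rparr>)" "S \<subset> K" by blast
    then have "UNIV \<times> K = H"
      using amenable_iff_pairwise_elementary[OF K(1)] H by (intro mD(3) subgroup_Times haagerup_Times) auto
    then show False using H K(3) by blast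
  qed
  with H show ?thesis by blast
qed

text \<open>The graph contains no nonzero translation, the product contains all translations as soon
  as it contains the identity.\<close>

lemma cocycle_graph_ne_Times:
  assumes "mat 1 \<in> S" "cocycle S c" shows "cocycle_graph S c \<noteq> UNIV \<times> C'"
proof
  assume eq: "cocycle_graph S c = UNIV \<times> C'"
  have "(0, mat 1) \<in> cocycle_graph S c" using assms cocycle_one by (force simp: cocycle_graph_def)
  then have "(axis 1 1, mat 1) \<in> cocycle_graph S c" unfolding eq by simp
  then have "(axis 1 1 :: Z2) = 0" using cocycle_one[OF assms(2,1)] by (auto simp: cocycle_graph_def)
  then show False by (simp add: axis_eq_0_iff)
qed

text \<open>Either defect would enlarge \<open>H\<close> to a Haagerup subgroup: an amenable image
  gives the product with all translations, an extension of the cocycle gives a larger graph.\<close>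

lemma maximal_haagerup_without_translation:
  assumes mx: "maximal_haagerup_subgroup H Z2_SL2Z" and triv: "\<And>a. (a, mat 1) \<in> H \<Longrightarrow> a = 0"
  shows "\<exists>S c. subgroup S SL2Z \<and> \<not> amenable (SL2Z\<lparr>carrier := S\<rparr>) \<and> inextendible_cocycle S c \<and> H = cocycle_graph S c"
proof -
  note mD = maximal_haagerupD[OF mx]
  define S where "S = snd ` H"
  have S: "subgroup S SL2Z" unfolding S_def by (rule subgroup_snd_image[OF mD(1)])
  obtain c where c: "cocycle S c" "H = cocycle_graph S c"
    unfolding S_def by (rule cocycle_graph_of_trivial_intersection[OF mD(1) triv])
  have "\<not> amenable (SL2Z\<lparr>carrier := S\<rparr>)"
  proof
    assume "amenable (SL2Z\<lparr>carrier := S\<rparr>)"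
    then have "UNIV \<times> S = H"
      using amenable_iff_pairwise_elementary[OF S] subset_Times_snd_image[of H]
      by (intro mD(3) subgroup_Times haagerup_Times S) (auto simp: S_def)
    then show False using cocycle_graph_ne_Times[OF subgroup_SL2Z_D(3)[OF S] c(1)] c(2) by blast
  qed
  moreover have "\<not> cocycle_extends_beyond S c"
  proof
    assume "cocycle_extends_beyond S c"
    then obtain T d where T: "subgroup T SL2Z" "S \<subset> T" "cocycle T d" "\<And>g. g \<in> S \<Longrightarrow> d g = c g"
      unfolding cocycle_extends_beyond_def by blast
    have "cocycle_graph T d = H"
      using T by (intro mD(3) subgroup_cocycle_graph haagerup_cocycle_graph) (force simp: c(2) cocycle_graph_def)+
    then have "snd ` cocycle_graph T d = snd ` cocycle_graph S c" using c(2) by simp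
    then show False using T(2) by (force simp: cocycle_graph_def image_def)
  qed
  ultimately show ?thesis using S c unfolding inextendible_cocycle_def by blast
qed

text \<open>A Haagerup overgroup contains translations, so its image is amenable and equals
  \<open>C'\<close> by maximality; but then it lies inside the product.\<close>

lemma maximal_haagerup_Times:
  assumes mx: "maximal_amenable_subgroup C' SL2Z"
  shows "maximal_haagerup_subgroup (UNIV \<times> C') Z2_SL2Z"
proof -
  have C: "subgroup C' SL2Z" "amenable (SL2Z\<lparr>carrier := C'\<rparr>)"
    and Cmax: "\<And>K. subgroup K SL2Z \<Longrightarrow> amenable (SL2Z\<lparr>carrier := K\<rparr>) \<Longrightarrow> C' \<subseteq> K \<Longrightarrow> K = C'"
    using mx unfolding maximal_amenable_subgroup_def by blast+
  have pe: "pairwise_elementary C'" using C amenable_iff_pairwise_elementary by blast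
  have False if K: "subgroup K Z2_SL2Z" "haagerup (Z2_SL2Z\<lparr>carrier := K\<rparr>)" "UNIV \<times> C' \<subset> K" for K
  proof -
    have one: "mat 1 \<in> C'" by (rule subgroup_SL2Z_D(3)[OF C(1)])
    then have "(axis 1 1, mat 1) \<in> K" using K(3) by blast
    then have "pairwise_elementary (snd ` K)"
      by (rule haagerup_with_translation[OF K(1,2)]) (simp add: axis_eq_0_iff)
    then have "amenable (SL2Z\<lparr>carrier := snd ` K\<rparr>)"
      using amenable_iff_pairwise_elementary[OF subgroup_snd_image[OF K(1)]] by blast
    moreover have "C' \<subseteq> snd ` K" using K(3) by force
    ultimately have "snd ` K = C'" using Cmax subgroup_snd_image[OF K(1)] by blast
    then show False using K(3) by force
  qed
  then show ?thesis unfolding maximal_haagerup_subgroup_def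
    using subgroup_Times[OF C(1)] haagerup_Times[OF C(1) pe] by blast
qed

text \<open>The image of a Haagerup overgroup contains a non-commuting pair, so the overgroup meets
  the translations trivially. It is then itself the graph of a cocycle, and this cocycle extends
  \<open>c\<close>.\<close>

lemma maximal_haagerup_cocycle_graph:
  assumes S: "subgroup S SL2Z" and na: "\<not> amenable (SL2Z\<lparr>carrier := S\<rparr>)" and ic: "inextendible_cocycle S c"
  shows "maximal_haagerup_subgroup (cocycle_graph S c) Z2_SL2Z"
proof -
  have c: "cocycle S c" and next': "\<not> cocycle_extends_beyond S c" using ic by (auto simp: inextendible_cocycle_def)
  have npe: "\<not> pairwise_elementary S" using na amenable_iff_pairwise_elementary[OF S] by blast
  have False if K: "subgroup K Z2_SL2Z" "haagerup (Z2_SL2Z\<lparr>carrier := K\<rparr>)" "cocycle_graph S c \<subset> K" for K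
  proof -
    have SK: "S \<subseteq> snd ` K" using K(3) by (force simp: cocycle_graph_def)
    have "a = 0" if "(a, mat 1) \<in> K" for a
    proof (rule ccontr)
      assume "a \<noteq> 0"
      then have "pairwise_elementary (snd ` K)" by (rule haagerup_with_translation[OF K(1,2) that])
      then show False using npe SK unfolding pairwise_elementary_def by blast
    qed
    then obtain d where d: "cocycle (snd ` K) d" "K = cocycle_graph (snd ` K) d"
      by (rule cocycle_graph_of_trivial_intersection[OF K(1)])
    have dc: "d g = c g" if "g \<in> S" for g
    proof -
      have "(c g, g) \<in> cocycle_graph (snd ` K) d" using that K(3) d(2) by (auto simp: cocycle_graph_def)
      then show ?thesis by (auto simp: cocycle_graph_def)
    qed
    have "S \<noteq> snd ` K"
    proof
      assume eq: "S = snd ` K"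
      have "K = cocycle_graph S d" using d(2) unfolding eq[symmetric] .
      also have "\<dots> = cocycle_graph S c" using dc by (force simp: cocycle_graph_def)
      finally have "K = cocycle_graph S c" .
      then show False using K(3) by simp
    qed
    then have "cocycle_extends_beyond S c" unfolding cocycle_extends_beyond_def
      using SK d(1) dc subgroup_snd_image[OF K(1)] by (intro exI[of _ "snd ` K"] exI[of _ d]) auto
    then show False using next' by contradiction
  qed
  then show ?thesis unfolding maximal_haagerup_subgroup_def
    using subgroup_cocycle_graph[OF S c] haagerup_cocycle_graph[OF S c] by blast
qed

theorem theorem2p12:
  "(\<forall>H. maximal_haagerup_subgroup H Z2_SL2Z \<longrightarrow>
      ((\<exists>C'. maximal_amenable_subgroup C' SL2Z \<and> H = UNIV \<times> C') \<noteq>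
       (\<exists>S c. subgroup S SL2Z \<and> \<not> amenable (SL2Z\<lparr>carrier := S\<rparr>) \<and>
          inextendible_cocycle S c \<and> H = cocycle_graph S c)) \<and>
      (\<forall>S c. subgroup S SL2Z \<and> \<not> amenable (SL2Z\<lparr>carrier := S\<rparr>) \<and>
          inextendible_cocycle S c \<and> H = cocycle_graph S c \<longrightarrow>
          Z2_SL2Z\<lparr>carrier := H\<rparr> \<cong> SL2Z\<lparr>carrier := S\<rparr> \<and>
          (conjugate_in Z2_SL2Z H ({0} \<times> S) \<longleftrightarrow> coboundary S c) \<and>
          (coboundary S c \<longrightarrow> S = carrier SL2Z))) \<and>
   (\<forall>C'. maximal_amenable_subgroup C' SL2Z \<longrightarrow>
      maximal_haagerup_subgroup (UNIV \<times> C') Z2_SL2Z) \<and>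
   (\<forall>S c. subgroup S SL2Z \<and> \<not> amenable (SL2Z\<lparr>carrier := S\<rparr>) \<and>
      inextendible_cocycle S c \<longrightarrow>
      maximal_haagerup_subgroup (cocycle_graph S c) Z2_SL2Z)"
proof (intro conjI allI impI; (elim conjE)?)
  fix H assume mx: "maximal_haagerup_subgroup H Z2_SL2Z"
  have "(\<exists>C'. maximal_amenable_subgroup C' SL2Z \<and> H = UNIV \<times> C') \<or>
       (\<exists>S c. subgroup S SL2Z \<and> \<not> amenable (SL2Z\<lparr>carrier := S\<rparr>) \<and>
          inextendible_cocycle S c \<and> H = cocycle_graph S c)"
    using maximal_haagerup_with_translation[OF mx] maximal_haagerup_without_translation[OF mx] by blast
  moreover have "\<not> ((\<exists>C'. maximal_amenable_subgroup C' SL2Z \<and> H = UNIV \<times> C') \<and>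
       (\<exists>S c. subgroup S SL2Z \<and> \<not> amenable (SL2Z\<lparr>carrier := S\<rparr>) \<and>
          inextendible_cocycle S c \<and> H = cocycle_graph S c))"
    using cocycle_graph_ne_Times subgroup_SL2Z_D(3) unfolding inextendible_cocycle_def by metis
  ultimately show "(\<exists>C'. maximal_amenable_subgroup C' SL2Z \<and> H = UNIV \<times> C') \<noteq>
       (\<exists>S c. subgroup S SL2Z \<and> \<not> amenable (SL2Z\<lparr>carrier := S\<rparr>) \<and>
          inextendible_cocycle S c \<and> H = cocycle_graph S c)" by argo
next
  fix H S c assume "subgroup S SL2Z" "H = cocycle_graph S c" "inextendible_cocycle S c"
  then show "Z2_SL2Z\<lparr>carrier := H\<rparr> \<cong> SL2Z\<lparr>carrier := S\<rparr>"
    and "conjugate_in Z2_SL2Z H ({0} \<times> S) \<longleftrightarrow> coboundary S c"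
    using cocycle_graph_iso conjugate_iff_coboundary by (auto simp: inextendible_cocycle_def)
next
  fix S c assume "subgroup S SL2Z" "inextendible_cocycle S c" "coboundary S c"
  then show "S = carrier SL2Z" by (rule inextendible_coboundary)
next
  fix C' assume "maximal_amenable_subgroup C' SL2Z"
  then show "maximal_haagerup_subgroup (UNIV \<times> C') Z2_SL2Z" by (rule maximal_haagerup_Times)
next
  fix S c assume "subgroup S SL2Z" "\<not> amenable (SL2Z\<lparr>carrier := S\<rparr>)" "inextendible_cocycle S c"
  then show "maximal_haagerup_subgroup (cocycle_graph S c) Z2_SL2Z" by (rule maximal_haagerup_cocycle_graph)
qed

end
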